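(* Let $d\ge2$. Assume $\mathcal L=\tau_*(\Lambda)$, where the measurable function $\tau:[0,1]\to\mathbb R$ satisfies $$\int_0^1e^{\alpha\tau^-(u)^\beta}\,du<\infty\quad\text{for some }\alpha>0\text{ and }\beta>1.$$ (a) The time constant $\mu_{\mathbb T_d}=\mu_{\mathbb T_d}(\tau)=\lim_{n\to\infty}T_n/n$ is given by the variational formula $$\mu_{\mathbb T_d}(\tau)=\inf_{\hat\sigma\in\hat\Sigma:\,D_{\mathrm{KL}}(\hat\sigma\|\Lambda)\le\log d}\langle\tau,\hat\sigma\rangle.$$ (b) The set of minimizers is nonempty: $$\mathcal R^{\mathbb T_d}_\tau:=\{\hat\sigma\in\hat\Sigma:D_{\mathrm{KL}}(\hat\sigma\|\Lambda)\le\log d,\ \langle\tau,\hat\sigma\rangle=\mu_{\mathbb T_d}(\tau)\}\ne\varnothing.$$ (c) Almost surely, for any increasing sequence of integers $(n_k)_{k\ge1}$ and any sequence $(x_{n_k})_{k\ge1}$ in $\mathbb T_d$ such that $|x_{n_k}|=n_k$ and $T(x_{n_k})/n_k\to\mu_{\mathbb T_d}$ as $k\to\infty$, there is a subsequence $(x_{n_{k_j}})_{j\ge1}$ such that $$\hat\sigma_{x_{n_{k_j}}}\Rightarrow\hat\sigma\quad\text{as }j\to\infty,\quad\text{for some }\hat\sigma\in\mathcal R^{\mathbb T_d}_\tau,$$ in which case $\hat\nu_{x_{n_{k_j}}}\Rightarrow\tau_*(\hat\sigma)$. (d) Let $\mathfrak b\in[-\infty,\infty)$ denote the essential infimum of $\mathcal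 L$. If $\mathbb P(\tau_x=\mathfrak b)\ge1/d$, then $\tau_*(\hat\sigma)=\delta_{\mathfrak b}$ for every $\hat\sigma\in\mathcal R^{\mathbb T_d}_\tau$. If instead $\mathbb P(\tau_x=\mathfrak b)<1/d$, then $\mathcal R^{\mathbb T_d}_\tau=\{\hat\sigma_\star\}$, where $\hat\sigma_\star$ is the unique solution to $$\min D_{\mathrm{KL}}(\hat\sigma\|\Lambda)\quad\text{subject to}\quad\langle\tau,\hat\sigma\rangle=\mu_{\mathbb T_d}(\tau).$$
   Context: $\mathbb T_d$ is the infinite rooted tree in which every node has exactly $d$ children, with root $0$; $|x|$ is the graph distance from $x$ to the root, and $y\le x$ means that $y$ is an ancestor of $x$ (allowing $y=x$). $(U_x)_{x\in\mathbb T_d}$ are i.i.d. uniform on $[0,1]$ on a complete probability space and $\tau_x=\tau(U_x)$, with law $\mathcal L$. $\Lambda$ is Lebesgue measure on $[0,1]$, $\tau_*(\cdot)$ is pushforward by $\tau$, $\tau^-=\max(-\tau,0)$, $\langle f,\sigma\rangle=\int f\,d\sigma$, and $\Rightarrow$ is weak convergence. $T(x)=\sum_{0<y\le x}\tau_y$ (the sum is over the non-root ancestors $y$ of $x$, including $x$), $T_n=\inf_{x:|x|=n}T(x)$ for integers $n$. Under the stated assumption, $T_n/n$ converges almost surely to a deterministic constant $\mu_{\mathbb T_d}\in\mathbb R$. Empirical measures: $\hat\nu_x=\frac1{|x|}\sum_{0<y\le x}\delta_{\tau_y}$ and $\hat\sigma_x=\frac1{|x|}\sum_{0<y\le x}\delta_{U_y}$.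 $\hat\Sigma$ is the set of Borel probability measures on $[0,1]$. $D_{\mathrm{KL}}(\hat\sigma\|\Lambda)=\int_0^1\log\frac{d\hat\sigma}{d\Lambda}\,d\hat\sigma$ if $\hat\sigma\ll\Lambda$, and $+\infty$ otherwise. *)

theory Defs
  imports "HOL-Probability.Probability" "HOL-Library.Sublist"
begin

section \<open>The rooted tree\<close>

text \<open>
  A node is the word of child indices on the path leading to it from the root \<^term>\<open>[]\<close>; the
  children of \<open>x\<close> are \<open>x @ [i]\<close> for \<open>i < d\<close>. So \<open>|x|\<close> is \<^term>\<open>length x\<close>, and \<open>y\<close> is an ancestor
  of \<open>x\<close> (or \<open>x\<close> itself) iff \<^term>\<open>prefix y x\<close>.
\<close>

definition nodes :: "nat \<Rightarrow> nat list set" where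
  "nodes d = {x. set x \<subseteq> {..<d}}"

definition nonroot_ancestors :: "nat list \<Rightarrow> nat list set" where
  "nonroot_ancestors x = {y. prefix y x \<and> y \<noteq> []}"

lemma finite_nonroot_ancestors [simp]: "finite (nonroot_ancestors x)"
  by (rule finite_subset[of _ "set (prefixes x)"]) (auto simp: nonroot_ancestors_def)

definition path_sum :: "(real \<Rightarrow> real) \<Rightarrow> (nat list \<Rightarrow> 'w \<Rightarrow> real) \<Rightarrow> nat list \<Rightarrow> 'w \<Rightarrow> real" where
  "path_sum \<tau> U x \<omega> = (\<Sum>y\<in>nonroot_ancestors x. \<tau> (U y \<omega>))"

definition level_min :: "nat \<Rightarrow> (real \<Rightarrow> real) \<Rightarrow> (nat list \<Rightarrow> 'w \<Rightarrow> real) \<Rightarrow> nat \<Rightarrow> 'w \<Rightarrow> real" where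
  "level_min d \<tau> U n \<omega> = (INF x\<in>{x\<in>nodes d. length x = n}. path_sum \<tau> U x \<omega>)"

text \<open>The deterministic almost sure limit of \<open>T\<^sub>n/n\<close>; meaningful only when this limit exists.\<close>

definition time_constant ::
    "'w measure \<Rightarrow> nat \<Rightarrow> (real \<Rightarrow> real) \<Rightarrow> (nat list \<Rightarrow> 'w \<Rightarrow> real) \<Rightarrow> real" where
  "time_constant M d \<tau> U =
     (THE c. AE \<omega> in M. (\<lambda>n. level_min d \<tau> U n \<omega> / real n) \<longlonglongrightarrow> c)"

section \<open>Measures on the unit interval\<close>

definition unit_lebesgue :: "real measure" where
  "unit_lebesgue = restrict_space lborel {0..1}"

lemma space_unit_lebesgue [simp]: "space unit_lebesgue = {0..1}"
  by (simp add: unit_lebesgue_def space_restrict_space)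

lemma sets_unit_lebesgue [measurable_cong]:
  "sets unit_lebesgue = sets (restrict_space borel {0..1})"
  unfolding unit_lebesgue_def by (intro sets_restrict_space_cong) simp

lemma prob_space_unit_lebesgue: "prob_space unit_lebesgue"
  by (intro prob_spaceI)
     (simp add: unit_lebesgue_def space_restrict_space emeasure_restrict_space)

definition unit_prob_measures :: "real measure set" where
  "unit_prob_measures = {\<sigma>. prob_space \<sigma> \<and> sets \<sigma> = sets (restrict_space borel {0..1})}"

text \<open>
  \<open>\<langle>f,\<sigma>\<rangle>\<close> as an extended real, since the integral may be \<open>\<plusminus>\<infinity>\<close> (the Bochner integral would return
  \<open>0\<close> there). If positive and negative part both have infinite integral, the integral does not
  exist; the value is then \<open>\<infinity> - \<infinity> = \<infinity>\<close>, so that a finite value always means that the integral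
  exists.
\<close>

definition ext_integral :: "('a \<Rightarrow> real) \<Rightarrow> 'a measure \<Rightarrow> ereal" where
  "ext_integral f \<sigma> =
     enn2ereal (\<integral>\<^sup>+u. ennreal (f u) \<partial>\<sigma>) - enn2ereal (\<integral>\<^sup>+u. ennreal (- f u) \<partial>\<sigma>)"

lemma ext_integral_eq_integral:
  assumes "integrable \<sigma> f"
  shows "ext_integral f \<sigma> = ereal (integral\<^sup>L \<sigma> f)"
proof -
  have "(\<integral>\<^sup>+u. ennreal (f u) \<partial>\<sigma>) \<noteq> \<infinity>" "(\<integral>\<^sup>+u. ennreal (- f u) \<partial>\<sigma>) \<noteq> \<infinity>"
    using assms by (auto simp: real_integrable_def)
  then show ?thesis
    unfolding ext_integral_def real_lebesgue_integral_def[OF assms]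
    by (cases "\<integral>\<^sup>+u. ennreal (f u) \<partial>\<sigma>"; cases "\<integral>\<^sup>+u. ennreal (- f u) \<partial>\<sigma>")
       (auto simp: enn2ereal_ennreal)
qed

text \<open>
  The library's \<^const>\<open>KL_divergence\<close> is a Bochner integral and does not take the value \<open>\<infinity>\<close>. The
  density vanishes or is infinite only on a \<open>\<sigma>\<close>-null set, so \<open>ln 0 = 0\<close> and \<open>enn2real \<infinity> = 0\<close> do
  not matter; the negative part of the integral below is always finite for probability measures.
\<close>

definition kl_div :: "'a measure \<Rightarrow> 'a measure \<Rightarrow> ereal" where
  "kl_div \<sigma> \<Lambda> =
     (if absolutely_continuous \<Lambda> \<sigma>
      then ext_integral (\<lambda>u. ln (enn2real (RN_deriv \<Lambda> \<sigma> u))) \<sigma> else \<infinity>)"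

lemma kl_div_eq_KL_divergence:
  assumes "absolutely_continuous \<Lambda> \<sigma>" "integrable \<sigma> (entropy_density (exp 1) \<Lambda> \<sigma>)"
  shows "kl_div \<sigma> \<Lambda> = ereal (KL_divergence (exp 1) \<Lambda> \<sigma>)"
proof -
  have "(\<lambda>u. ln (enn2real (RN_deriv \<Lambda> \<sigma> u))) = entropy_density (exp 1) \<Lambda> \<sigma>"
    by (simp add: entropy_density_def comp_def log_def)
  with assms show ?thesis
    by (simp add: kl_div_def KL_divergence_def ext_integral_eq_integral)
qed

definition kl_ball :: "nat \<Rightarrow> real measure set" where
  "kl_ball d = {\<sigma>\<in>unit_prob_measures. kl_div \<sigma> unit_lebesgue \<le> ereal (ln (real d))}"

definition minimizers :: "nat \<Rightarrow> (real \<Rightarrow> real) \<Rightarrow> real \<Rightarrow> real measure set" where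
  "minimizers d \<tau> \<mu> = {\<sigma>\<in>kl_ball d. ext_integral \<tau> \<sigma> = ereal \<mu>}"

text \<open>Weak convergence on \<open>[0,1]\<close>; on the line the library's \<^const>\<open>weak_conv_m\<close> is used.\<close>

definition weak_conv_unit :: "(nat \<Rightarrow> real measure) \<Rightarrow> real measure \<Rightarrow> bool" where
  "weak_conv_unit \<sigma>s \<sigma> \<longleftrightarrow>
     (\<forall>f::real \<Rightarrow> real. continuous_on {0..1} f \<longrightarrow>
        (\<lambda>n. integral\<^sup>L (\<sigma>s n) f) \<longlonglongrightarrow> integral\<^sup>L \<sigma> f)"

section \<open>Empirical measures\<close>

text \<open>
  The average of the point masses at \<open>f y\<close> over the non-root ancestors \<open>y\<close> of \<open>x\<close>, on the
  \<open>\<sigma>\<close>-algebra of \<open>N\<close>. At the root this is the null measure.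
\<close>

definition empirical :: "'b measure \<Rightarrow> (nat list \<Rightarrow> 'b) \<Rightarrow> nat list \<Rightarrow> 'b measure" where
  "empirical N f x = measure_of (space N) (sets N)
     (\<lambda>A. (\<Sum>y\<in>nonroot_ancestors x. emeasure (return N (f y)) A) / of_nat (length x))"

lemma sets_empirical [simp, measurable_cong]: "sets (empirical N f x) = sets N"
  by (simp add: empirical_def)

lemma space_empirical [simp]: "space (empirical N f x) = space N"
  by (simp add: empirical_def)

lemma emeasure_empirical:
  assumes "A \<in> sets N"
  shows "emeasure (empirical N f x) A =
    (\<Sum>y\<in>nonroot_ancestors x. indicator A (f y)) / of_nat (length x)"
proof -
  let ?m = "\<lambda>A. (\<Sum>y\<in>nonroot_ancestors x. emeasure (return N (f y)) A) / of_nat (length x)"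
  have "countably_additive (sets N) ?m"
  proof (rule countably_additiveI)
    fix A :: "nat \<Rightarrow> _" assume A: "range A \<subseteq> sets N" "disjoint_family A"
    have "(\<Sum>i. ?m (A i)) =
        (\<Sum>i. \<Sum>y\<in>nonroot_ancestors x. emeasure (return N (f y)) (A i)) / of_nat (length x)"
      by (simp add: divide_ennreal_def)
    also have "(\<Sum>i. \<Sum>y\<in>nonroot_ancestors x. emeasure (return N (f y)) (A i)) =
        (\<Sum>y\<in>nonroot_ancestors x. \<Sum>i. emeasure (return N (f y)) (A i))"
      by (rule suminf_sum) simp
    also have "\<dots> = (\<Sum>y\<in>nonroot_ancestors x. emeasure (return N (f y)) (\<Union>i. A i))"
      using A by (intro sum.cong refl suminf_emeasure) auto
    finally show "(\<Sum>i. ?m (A i)) = ?m (\<Union>i. A i)" .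
  qed
  moreover have "positive (sets N) ?m"
    by (simp add: positive_def)
  ultimately show ?thesis
    unfolding empirical_def using assms
    by (subst emeasure_measure_of_sigma) (simp_all add: sets.sigma_algebra_axioms)
qed

definition empirical_unit :: "(nat list \<Rightarrow> 'w \<Rightarrow> real) \<Rightarrow> nat list \<Rightarrow> 'w \<Rightarrow> real measure" where
  "empirical_unit U x \<omega> = empirical (restrict_space borel {0..1}) (\<lambda>y. U y \<omega>) x"

definition empirical_weight ::
    "(real \<Rightarrow> real) \<Rightarrow> (nat list \<Rightarrow> 'w \<Rightarrow> real) \<Rightarrow> nat list \<Rightarrow> 'w \<Rightarrow> real measure" where
  "empirical_weight \<tau> U x \<omega> = empirical borel (\<lambda>y. \<tau> (U y \<omega>)) x"

section \<open>Essential infimum\<close>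

text \<open>Dual to the definition of \<^const>\<open>esssup\<close>: the largest \<open>z\<close> with \<open>z \<le> t\<close> for \<open>L\<close>-almost all \<open>t\<close>.\<close>

definition ess_inf :: "real measure \<Rightarrow> ereal" where
  "ess_inf L = Liminf (ae_filter L) ereal"

lemma ess_inf_eq_Sup: "ess_inf L = Sup {z. AE t in L. z \<le> ereal t}"
proof (rule antisym)
  show "ess_inf L \<le> Sup {z. AE t in L. z \<le> ereal t}"
    unfolding ess_inf_def Liminf_def
  proof (rule SUP_least)
    fix P assume "P \<in> {P. eventually P (ae_filter L)}"
    then have "AE t in L. Inf (ereal ` Collect P) \<le> ereal t"
      by (auto elim!: eventually_mono intro: INF_lower)
    then show "Inf (ereal ` Collect P) \<le> Sup {z. AE t in L. z \<le> ereal t}"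
      by (intro Sup_upper) simp
  qed
  show "Sup {z. AE t in L. z \<le> ereal t} \<le> ess_inf L"
    unfolding ess_inf_def by (intro Sup_least Liminf_bounded) simp
qed

end

(*
For a bounded or continuous test function g, a Chernoff bound for one path and a union bound over
the d^n paths to level n show that, almost surely, the average of g along any long path is at most
log d + log (int exp g) up to a vanishing error. For countably many g at once this forces every
weak limit s of empirical measures to satisfy the Donsker-Varadhan inequality
<g,s> <= log d + log (int exp g), hence D_KL(s | Lambda) <= log d. Test functions theta |h - g_m| with
g_m continuous and g_m -> h, and theta (tau^- - K)^+, transfer the convergence to bounded measurable
h and give <tau,s> <= lim T(x_n)/n. This is the lower bound, the existence of minimizers, and (c).

For the upper bound, a density with entropy below log d and mean below eta is tilted to show that
for some k the expected number of paths of length k with sum at most k eta exceeds 1. Such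
blocks percolate with positive probability by a second moment recursion, and a zero-one argument
makes T_n <= eta n + O(1) almost sure.

For (d), if P(tau = b) < 1/d then {tau < mu} has positive measure, so mixing a minimizer with the
uniform law on that set shows that D_KL < log d is impossible at mean mu; strict convexity of the
entropy then gives uniqueness.
*)

theory Submission
  imports Defs "HOL-Real_Asymp.Real_Asymp"
begin

section \<open>Relative entropy on the unit interval\<close>

text \<open>The union bound costs ln d however small the test function is, so a Chernoff bound for g
  alone never shows that averages of g tend to 0. The remedy is the factor theta: applied to theta *
  g, it bounds the average of g by (ln d + ln int exp (theta g)) / theta, and theta is fixed large
  before the approximation is refined. For the negative part of tau this calls for every exponential
  moment, which is what beta > 1 gives. Empirical measures are atomic, so weak convergence by itself
  says nothing about a merely measurable tau; these bounds stand in for continuity. Large positive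
  weights are not controlled and may escape, hence only an inequality for the mean of a limit. Paths
  may be chosen after seeing the outcome, so each null set has to be fixed beforehand for countably
  many test functions. In the upper bound, strict inequalities for entropy and mean are what makes
  the expected number of good blocks exceed 1; they are reached by mixing in a little of a law of
  small entropy. A cap on the single weights of a block handles the levels that are not multiples of
  the block length.\<close>

interpretation unit_lebesgue: prob_space unit_lebesgue
  by (rule prob_space_unit_lebesgue)

lemma borel_measurable_unit_lebesgue:
  "borel_measurable unit_lebesgue = borel_measurable (restrict_space borel {0..1})"
  by (rule measurable_cong_sets[OF sets_unit_lebesgue refl])

text \<open>Young's inequality for the conjugate pair x ln x - x and exp y: the bound 1 + v <= exp v
  at v = y - ln x, multiplied by x.\<close>

lemma mult_le_entropy_plus_exp:
  fixes x y :: real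
  assumes "0 \<le> x"
  shows "x * y \<le> x * ln x - x + exp y"
proof (cases "x = 0")
  case False
  then have "x > 0" using assms by simp
  have "1 + (y - ln x) \<le> exp (y - ln x)" by (rule exp_ge_add_one_self)
  also have "\<dots> = exp y / x" using \<open>x > 0\<close> by (simp add: exp_diff)
  finally show ?thesis using \<open>x > 0\<close> by (simp add: field_simps)
qed simp

text \<open>In Young's inequality with y = ln z, equality holds only at x = z. This is the source of
  all strictness in the uniqueness proof.\<close>

lemma mult_ln_less_entropy:
  fixes x z :: real
  assumes "0 \<le> x" "0 < z" "x \<noteq> z"
  shows "x * ln z < x * ln x - x + z"
proof (cases "x = 0")
  case False
  then have "x > 0" using assms by simp
  have "ln (z / x) < z / x - 1"
    using ln_le_minus_one[of "z / x"] ln_eq_minus_one[of "z / x"] assms \<open>x > 0\<close>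
    by (force simp: less_le)
  then show ?thesis using \<open>x > 0\<close> assms(2) by (simp add: field_simps ln_div)
qed (use assms in simp)

lemma entropy_ge: "0 \<le> x \<Longrightarrow> -1 \<le> x * ln x" for x :: real
  using mult_le_entropy_plus_exp[of x 0] by simp

text \<open>Average Young's inequality at x and at y, both with slope ln z; since z is the average
  of x and y, the linear terms cancel. The case z = 0 is separate because the tangent there is
  vertical.\<close>

lemma entropy_convex:
  fixes x y t :: real
  assumes "0 \<le> x" "0 \<le> y" "0 \<le> t" "t \<le> 1"
  defines "z \<equiv> (1 - t) * x + t * y"
  shows "z * ln z \<le> (1 - t) * (x * ln x) + t * (y * ln y)"
proof (cases "z = 0")
  case True
  then have "(1 - t) * x = 0" "t * y = 0"
    using assms by (auto simp: z_def add_nonneg_eq_0_iff)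
  then show ?thesis using True by (auto simp: mult.assoc[symmetric])
next
  case False
  have "0 \<le> z" using assms by (simp add: z_def)
  with False have "z > 0" by simp
  have "(1 - t) * (x * ln z) \<le> (1 - t) * (x * ln x - x + z)" "t * (y * ln z) \<le> t * (y * ln y - y + z)"
    using mult_le_entropy_plus_exp[of x "ln z"] mult_le_entropy_plus_exp[of y "ln z"] \<open>z > 0\<close> assms
    by (auto intro!: mult_left_mono)
  then show ?thesis by (simp add: z_def algebra_simps)
qed

lemma entropy_strict_convex:
  fixes x y t :: real
  assumes "0 \<le> x" "0 \<le> y" "0 < t" "t < 1" "x \<noteq> y"
  defines "z \<equiv> (1 - t) * x + t * y"
  shows "z * ln z < (1 - t) * (x * ln x) + t * (y * ln y)"
proof -
  have "z > 0"
    using assms by (cases "x = 0") (auto simp: z_def intro: add_pos_nonneg)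
  have "x \<noteq> z"
    using assms by (auto simp: z_def algebra_simps)
  have "(1 - t) * (x * ln z) < (1 - t) * (x * ln x - x + z)"
    using mult_ln_less_entropy[of x z] \<open>z > 0\<close> \<open>x \<noteq> z\<close> assms by (auto intro!: mult_strict_left_mono)
  moreover have "t * (y * ln z) \<le> t * (y * ln y - y + z)"
    using mult_le_entropy_plus_exp[of y "ln z"] \<open>z > 0\<close> assms by (auto intro!: mult_left_mono)
  ultimately show ?thesis by (simp add: z_def algebra_simps)
qed

section \<open>Probability densities of finite relative entropy\<close>

definition prob_density :: "(real \<Rightarrow> real) \<Rightarrow> bool" where
  "prob_density f \<longleftrightarrow> (\<forall>u. 0 \<le> f u) \<and> integrable unit_lebesgue f \<and> (\<integral>u. f u \<partial>unit_lebesgue) = 1"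

definition finite_entropy :: "(real \<Rightarrow> real) \<Rightarrow> bool" where
  "finite_entropy f \<longleftrightarrow> prob_density f \<and> integrable unit_lebesgue (\<lambda>u. f u * ln (f u))"

text \<open>A Bochner integral, hence meaningful only under \<open>finite_entropy\<close>, where
  \<open>kl_div_density\<close> identifies it with the divergence.\<close>

definition rel_entropy :: "(real \<Rightarrow> real) \<Rightarrow> real" where
  "rel_entropy f = (\<integral>u. f u * ln (f u) \<partial>unit_lebesgue)"

lemma prob_densityD:
  assumes "prob_density f"
  shows "\<And>u. 0 \<le> f u" "integrable unit_lebesgue f" "(\<integral>u. f u \<partial>unit_lebesgue) = 1"
    "f \<in> borel_measurable unit_lebesgue" "(\<integral>\<^sup>+u. ennreal (f u) \<partial>unit_lebesgue) = 1"
  using assms by (auto simp: prob_density_def nn_integral_eq_integral)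

lemma finite_entropyD:
  assumes "finite_entropy f"
  shows "prob_density f" "integrable unit_lebesgue (\<lambda>u. f u * ln (f u))"
  using assms by (auto simp: finite_entropy_def)

lemma emeasure_density_whole_space:
  assumes "f \<in> borel_measurable M"
  shows "emeasure (density M f) (space M) = (\<integral>\<^sup>+u. f u \<partial>M)"
  by (subst emeasure_density[OF assms sets.top]) (auto intro!: nn_integral_cong)

lemma unit_prob_measures_density:
  assumes "prob_density f"
  shows "density unit_lebesgue f \<in> unit_prob_measures"
proof -
  note [measurable] = prob_densityD(4)[OF assms]
  have "prob_space (density unit_lebesgue f)"
    by (intro prob_spaceI)
      (simp add: emeasure_density_whole_space[of _ unit_lebesgue, simplified] prob_densityD(5)[OF assms])
  then show ?thesis
    by (simp add: unit_prob_measures_def sets_unit_lebesgue)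
qed

lemma ext_integral_cong_AE:
  assumes "f \<in> borel_measurable M" "g \<in> borel_measurable M" "AE u in M. f u = g u"
  shows "ext_integral f M = ext_integral g M"
proof -
  have "(\<integral>\<^sup>+u. ennreal (f u) \<partial>M) = (\<integral>\<^sup>+u. ennreal (g u) \<partial>M)"
    "(\<integral>\<^sup>+u. ennreal (- f u) \<partial>M) = (\<integral>\<^sup>+u. ennreal (- g u) \<partial>M)"
    using assms(3) by (auto intro!: nn_integral_cong_AE)
  then show ?thesis by (simp add: ext_integral_def)
qed

lemma integrable_of_ext_integral_less_top:
  assumes [measurable]: "f \<in> borel_measurable M"
    and "ext_integral f M < \<infinity>" "(\<integral>\<^sup>+u. ennreal (- f u) \<partial>M) < \<infinity>"
  shows "integrable M f"
proof -
  have "(\<integral>\<^sup>+u. ennreal (f u) \<partial>M) \<noteq> \<infinity>"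
    using assms(2,3) by (auto simp: ext_integral_def)
  then show ?thesis using assms(3) by (simp add: real_integrable_def)
qed

lemma integrable_of_ext_integral_eq:
  assumes [measurable]: "f \<in> borel_measurable M" and "ext_integral f M = ereal m"
  shows "integrable M f \<and> integral\<^sup>L M f = m"
proof -
  have "(\<integral>\<^sup>+u. ennreal (f u) \<partial>M) \<noteq> \<infinity>" "(\<integral>\<^sup>+u. ennreal (- f u) \<partial>M) \<noteq> \<infinity>"
    using assms(2)
    by (cases "enn2ereal (\<integral>\<^sup>+u. ennreal (f u) \<partial>M)"; auto simp: ext_integral_def)+
  then have "integrable M f" by (simp add: real_integrable_def)
  then show ?thesis using assms(2) by (simp add: ext_integral_eq_integral)
qed

lemma AE_density_pos:
  fixes f :: "'a \<Rightarrow> real"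
  assumes "f \<in> borel_measurable M"
  shows "AE u in density M f. 0 < f u"
  using assms by (subst AE_density) auto

lemma RN_deriv_density_real:
  assumes "prob_density f"
  shows "AE u in unit_lebesgue. RN_deriv unit_lebesgue (density unit_lebesgue f) u = ennreal (f u)"
proof -
  have "f \<in> borel_measurable unit_lebesgue" using prob_densityD[OF assms] by auto
  then have "AE u in unit_lebesgue. ennreal (f u) = RN_deriv unit_lebesgue (density unit_lebesgue f) u"
    by (intro unit_lebesgue.RN_deriv_unique) auto
  then show ?thesis by (auto elim: eventually_mono)
qed

text \<open>Radon-Nikodym with a real-valued density: the extended density integrates to 1, so it is
  finite almost everywhere and \<open>enn2real\<close> alters it on a null set only.\<close>

lemma absolutely_continuous_unitE:
  assumes s: "s \<in> unit_prob_measures" and ac: "absolutely_continuous unit_lebesgue s"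
  obtains f where "prob_density f" "s = density unit_lebesgue f"
proof -
  interpret s: prob_space s using s by (simp add: unit_prob_measures_def)
  have sets: "sets s = sets unit_lebesgue"
    using s by (simp add: unit_prob_measures_def sets_unit_lebesgue)
  define R where "R = RN_deriv unit_lebesgue s"
  have [measurable]: "R \<in> borel_measurable unit_lebesgue" by (simp add: R_def)
  have dR: "density unit_lebesgue R = s"
    unfolding R_def by (rule unit_lebesgue.density_RN_deriv[OF ac sets])
  define f where "f u = enn2real (R u)" for u
  have [measurable]: "f \<in> borel_measurable unit_lebesgue" unfolding f_def by simp
  have int: "(\<integral>\<^sup>+u. R u \<partial>unit_lebesgue) = 1"
    using s.emeasure_space_1 emeasure_density_whole_space[of R unit_lebesgue] sets_eq_imp_space_eq[OF sets]
    by (simp add: dR)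
  have "AE u in unit_lebesgue. R u \<noteq> \<infinity>"
    by (intro nn_integral_PInf_AE) (auto simp: int)
  then have fR: "AE u in unit_lebesgue. ennreal (f u) = R u"
    by eventually_elim (auto simp: f_def less_top)
  have "density unit_lebesgue f = s"
    unfolding dR[symmetric] using fR by (intro density_cong) auto
  moreover have "(\<integral>\<^sup>+u. ennreal (f u) \<partial>unit_lebesgue) = 1"
    unfolding int[symmetric] using fR by (intro nn_integral_cong_AE) auto
  then have "prob_density f"
    by (auto simp: prob_density_def f_def integral_eq_nn_integral intro!: integrableI_bounded)
  ultimately show thesis using that by simp
qed

lemma kl_div_eq_ext_integral_density:
  assumes f: "prob_density f"
  shows "kl_div (density unit_lebesgue f) unit_lebesgue = ext_integral (\<lambda>u. ln (f u)) (density unit_lebesgue f)"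
proof -
  note D = prob_densityD[OF f]
  note [measurable] = D(4)
  let ?s = "density unit_lebesgue f"
  have ac: "absolutely_continuous unit_lebesgue ?s"
    by (rule absolutely_continuousI_density) simp
  have "AE u in ?s. RN_deriv unit_lebesgue ?s u = ennreal (f u)"
    using RN_deriv_density_real[OF f] by (subst AE_density) (auto elim: eventually_mono)
  then have "AE u in ?s. ln (enn2real (RN_deriv unit_lebesgue ?s u)) = ln (f u)"
    by eventually_elim (simp add: D(1))
  then have "ext_integral (\<lambda>u. ln (enn2real (RN_deriv unit_lebesgue ?s u))) ?s = ext_integral (\<lambda>u. ln (f u)) ?s"
    by (intro ext_integral_cong_AE) auto
  then show ?thesis using ac by (simp add: kl_div_def)
qed

lemma kl_div_density:
  assumes f: "finite_entropy f"
  shows "kl_div (density unit_lebesgue f) unit_lebesgue = ereal (rel_entropy f)"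
proof -
  note D = prob_densityD[OF finite_entropyD(1)[OF f]]
  note [measurable] = D(4)
  have "ext_integral (\<lambda>u. ln (f u)) (density unit_lebesgue f) = ereal (\<integral>u. ln (f u) \<partial>density unit_lebesgue f)"
    using finite_entropyD(2)[OF f] by (intro ext_integral_eq_integral) (simp add: integrable_density D(1))
  also have "(\<integral>u. ln (f u) \<partial>density unit_lebesgue f) = rel_entropy f"
    by (simp add: rel_entropy_def integral_density D(1))
  finally show ?thesis
    using finite_entropyD(1)[OF f] by (simp add: kl_div_eq_ext_integral_density)
qed

text \<open>Since x ln x >= -1, the negative part of \<open>ln f\<close> has integral at most 1
  under \<open>s\<close>; a finite divergence therefore leaves no room for a non-integrable positive
  part.\<close>

lemma kl_div_finiteE:
  assumes s: "s \<in> unit_prob_measures" and fin: "kl_div s unit_lebesgue < \<infinity>"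
  obtains f where "finite_entropy f" "s = density unit_lebesgue f"
    "kl_div s unit_lebesgue = ereal (rel_entropy f)"
proof -
  have "absolutely_continuous unit_lebesgue s"
    using fin by (auto simp: kl_div_def split: if_splits)
  then obtain f where f: "prob_density f" and s_eq: "s = density unit_lebesgue f"
    using absolutely_continuous_unitE[OF s] by blast
  note D = prob_densityD[OF f]
  note [measurable] = D(4)
  have "(\<integral>\<^sup>+u. ennreal (- ln (f u)) \<partial>s) = (\<integral>\<^sup>+u. ennreal (f u) * ennreal (- ln (f u)) \<partial>unit_lebesgue)"
    unfolding s_eq by (subst nn_integral_density) auto
  also have "\<dots> \<le> (\<integral>\<^sup>+u. 1 \<partial>unit_lebesgue)"
  proof (rule nn_integral_mono)
    fix u
    have "ennreal (f u) * ennreal (- ln (f u)) = ennreal (- (f u * ln (f u)))"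
      by (subst ennreal_mult'[symmetric]) (auto simp: D(1))
    also have "\<dots> \<le> 1" using entropy_ge[OF D(1)[of u]] by simp
    finally show "ennreal (f u) * ennreal (- ln (f u)) \<le> 1" .
  qed
  finally have neg: "(\<integral>\<^sup>+u. ennreal (- ln (f u)) \<partial>s) < \<infinity>"
    by (auto intro: le_less_trans simp: unit_lebesgue.emeasure_space_1[simplified])
  have "integrable s (\<lambda>u. ln (f u))"
    using fin neg unfolding s_eq kl_div_eq_ext_integral_density[OF f]
    by (intro integrable_of_ext_integral_less_top) auto
  then have "integrable unit_lebesgue (\<lambda>u. f u * ln (f u))"
    unfolding s_eq by (subst (asm) integrable_density) (auto simp: D(1))
  then have "finite_entropy f" using f by (simp add: finite_entropy_def)
  then show thesis using that kl_div_density s_eq by metis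
qed

text \<open>Adding 1 makes the integrand nonnegative, so the hypothesis can be a bound on a
  nonnegative integral, the form in which Fatou's lemma delivers it.\<close>

lemma finite_entropyI:
  assumes f: "prob_density f" and "0 \<le> 1 + c"
    and le: "(\<integral>\<^sup>+u. ennreal (f u * ln (f u) + 1) \<partial>unit_lebesgue) \<le> ennreal (1 + c)"
  shows "finite_entropy f \<and> rel_entropy f \<le> c"
proof -
  note D = prob_densityD[OF f]
  note [measurable] = D(4)
  have nn: "0 \<le> f u * ln (f u) + 1" for u using entropy_ge[OF D(1)[of u]] by simp
  have "integrable unit_lebesgue (\<lambda>u. f u * ln (f u) + 1)"
    using le nn by (intro integrableI_bounded) (auto intro: le_less_trans)
  from Bochner_Integration.integrable_diff[OF this, of "\<lambda>_. 1"]
  have i: "integrable unit_lebesgue (\<lambda>u. f u * ln (f u))" by simp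
  have "ennreal (\<integral>u. f u * ln (f u) + 1 \<partial>unit_lebesgue) \<le> ennreal (1 + c)"
    using le nn i by (subst nn_integral_eq_integral[symmetric]) auto
  then have "(\<integral>u. f u * ln (f u) + 1 \<partial>unit_lebesgue) \<le> 1 + c"
    using assms(2) by simp
  then show ?thesis using i f
    by (simp add: finite_entropy_def rel_entropy_def unit_lebesgue.prob_space[simplified])
qed

text \<open>Pointwise convexity, integrated; the lower bound -1 gives integrability of the mixture.
  For the equality case, the convexity gap is nonnegative with integral 0, so it vanishes almost
  everywhere, and strict convexity forces \<open>f u = g u\<close> there.\<close>

lemma finite_entropy_mix:
  assumes f: "finite_entropy f" and g: "finite_entropy g" and t: "0 \<le> t" "t \<le> 1"
  defines "h \<equiv> \<lambda>u. (1 - t) * f u + t * g u"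
  shows "finite_entropy h" "rel_entropy h \<le> (1 - t) * rel_entropy f + t * rel_entropy g"
    "rel_entropy h = (1 - t) * rel_entropy f + t * rel_entropy g \<Longrightarrow> 0 < t \<Longrightarrow> t < 1 \<Longrightarrow>
      AE u in unit_lebesgue. f u = g u"
proof -
  note F = prob_densityD[OF finite_entropyD(1)[OF f]] and G = prob_densityD[OF finite_entropyD(1)[OF g]]
  note [measurable] = F(4) G(4) and [simp] = F(2,3) G(2,3) finite_entropyD(2)[OF f] finite_entropyD(2)[OF g]
  have h: "prob_density h"
    using F(1) G(1) t by (auto simp: prob_density_def h_def)
  note [measurable] = prob_densityD(4)[OF h]
  define k where "k u = (1 - t) * (f u * ln (f u)) + t * (g u * ln (g u))" for u
  have k: "integrable unit_lebesgue k" "integral\<^sup>L unit_lebesgue k = (1 - t) * rel_entropy f + t * rel_entropy g"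
    by (simp_all add: k_def[abs_def] rel_entropy_def)
  have hk: "h u * ln (h u) \<le> k u" for u
    unfolding h_def k_def using F(1) G(1) t by (intro entropy_convex) auto
  have hl: "-1 \<le> h u * ln (h u)" for u using entropy_ge prob_densityD(1)[OF h] by simp
  have ih: "integrable unit_lebesgue (\<lambda>u. h u * ln (h u))"
  proof (rule Bochner_Integration.integrable_bound[where f="\<lambda>u. \<bar>k u\<bar> + 1"])
    show "AE u in unit_lebesgue. norm (h u * ln (h u)) \<le> norm (\<bar>k u\<bar> + 1)"
    proof (rule AE_I2)
      fix u show "norm (h u * ln (h u)) \<le> norm (\<bar>k u\<bar> + 1)"
        using hk[of u] hl[of u] unfolding real_norm_def by linarith
    qed
  qed (use k in auto)
  show "finite_entropy h" using h ih by (simp add: finite_entropy_def)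
  show "rel_entropy h \<le> (1 - t) * rel_entropy f + t * rel_entropy g"
    using integral_mono[OF ih k(1) hk] k(2) by (simp add: rel_entropy_def)
  assume eq: "rel_entropy h = (1 - t) * rel_entropy f + t * rel_entropy g" and t': "0 < t" "t < 1"
  have "(\<integral>u. k u - h u * ln (h u) \<partial>unit_lebesgue) = 0"
    using eq k ih by (simp add: rel_entropy_def)
  then have "AE u in unit_lebesgue. k u - h u * ln (h u) = 0"
    using hk by (subst (asm) integral_nonneg_eq_0_iff_AE) (use k ih in auto)
  then show "AE u in unit_lebesgue. f u = g u"
  proof eventually_elim
    case (elim u)
    then show ?case
      using entropy_strict_convex[of "f u" "g u" t] F(1) G(1) t' by (force simp: h_def k_def)
  qed
qed

definition uniform_density :: "real set \<Rightarrow> real \<Rightarrow> real" where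
  "uniform_density B u = indicator B u / measure unit_lebesgue B"

text \<open>These laws are the test measures of the proof: their entropy is near 0 when
  \<open>B\<close> has nearly full measure, and at most ln d when \<open>B\<close> has measure at
  least 1/d, the threshold in the atom dichotomy.\<close>

lemma finite_entropy_uniform_on:
  assumes B: "B \<in> sets unit_lebesgue" and pos: "0 < measure unit_lebesgue B"
  shows "finite_entropy (uniform_density B)"
    "rel_entropy (uniform_density B) = - ln (measure unit_lebesgue B)"
proof -
  let ?g = "uniform_density B"
  have e: "?g u * ln (?g u) = indicator B u * (- ln (measure unit_lebesgue B) / measure unit_lebesgue B)" for u
    using pos by (simp add: uniform_density_def[abs_def] ln_div indicator_def)
  have i: "integrable unit_lebesgue (indicator B :: real \<Rightarrow> real)"
    using B by (simp add: less_top[symmetric])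
  have *: "measure unit_lebesgue (B \<inter> {0..1}) = measure unit_lebesgue B"
    using sets.sets_into_space[OF B] by (simp add: Int_absorb2)
  show "finite_entropy ?g"
    unfolding finite_entropy_def e prob_density_def using i pos by (simp add: uniform_density_def[abs_def] *)
  show "rel_entropy ?g = - ln (measure unit_lebesgue B)"
    unfolding rel_entropy_def e using i pos by (simp add: *)
qed

text \<open>Young's inequality with x = \<open>f u\<close> and y = \<open>g u\<close> supplies an
  integrable majorant. It is applied to the negative part of the weight.\<close>

lemma integrable_mult_of_exp:
  assumes f: "finite_entropy f" and [measurable]: "g \<in> borel_measurable unit_lebesgue"
    and g: "\<And>u. 0 \<le> g u" and e: "integrable unit_lebesgue (\<lambda>u. exp (g u))"
  shows "integrable unit_lebesgue (\<lambda>u. f u * g u)"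
proof -
  note F = prob_densityD[OF finite_entropyD(1)[OF f]]
  note [measurable] = F(4)
  show ?thesis
  proof (rule Bochner_Integration.integrable_bound)
    show "integrable unit_lebesgue (\<lambda>u. f u * ln (f u) - f u + exp (g u))"
      using F(2) finite_entropyD(2)[OF f] e by simp
    show "AE u in unit_lebesgue. norm (f u * g u) \<le> norm (f u * ln (f u) - f u + exp (g u))"
      using mult_le_entropy_plus_exp[OF F(1)] g F(1) by (intro AE_I2) (auto intro: order_trans[OF _ abs_ge_self])
  qed simp
qed

lemma integrable_density_unit:
  assumes "prob_density f" "g \<in> borel_measurable unit_lebesgue"
  shows "integrable (density unit_lebesgue f) g \<longleftrightarrow> integrable unit_lebesgue (\<lambda>u. f u * g u)"
    "integral\<^sup>L (density unit_lebesgue f) g = (\<integral>u. f u * g u \<partial>unit_lebesgue)"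
  using prob_densityD[OF assms(1)] assms(2) by (simp_all add: integrable_density integral_density)

text \<open>A power above 1 dominates every linear function up to an additive constant, so one
  stretched moment gives all exponential moments.\<close>

lemma integrable_exp_of_powr:
  assumes [measurable]: "g \<in> borel_measurable unit_lebesgue" and g: "\<And>u. 0 \<le> g u"
    and "0 < \<alpha>" "1 < \<beta>"
    and fin: "(\<integral>\<^sup>+u. ennreal (exp (\<alpha> * g u powr \<beta>)) \<partial>unit_lebesgue) < \<infinity>"
  shows "integrable unit_lebesgue (\<lambda>u. exp (\<theta> * g u))"
proof -
  \<comment> \<open>The point where |theta| t and alpha t^beta cross: below \<open>T\<close> the
    linear term is bounded by its value at \<open>T\<close>, above it the power wins.\<close>
  define T where "T = (\<bar>\<theta>\<bar> / \<alpha>) powr (1 / (\<beta> - 1))"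
  have ie: "integrable unit_lebesgue (\<lambda>u. exp (\<alpha> * g u powr \<beta>))"
    using fin by (intro integrableI_bounded) auto
  have "\<theta> * t \<le> \<bar>\<theta>\<bar> * T + \<alpha> * t powr \<beta>" if "0 \<le> t" for t
  proof (cases "t \<le> T")
    case True
    have "\<theta> * t \<le> \<bar>\<theta>\<bar> * T" using that True by (intro mult_mono) auto
    then show ?thesis using \<open>0 < \<alpha>\<close> by (simp add: add_increasing2)
  next
    case False
    then have "0 < t" using powr_ge_zero[of "\<bar>\<theta>\<bar> / \<alpha>" "1 / (\<beta> - 1)"] unfolding T_def by linarith
    have "T powr (\<beta> - 1) \<le> t powr (\<beta> - 1)"
      using False \<open>1 < \<beta>\<close> by (intro powr_mono2) (auto simp: T_def)
    moreover have "T powr (\<beta> - 1) = \<bar>\<theta>\<bar> / \<alpha>"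
      using \<open>1 < \<beta>\<close> \<open>0 < \<alpha>\<close> by (simp add: T_def powr_powr)
    ultimately have "\<bar>\<theta>\<bar> \<le> \<alpha> * t powr (\<beta> - 1)" using \<open>0 < \<alpha>\<close> by (simp add: field_simps)
    then have "\<bar>\<theta>\<bar> * t \<le> \<alpha> * t powr (\<beta> - 1) * t" using that by (rule mult_right_mono)
    also have "\<dots> = \<alpha> * t powr \<beta>"
      using \<open>0 < t\<close> by (simp add: powr_diff)
    finally have "\<bar>\<theta>\<bar> * t \<le> \<alpha> * t powr \<beta>" .
    moreover have "\<theta> * t \<le> \<bar>\<theta>\<bar> * t" using that by (intro mult_right_mono) auto
    moreover have "0 \<le> \<bar>\<theta>\<bar> * T" by (simp add: T_def)
    ultimately show ?thesis by linarith
  qed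
  then have le: "exp (\<theta> * g u) \<le> exp (\<bar>\<theta>\<bar> * T) * exp (\<alpha> * g u powr \<beta>)" for u
    using g by (simp add: exp_add[symmetric])
  show ?thesis
    by (rule Bochner_Integration.integrable_bound[where f="\<lambda>u. exp (\<bar>\<theta>\<bar> * T) * exp (\<alpha> * g u powr \<beta>)"])
       (use ie le in auto)
qed

section \<open>Chernoff bounds along the tree\<close>

lemma nonroot_ancestors_subset_nodes: "x \<in> nodes d \<Longrightarrow> nonroot_ancestors x \<subseteq> nodes d"
  by (auto simp: nodes_def nonroot_ancestors_def prefix_def)

lemma nonroot_ancestors_eq_image:
  "nonroot_ancestors x = (\<lambda>i. take (Suc i) x) ` {..<length x}"
proof (intro equalityI subsetI)
  fix y assume "y \<in> nonroot_ancestors x"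
  then obtain zs where "x = y @ zs" "y \<noteq> []" by (auto simp: nonroot_ancestors_def prefix_def)
  then have "y = take (Suc (length y - 1)) x" "length y - 1 < length x"
    by (cases y; auto)+
  then show "y \<in> (\<lambda>i. take (Suc i) x) ` {..<length x}" by blast
qed (auto simp: nonroot_ancestors_def take_is_prefix)

lemma inj_on_take_Suc: "inj_on (\<lambda>i. take (Suc i) x) {..<length x}"
proof (rule inj_onI)
  fix i j assume *: "i \<in> {..<length x}" "j \<in> {..<length x}" and eq: "take (Suc i) x = take (Suc j) x"
  have "length (take (Suc i) x) = length (take (Suc j) x)" by (simp only: eq)
  then show "i = j" using * by simp
qed

lemma card_nonroot_ancestors: "card (nonroot_ancestors x) = length x"
  by (simp add: nonroot_ancestors_eq_image card_image inj_on_take_Suc)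

lemma sum_nonroot_ancestors:
  "(\<Sum>y\<in>nonroot_ancestors x. h y) = (\<Sum>i<length x. h (take (Suc i) x))"
  by (simp add: nonroot_ancestors_eq_image sum.reindex inj_on_take_Suc)

lemma sum_nonroot_ancestors_append:
  "(\<Sum>y\<in>nonroot_ancestors (z @ x). h y)
    = (\<Sum>y\<in>nonroot_ancestors z. h y) + (\<Sum>y\<in>nonroot_ancestors x. h (z @ y))"
proof -
  have "{..<length z + length x} = {..<length z} \<union> (+) (length z) ` {..<length x}"
    by (simp add: lessThan_atLeast0 ivl_disj_un add.commute)
  moreover have "{..<length z} \<inter> (+) (length z) ` {..<length x} = {}" by auto
  ultimately show ?thesis
    by (simp add: sum_nonroot_ancestors sum.union_disjoint sum.reindex)
qed

lemma nodes_append: "z @ y \<in> nodes d \<longleftrightarrow> z \<in> nodes d \<and> y \<in> nodes d"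
  by (auto simp: nodes_def)

lemma nodes_take: "x \<in> nodes d \<Longrightarrow> take n x \<in> nodes d"
  by (auto simp: nodes_def dest: in_set_takeD)

abbreviation level :: "nat \<Rightarrow> nat \<Rightarrow> nat list set" where
  "level d n \<equiv> {x\<in>nodes d. length x = n}"

lemma finite_level: "finite (level d n)"
  using finite_lists_length_eq[of "{..<d}" n] by (simp add: nodes_def)

lemma card_level: "card (level d n) = d ^ n"
  using card_lists_length_eq[of "{..<d}" n] by (simp add: nodes_def)

lemma level_nonempty: "0 < d \<Longrightarrow> level d n \<noteq> {}"
  using card_level[of d n] by (metis card.empty power_not_zero less_irrefl)

lemma integral_exp_pos:
  fixes g :: "real \<Rightarrow> real"
  assumes "integrable unit_lebesgue (\<lambda>u. exp (g u))"
  shows "0 < (\<integral>u. exp (g u) \<partial>unit_lebesgue)"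
proof -
  have "(\<integral>u. exp (g u) \<partial>unit_lebesgue) \<noteq> 0"
    using integral_nonneg_eq_0_iff_AE[OF assms] unit_lebesgue.AE_const[of False] by simp
  moreover have "0 \<le> (\<integral>u. exp (g u) \<partial>unit_lebesgue)" by simp
  ultimately show ?thesis by linarith
qed

locale uniform_tree = prob_space M for M :: "'w measure" +
  fixes d :: nat and U :: "nat list \<Rightarrow> 'w \<Rightarrow> real"
  assumes arity: "d \<ge> 2"
    and indep: "indep_vars (\<lambda>_. unit_lebesgue) U (nodes d)"
    and uniform: "x \<in> nodes d \<Longrightarrow> distr M unit_lebesgue (U x) = unit_lebesgue"
begin

lemma measurable_U: "x \<in> nodes d \<Longrightarrow> U x \<in> measurable M unit_lebesgue"
  using indep by (auto simp: indep_vars_def)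

lemma U_in_unit: "x \<in> nodes d \<Longrightarrow> \<omega> \<in> space M \<Longrightarrow> U x \<omega> \<in> {0..1}"
  using measurable_space[OF measurable_U] by fastforce

lemma nn_integral_U:
  assumes "x \<in> nodes d" "g \<in> borel_measurable unit_lebesgue"
  shows "(\<integral>\<^sup>+\<omega>. g (U x \<omega>) \<partial>M) = (\<integral>\<^sup>+u. g u \<partial>unit_lebesgue)"
  using assms measurable_U[OF assms(1)] uniform[OF assms(1)]
  by (subst nn_integral_distr[symmetric, of _ _ unit_lebesgue]) auto

text \<open>Markov's inequality for the exponential of the sum; independence along the path turns
  its expectation into a power.\<close>

lemma prob_ancestor_sum_gt:
  assumes x: "x \<in> nodes d" and [measurable]: "g \<in> borel_measurable unit_lebesgue"
    and int: "integrable unit_lebesgue (\<lambda>u. exp (g u))"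
  shows "prob {\<omega>\<in>space M. real (length x) * c < (\<Sum>y\<in>nonroot_ancestors x. g (U y \<omega>))}
    \<le> (exp (- c) * (\<integral>u. exp (g u) \<partial>unit_lebesgue)) ^ length x"
proof -
  define A where "A = nonroot_ancestors x"
  define Z where "Z = (\<integral>u. exp (g u) \<partial>unit_lebesgue)"
  have A: "finite A" "A \<subseteq> nodes d" "card A = length x"
    using nonroot_ancestors_subset_nodes[OF x] by (auto simp: A_def card_nonroot_ancestors)
  have [measurable]: "U y \<in> measurable M unit_lebesgue" if "y \<in> A" for y
    using that A measurable_U by auto
  have Z: "0 \<le> Z" by (auto simp: Z_def)
  have "indep_vars (\<lambda>_. borel) (\<lambda>y \<omega>. exp (g (U y \<omega>))) A"
    by (rule indep_vars_compose2[OF indep_vars_subset[OF indep A(2)]]) auto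
  then have "(\<integral>\<^sup>+\<omega>. (\<Prod>y\<in>A. ennreal (exp (g (U y \<omega>)))) \<partial>M) = (\<Prod>y\<in>A. \<integral>\<^sup>+\<omega>. ennreal (exp (g (U y \<omega>))) \<partial>M)"
    by (intro indep_vars_nn_integral[OF A(1)] indep_vars_compose2[where Y = "\<lambda>_. ennreal"]) auto
  also have "\<dots> = (\<Prod>y\<in>A. ennreal Z)"
    using A(2) int by (intro prod.cong refl)
      (auto simp: nn_integral_U[of _ "\<lambda>u. ennreal (exp (g u))"] Z_def nn_integral_eq_integral)
  also have "\<dots> = ennreal (Z ^ length x)" using Z A(3) by (simp add: ennreal_power)
  finally have E: "(\<integral>\<^sup>+\<omega>. (\<Prod>y\<in>A. ennreal (exp (g (U y \<omega>)))) \<partial>M) = ennreal (Z ^ length x)" .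
  \<comment> \<open>The event is enlarged to the shape \<open>1 \<le> c * u\<close> to which
    Markov's inequality applies.\<close>
  have "emeasure M {\<omega>\<in>space M. real (length x) * c < (\<Sum>y\<in>A. g (U y \<omega>))}
      \<le> emeasure M {\<omega>\<in>space M. 1 \<le> ennreal (exp (- c) ^ length x) * (\<Prod>y\<in>A. ennreal (exp (g (U y \<omega>))))}"
  proof (intro emeasure_mono subsetI CollectI)
    fix \<omega> assume "\<omega> \<in> {\<omega>\<in>space M. real (length x) * c < (\<Sum>y\<in>A. g (U y \<omega>))}"
    then have *: "\<omega> \<in> space M" "0 \<le> - (real (length x) * c) + (\<Sum>y\<in>A. g (U y \<omega>))" by auto
    have "exp (- c) ^ length x = exp (- (real (length x) * c))"
      by (simp add: exp_of_nat_mult[symmetric])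
    then have "exp (- c) ^ length x * (\<Prod>y\<in>A. exp (g (U y \<omega>))) = exp (- (real (length x) * c) + (\<Sum>y\<in>A. g (U y \<omega>)))"
      by (simp only: exp_sum[OF A(1)] exp_add)
    also have "1 \<le> \<dots>" using *(2) by simp
    finally show "\<omega> \<in> space M \<and> 1 \<le> ennreal (exp (- c) ^ length x) * (\<Prod>y\<in>A. ennreal (exp (g (U y \<omega>))))"
      using *(1) by (simp add: prod_ennreal ennreal_mult'[symmetric] prod_nonneg)
  qed measurable
  also have "\<dots> \<le> ennreal (exp (- c) ^ length x) * (\<integral>\<^sup>+\<omega>. (\<Prod>y\<in>A. ennreal (exp (g (U y \<omega>)))) * indicator (space M) \<omega> \<partial>M)"
    by (rule nn_integral_Markov_inequality) auto
  also have "\<dots> = ennreal (exp (- c) ^ length x) * (\<integral>\<^sup>+\<omega>. (\<Prod>y\<in>A. ennreal (exp (g (U y \<omega>)))) \<partial>M)"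
    by (intro arg_cong2[where f = times] nn_integral_cong) auto
  also have "\<dots> = ennreal ((exp (- c) * Z) ^ length x)"
    using Z by (simp add: E ennreal_mult power_mult_distrib)
  finally show ?thesis
    using Z by (simp add: emeasure_eq_measure A_def Z_def)
qed

text \<open>The term \<open>ln d\<close> is the price of a union bound over the \<open>d ^ n\<close> paths to level \<open>n\<close>.\<close>

lemma AE_eventually_ancestor_sum_le:
  assumes [measurable]: "g \<in> borel_measurable unit_lebesgue"
    and int: "integrable unit_lebesgue (\<lambda>u. exp (g u))"
    and c: "ln (real d) + ln (\<integral>u. exp (g u) \<partial>unit_lebesgue) < c"
  shows "AE \<omega> in M. \<forall>\<^sub>F n in sequentially. \<forall>x\<in>level d n.
    (\<Sum>y\<in>nonroot_ancestors x. g (U y \<omega>)) \<le> real n * c"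
proof -
  define Z where "Z = (\<integral>u. exp (g u) \<partial>unit_lebesgue)"
  define B where "B x = {\<omega>\<in>space M. real (length x) * c < (\<Sum>y\<in>nonroot_ancestors x. g (U y \<omega>))}" for x
  have Bm [measurable]: "B x \<in> events" if "x \<in> nodes d" for x
  proof -
    have [measurable]: "U y \<in> measurable M unit_lebesgue" if "y \<in> nonroot_ancestors x" for y
      using that nonroot_ancestors_subset_nodes[OF \<open>x \<in> nodes d\<close>] measurable_U by auto
    show ?thesis unfolding B_def by measurable
  qed
  \<comment> \<open>Ratio of the geometric series that bounds the union over level n;
    \<open>q < 1\<close> is the hypothesis on \<open>c\<close>, exponentiated. Borel-Cantelli then
    applies.\<close>
  define q where "q = real d * (exp (- c) * Z)"
  have "0 < Z"
    unfolding Z_def by (rule integral_exp_pos[OF int])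
  have "real d * Z < exp c"
    using c \<open>0 < Z\<close> arity by (subst (asm) exp_less_cancel_iff[symmetric]) (simp add: exp_add Z_def)
  then have q: "0 \<le> q" "q < 1"
    using \<open>0 < Z\<close> by (auto simp: q_def exp_minus field_simps)
  have le: "prob (\<Union>x\<in>level d n. B x) \<le> q ^ n" for n
  proof -
    have "prob (\<Union>x\<in>level d n. B x) \<le> (\<Sum>x\<in>level d n. prob (B x))"
      by (intro finite_measure_subadditive_finite finite_level) auto
    also have "\<dots> \<le> (\<Sum>x\<in>level d n. (exp (- c) * Z) ^ n)"
      using prob_ancestor_sum_gt[OF _ assms(1) int, of _ c] by (intro sum_mono) (auto simp: B_def Z_def)
    also have "\<dots> = q ^ n" by (simp add: card_level q_def power_mult_distrib)
    finally show ?thesis .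
  qed
  have "AE \<omega> in M. \<forall>\<^sub>F n in sequentially. \<omega> \<in> space M - (\<Union>x\<in>level d n. B x)"
  proof (rule borel_cantelli_AE1)
    show "summable (\<lambda>n. prob (\<Union>x\<in>level d n. B x))"
      using q le by (intro summable_comparison_test'[OF summable_geometric[of q], of 0]) auto
  qed (auto simp: finite_level less_top[symmetric] intro!: sets.finite_UN)
  then show ?thesis
    by eventually_elim (auto simp: B_def not_less elim!: eventually_mono)
qed

end

section \<open>Weak limits and the entropy bound\<close>

lemma AE_unit_lebesgue_iff:
  "(AE u in unit_lebesgue. P u) \<longleftrightarrow> (AE u in lborel. u \<in> {0..1} \<longrightarrow> P u)"
  unfolding unit_lebesgue_def by (rule AE_restrict_space_iff) simp

lemma continuous_imp_measurable_unit:
  "continuous_on {0..1} g \<Longrightarrow> g \<in> borel_measurable unit_lebesgue" for g :: "real \<Rightarrow> real"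
  unfolding borel_measurable_unit_lebesgue by (rule borel_measurable_continuous_on_restrict)

lemma continuous_bounded_unit:
  fixes g :: "real \<Rightarrow> real"
  assumes "continuous_on {0..1} g"
  obtains B where "\<And>x. x \<in> {0..1} \<Longrightarrow> \<bar>g x\<bar> \<le> B"
proof -
  have "bounded (g ` {0..1})"
    using assms by (intro compact_imp_bounded compact_continuous_image) auto
  then obtain B where "\<forall>x\<in>g ` {0..1}. norm x \<le> B"
    unfolding bounded_iff by blast
  then have "\<And>x. x \<in> {0..1} \<Longrightarrow> \<bar>g x\<bar> \<le> B" by auto
  then show thesis using that by blast
qed

text \<open>A Lebesgue measurable function on the line is an almost everywhere limit of continuous
  ones. Clipping these at \<plusminus>C keeps continuity and the limit and adds the uniform bound
  that dominated convergence needs.\<close>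

lemma bounded_measurable_approx_continuous:
  fixes g :: "real \<Rightarrow> real"
  assumes g: "g \<in> borel_measurable unit_lebesgue" and b: "\<And>u. \<bar>g u\<bar> \<le> C"
  obtains h :: "nat \<Rightarrow> real \<Rightarrow> real" where "\<And>n. continuous_on UNIV (h n)" "\<And>n u. \<bar>h n u\<bar> \<le> C"
    "AE u in unit_lebesgue. (\<lambda>n. h n u) \<longlonglongrightarrow> g u"
proof -
  have "0 \<le> C" using b[of 0] by linarith
  have "(\<lambda>u. indicator {0..1} u *\<^sub>R g u) \<in> borel_measurable borel"
    using g unfolding borel_measurable_unit_lebesgue by (subst borel_measurable_restrict_space_iff[symmetric]) auto
  then have "(\<lambda>u. indicator {0..1} u *\<^sub>R g u) \<in> borel_measurable lebesgue"
    by (intro measurable_completion) simp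
  then have "(\<lambda>u. indicator {0..1} u *\<^sub>R g u) measurable_on UNIV"
    by (rule lebesgue_measurable_imp_measurable_on) simp
  then obtain N h where N: "negligible N" and h: "\<And>n. continuous_on UNIV (h n)"
    and lim: "\<And>x. x \<notin> N \<Longrightarrow> (\<lambda>n. h n x) \<longlonglongrightarrow> indicator {0..1} x *\<^sub>R g x"
    unfolding measurable_on_def by auto
  have "AE u in lebesgue. u \<notin> N"
    using N by (simp add: negligible_iff_null_sets AE_not_in)
  then have "AE u in lborel. u \<notin> N"
    by (simp add: AE_completion_iff)
  then have AE: "AE u in unit_lebesgue. (\<lambda>n. h n u) \<longlonglongrightarrow> g u"
    unfolding AE_unit_lebesgue_iff by eventually_elim (use lim in force)
  show thesis
  proof (rule that[of "\<lambda>n u. max (- C) (min C (h n u))"])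
    show "AE u in unit_lebesgue. (\<lambda>n. max (- C) (min C (h n u))) \<longlonglongrightarrow> g u"
      using AE
    proof eventually_elim
      case (elim u)
      then have "(\<lambda>n. max (- C) (min C (h n u))) \<longlonglongrightarrow> max (- C) (min C (g u))"
        by (intro tendsto_intros)
      then show ?case using b[of u] by (simp add: abs_le_iff min_def max_def split: if_splits)
    qed
  qed (use h \<open>0 \<le> C\<close> in \<open>auto intro!: continuous_intros\<close>)
qed

lemma sets_unit_prob_measures: "s \<in> unit_prob_measures \<Longrightarrow> sets s = sets unit_lebesgue"
  by (simp add: unit_prob_measures_def sets_unit_lebesgue)

lemma space_unit_prob_measures: "s \<in> unit_prob_measures \<Longrightarrow> space s = {0..1}"
  using sets_eq_imp_space_eq[OF sets_unit_prob_measures] by simp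

lemma AE_absolutely_continuous:
  assumes "absolutely_continuous M N" "sets N = sets M" "AE u in M. P u"
  shows "AE u in N. P u"
  using absolutely_continuous_AE[of N M P] assms by simp

lemma tendsto_expectation_bounded:
  fixes h :: "nat \<Rightarrow> 'a \<Rightarrow> real"
  assumes "prob_space s" "\<And>n. h n \<in> borel_measurable s" "g \<in> borel_measurable s"
    "\<And>n u. \<bar>h n u\<bar> \<le> C" "AE u in s. (\<lambda>n. h n u) \<longlonglongrightarrow> g u"
  shows "(\<lambda>n. integral\<^sup>L s (h n)) \<longlonglongrightarrow> integral\<^sup>L s g"
proof (rule integral_dominated_convergence[where w = "\<lambda>_. C"])
  interpret prob_space s by fact
  show "integrable s (\<lambda>_. C)" by simp
qed (use assms in auto)

lemma integrable_unit_bounded: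
  fixes g :: "'a \<Rightarrow> real"
  assumes "prob_space s" "g \<in> borel_measurable s" "\<And>u. u \<in> space s \<Longrightarrow> \<bar>g u\<bar> \<le> C"
  shows "integrable s g"
proof -
  interpret prob_space s by fact
  show ?thesis using assms by (intro integrable_const_bound[where B = C]) (auto intro!: AE_I2)
qed

section \<open>From the Donsker-Varadhan inequality for continuous functions to the entropy
  bound\<close>

context
  fixes s :: "real measure" and c :: real
  assumes s: "s \<in> unit_prob_measures"
    and DV: "\<And>g. continuous_on UNIV g \<Longrightarrow>
      integral\<^sup>L s g \<le> c + ln (\<integral>u. exp (g u) \<partial>unit_lebesgue)"
begin

interpretation s: prob_space s
  using s by (simp add: unit_prob_measures_def)

lemma measurable_s [measurable_cong]: "sets s = sets unit_lebesgue"
  by (rule sets_unit_prob_measures[OF s])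

text \<open>Continuous bumps \<open>g m\<close> decrease to the indicator of \<open>K\<close>, and
  the integral of exp (theta g_m) tends to 1 because \<open>K\<close> is null. So theta * s(K) <= c
  for every theta >= 0, which forces s(K) = 0. Absolute continuity has to come first: the passage to
  measurable test functions uses almost everywhere limits.\<close>

lemma compact_null_of_continuous_bound:
  assumes K: "compact K" "K \<subseteq> {0..1}" and null: "measure unit_lebesgue K = 0"
  shows "measure s K = 0"
proof (cases "K = {}")
  case False
  have Ks: "K \<in> sets unit_lebesgue"
    using K by (simp add: sets_unit_lebesgue sets_restrict_space_iff borel_compact)
  define g where "g m u = max 0 (1 - real m * infdist u K)" for m u
  have gc: "continuous_on A (\<lambda>u. \<theta> * g m u)" for m A \<theta>
    unfolding g_def by (intro continuous_intros)
  have gm [measurable]: "(\<lambda>u. g m u) \<in> borel_measurable unit_lebesgue" for m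
    using gc[of _ 1 m] by (simp add: continuous_imp_measurable_unit)
  have gb: "0 \<le> g m u" "g m u \<le> 1" for m u
    using infdist_nonneg[of u K] by (auto simp: g_def)
  have gK: "g m u = 1" if "u \<in> K" for m u using that by (simp add: g_def)
  have glim: "(\<lambda>m. g m u) \<longlonglongrightarrow> indicator K u" for u
  proof (cases "u \<in> K")
    case False
    have "0 < infdist u K"
      using False \<open>K \<noteq> {}\<close> K infdist_pos_not_in_closed[of K u] compact_imp_closed by blast
    then obtain N :: nat where N: "1 < real N * infdist u K"
      using reals_Archimedean3 by blast
    have "g m u = 0" if "m \<ge> N" for m
      using N mult_right_mono[of "real N" "real m" "infdist u K"] that infdist_nonneg[of u K]
      by (simp add: g_def)
    then have "\<forall>\<^sub>F m in sequentially. g m u = indicator K u"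
      using False by (auto simp: eventually_sequentially)
    then show ?thesis by (rule tendsto_eventually)
  qed (simp add: gK)
  have bound: "\<theta> * measure s K \<le> c" if \<theta>: "0 \<le> \<theta>" for \<theta> :: real
  proof -
    have "(\<lambda>m. \<integral>u. exp (\<theta> * g m u) \<partial>unit_lebesgue) \<longlonglongrightarrow> (\<integral>u. exp (\<theta> * indicator K u) \<partial>unit_lebesgue)"
    proof (rule tendsto_expectation_bounded)
      show "\<bar>exp (\<theta> * g m u)\<bar> \<le> exp \<theta>" for m u
        using gb[of m u] \<theta> by (simp add: mult_left_le)
      show "AE u in unit_lebesgue. (\<lambda>n. exp (\<theta> * g n u)) \<longlonglongrightarrow> exp (\<theta> * indicator K u)"
        using glim by (auto intro!: tendsto_intros)
    qed (use Ks unit_lebesgue.prob_space_axioms in measurable)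
    also have "AE u in unit_lebesgue. u \<notin> K"
      using Ks null by (intro AE_not_in) (auto simp: null_sets_def unit_lebesgue.emeasure_eq_measure)
    then have "AE u in unit_lebesgue. exp (\<theta> * indicator K u) = 1"
      by eventually_elim simp
    then have "(\<integral>u. exp (\<theta> * indicator K u) \<partial>unit_lebesgue) = (\<integral>u. 1 \<partial>unit_lebesgue)"
      using Ks by (intro integral_cong_AE) simp_all
    also have "\<dots> = 1" using unit_lebesgue.prob_space by simp
    finally have "(\<lambda>m. c + ln (\<integral>u. exp (\<theta> * g m u) \<partial>unit_lebesgue)) \<longlonglongrightarrow> c + ln 1"
      by (intro tendsto_intros) auto
    moreover have "\<theta> * measure s K \<le> c + ln (\<integral>u. exp (\<theta> * g m u) \<partial>unit_lebesgue)" for m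
    proof -
      have "\<theta> * measure s K = (\<integral>u. \<theta> * indicator K u \<partial>s)"
        using Ks K by (simp add: measurable_s space_unit_prob_measures[OF s] Int_absorb2)
      also have "\<dots> \<le> (\<integral>u. \<theta> * g m u \<partial>s)"
      proof (rule integral_mono)
        show "integrable s (\<lambda>u. \<theta> * g m u)"
          by (intro integrable_mult_right integrable_unit_bounded[where C = 1] s.prob_space_axioms) (use gb in auto)
        show "integrable s (\<lambda>u. \<theta> * indicator K u)"
          using Ks by (simp add: measurable_s less_top[symmetric])
      qed (use gb gK \<theta> in \<open>auto simp: indicator_def intro!: mult_left_mono\<close>)
      also have "\<dots> \<le> c + ln (\<integral>u. exp (\<theta> * g m u) \<partial>unit_lebesgue)"
        by (rule DV) (rule gc)
      finally show ?thesis .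
    qed
    ultimately show ?thesis
      by (auto intro: LIMSEQ_le_const)
  qed
  show ?thesis
  proof (rule ccontr)
    assume "measure s K \<noteq> 0"
    then have "0 < measure s K" by (simp add: less_le)
    moreover have "0 \<le> c" using bound[of 0] by simp
    \<comment> \<open>For this theta the bound reads c + 1 <= c, and c >= 0 makes the choice
      admissible.\<close>
    ultimately show False using bound[of "(c + 1) / measure s K"] by simp
  qed
qed simp

text \<open>Inner regularity reduces a null set to its compact subsets. The measure is moved to the
  Borel sets of the line to apply it.\<close>

lemma absolutely_continuous_of_continuous_bound: "absolutely_continuous unit_lebesgue s"
  unfolding absolutely_continuous_def
proof
  fix N assume N: "N \<in> null_sets unit_lebesgue"
  let ?s = "distr s borel (\<lambda>x. x)"
  have [measurable]: "(\<lambda>x. x) \<in> borel_measurable s"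
    by (simp add: measurable_cong_sets[OF measurable_s refl] borel_measurable_unit_lebesgue measurable_restrict_space1)
  have N': "N \<in> sets s" "N \<subseteq> {0..1}" "N \<in> sets borel"
    using N by (auto simp: measurable_s null_sets_def sets_unit_lebesgue sets_restrict_space_iff)
  have e: "emeasure ?s A = emeasure s (A \<inter> {0..1})" if "A \<in> sets borel" for A
    using that by (simp add: emeasure_distr space_unit_prob_measures[OF s])
  have "emeasure s N = emeasure ?s N" using N' by (simp add: e Int_absorb2)
  also have "\<dots> = (SUP K\<in>{K. K \<subseteq> N \<and> compact K}. emeasure ?s K)"
    using N' by (intro inner_regular) (auto simp: e less_top[symmetric])
  also have "\<dots> \<le> 0"
  proof (rule SUP_least)
    fix K assume "K \<in> {K. K \<subseteq> N \<and> compact K}"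
    then have K: "K \<subseteq> N" "compact K" by auto
    then have "measure unit_lebesgue K = 0"
      using N null_sets_subset[OF N, of K] N'(2) by (simp add: sets_unit_lebesgue sets_restrict_space_iff borel_compact measure_def null_setsD1)
    then have "measure s K = 0"
      using K N' by (intro compact_null_of_continuous_bound) auto
    then show "emeasure ?s K \<le> 0"
      using K N' by (simp add: e borel_compact Int_absorb2 subset_trans s.emeasure_eq_measure)
  qed
  finally show "N \<in> null_sets s" using N' by (simp add: null_sets_def)
qed

text \<open>Approximants that converge Lebesgue almost everywhere also converge
  \<open>s\<close>-almost everywhere by absolute continuity, so both sides of the inequality pass to
  the limit by dominated convergence.\<close>

lemma bounded_measurable_bound:
  assumes g: "g \<in> borel_measurable unit_lebesgue" and b: "\<And>u. \<bar>g u\<bar> \<le> C"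
  shows "integral\<^sup>L s g \<le> c + ln (\<integral>u. exp (g u) \<partial>unit_lebesgue)"
proof -
  obtain h :: "nat \<Rightarrow> real \<Rightarrow> real" where h: "\<And>n. continuous_on UNIV (h n)" "\<And>n u. \<bar>h n u\<bar> \<le> C"
    "AE u in unit_lebesgue. (\<lambda>n. h n u) \<longlonglongrightarrow> g u"
    using bounded_measurable_approx_continuous[OF g b] by blast
  have [measurable]: "h n \<in> borel_measurable unit_lebesgue" for n
    using h(1) by (intro continuous_imp_measurable_unit) (auto intro: continuous_on_subset)
  have hs: "AE u in s. (\<lambda>n. h n u) \<longlonglongrightarrow> g u"
    using absolutely_continuous_of_continuous_bound measurable_s h(3) by (rule AE_absolutely_continuous)
  have 1: "(\<lambda>n. integral\<^sup>L s (h n)) \<longlonglongrightarrow> integral\<^sup>L s g"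
    by (rule tendsto_expectation_bounded[OF s.prob_space_axioms _ _ h(2) hs]) (use g in measurable)
  have 2: "(\<lambda>n. \<integral>u. exp (h n u) \<partial>unit_lebesgue) \<longlonglongrightarrow> (\<integral>u. exp (g u) \<partial>unit_lebesgue)"
  proof (rule tendsto_expectation_bounded[OF unit_lebesgue.prob_space_axioms, where C = "exp C"])
    show "AE u in unit_lebesgue. (\<lambda>n. exp (h n u)) \<longlonglongrightarrow> exp (g u)"
      using h(3) by eventually_elim (intro tendsto_intros)
    show "\<bar>exp (h n u)\<bar> \<le> exp C" for n u using h(2)[of n u] by simp
  qed (use g in measurable)
  have "integrable unit_lebesgue (\<lambda>u. exp (g u))"
    using g b by (intro integrable_unit_bounded[where C = "exp C"] unit_lebesgue.prob_space_axioms) (auto simp: abs_le_iff)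
  then have "0 < (\<integral>u. exp (g u) \<partial>unit_lebesgue)" by (rule integral_exp_pos)
  then have "(\<lambda>n. c + ln (\<integral>u. exp (h n u) \<partial>unit_lebesgue)) \<longlonglongrightarrow> c + ln (\<integral>u. exp (g u) \<partial>unit_lebesgue)"
    using 2 by (intro tendsto_intros) auto
  then show ?thesis
    using 1 DV[OF h(1)] by (intro LIMSEQ_le) auto
qed

text \<open>The optimal test function in the variational formula is the log density. It is used in a
  form truncated to [-k, k], for which the exponential integral is at most 1 + exp (-k), and Fatou's
  lemma removes the truncation.\<close>

lemma kl_div_le_of_continuous_bound: "kl_div s unit_lebesgue \<le> ereal c"
proof -
  obtain f where f: "prob_density f" and s_eq: "s = density unit_lebesgue f"
    using absolutely_continuous_unitE[OF s absolutely_continuous_of_continuous_bound] by blast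
  note D = prob_densityD[OF f]
  note [measurable] = D(4)
  \<comment> \<open>The truncation is decided on \<open>f u\<close> and not on its logarithm: since
    \<open>ln 0 = 0\<close>, clipping \<open>ln (f u)\<close> would make the exponential equal to 1
    where the density vanishes.\<close>
  define g where "g k u = (if f u \<le> exp (- real k) then - real k else if exp (real k) \<le> f u then real k else ln (f u))" for k u
  have [measurable]: "g k \<in> borel_measurable unit_lebesgue" for k unfolding g_def by measurable
  have gb: "\<bar>g k u\<bar> \<le> real k" for k u
  proof -
    have "- real k \<le> ln (f u)" if "\<not> f u \<le> exp (- real k)"
      using that less_trans[of 0 "exp (- real k)" "f u"] by (simp add: ln_ge_iff not_le)
    moreover have "ln (f u) \<le> real k" if "\<not> f u \<le> exp (- real k)" "\<not> exp (real k) \<le> f u"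
      using that less_trans[of 0 "exp (- real k)" "f u"] ln_less_cancel_iff[of "f u" "exp (real k)"]
      by (simp add: not_le)
    ultimately show ?thesis by (auto simp: g_def)
  qed
  \<comment> \<open>A lower bound uniform in k, so that the integrands plus 1 are nonnegative. Below
    exp k the truncation only raises x ln x; above, the product is nonnegative.\<close>
  have ge: "-1 \<le> f u * g k u" for k u
  proof -
    have "f u * ln (f u) \<le> f u * g k u" if "\<not> exp (real k) \<le> f u"
    proof (cases "0 < f u \<and> f u \<le> exp (- real k)")
      case True
      then have "ln (f u) \<le> - real k" using ln_le_cancel_iff[of "f u" "exp (- real k)"] by simp
      then have "f u * ln (f u) \<le> f u * - real k" using D(1)[of u] by (rule mult_left_mono)
      then show ?thesis using True by (simp add: g_def)
    qed (use that D(1)[of u] in \<open>auto simp: g_def less_le\<close>)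
    moreover have "0 \<le> f u * g k u" if "exp (real k) \<le> f u"
    proof (cases "f u \<le> exp (- real k)")
      case True
      then have "exp (real k) \<le> exp (- real k)" using that by linarith
      then show ?thesis by (simp add: g_def)
    qed (use that D(1)[of u] in \<open>auto simp: g_def\<close>)
    ultimately show ?thesis using entropy_ge[OF D(1)[of u]] by fastforce
  qed
  have lim: "(\<lambda>k. f u * g k u) \<longlonglongrightarrow> f u * ln (f u)" for u
  proof (cases "f u = 0")
    case False
    then have pos: "0 < f u" using D(1)[of u] by simp
    obtain N :: nat where N: "\<bar>ln (f u)\<bar> < real N" using reals_Archimedean2 by blast
    have "g k u = ln (f u)" if "N \<le> k" for k
    proof -
      have k: "- real k < ln (f u)" "ln (f u) < real k" using N that by auto
      have "exp (- real k) < f u" "f u < exp (real k)"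
        using k pos exp_less_cancel_iff[of "- real k" "ln (f u)"] exp_less_cancel_iff[of "ln (f u)" "real k"] by auto
      then show ?thesis by (simp add: g_def)
    qed
    then have "\<forall>\<^sub>F k in sequentially. f u * g k u = f u * ln (f u)"
      unfolding eventually_sequentially by auto
    then show ?thesis by (rule tendsto_eventually)
  qed simp
  have expg: "exp (g k u) \<le> f u + exp (- real k)" for k u
    using D(1)[of u] by (auto simp: g_def add_increasing2 add_increasing)
      (smt (verit, best) exp_gt_zero exp_ln)
  have int_exp: "(\<integral>u. exp (g k u) \<partial>unit_lebesgue) \<le> 1 + exp (- real k)" for k
  proof -
    have "integrable unit_lebesgue (\<lambda>u. exp (g k u))"
      using gb by (intro integrable_unit_bounded[where C = "exp (real k)"] unit_lebesgue.prob_space_axioms) (auto simp: abs_le_iff)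
    then have "(\<integral>u. exp (g k u) \<partial>unit_lebesgue) \<le> (\<integral>u. f u + exp (- real k) \<partial>unit_lebesgue)"
      using expg D(2) by (intro integral_mono) auto
    also have "\<dots> = 1 + exp (- real k)"
      using D(2,3) unit_lebesgue.prob_space by simp
    finally show ?thesis .
  qed
  have "0 \<le> c" using DV[of "\<lambda>_. 0"] unit_lebesgue.prob_space by (simp add: continuous_on_const)
  have step: "(\<integral>\<^sup>+u. ennreal (f u * g k u + 1) \<partial>unit_lebesgue) \<le> ennreal (1 + (c + ln (1 + exp (- real k))))" for k
  proof -
    have "integrable s (g k)"
      using gb by (intro integrable_unit_bounded[where C = "real k"] s.prob_space_axioms) auto
    then have i: "integrable unit_lebesgue (\<lambda>u. f u * g k u)"
      unfolding s_eq by (simp add: integrable_density_unit[OF f])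
    have "(\<integral>u. f u * g k u \<partial>unit_lebesgue) = integral\<^sup>L s (g k)"
      unfolding s_eq by (simp add: integrable_density_unit[OF f])
    also have "\<dots> \<le> c + ln (\<integral>u. exp (g k u) \<partial>unit_lebesgue)"
      by (rule bounded_measurable_bound[OF _ gb]) simp
    also have "\<dots> \<le> c + ln (1 + exp (- real k))"
      using int_exp[of k] gb
      by (subst add_le_cancel_left, subst ln_le_cancel_iff)
         (auto intro!: integral_exp_pos integrable_unit_bounded[where C = "exp (real k)"] unit_lebesgue.prob_space_axioms
            add_pos_pos simp: abs_le_iff)
    finally have "(\<integral>u. f u * g k u + 1 \<partial>unit_lebesgue) \<le> 1 + (c + ln (1 + exp (- real k)))"
      using i unit_lebesgue.prob_space by simp
    moreover have "(\<integral>\<^sup>+u. ennreal (f u * g k u + 1) \<partial>unit_lebesgue) = ennreal (\<integral>u. f u * g k u + 1 \<partial>unit_lebesgue)"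
      using i by (intro nn_integral_eq_integral AE_I2) (use ge[of _ k] in \<open>auto simp: add.commute\<close>, smt (verit) ge)
    ultimately show ?thesis by (simp add: ennreal_leI)
  qed
  have lim_k: "(\<lambda>k. ennreal (1 + (c + ln (1 + exp (- real k))))) \<longlonglongrightarrow> ennreal (1 + c)"
  proof -
    have "(\<lambda>k. exp (- real k)) \<longlonglongrightarrow> 0"
      by real_asymp
    then have "(\<lambda>k. 1 + (c + ln (1 + exp (- real k)))) \<longlonglongrightarrow> 1 + (c + ln (1 + 0))"
      by (intro tendsto_intros) auto
    then show ?thesis by (intro tendsto_ennrealI) simp
  qed
  have "(\<lambda>k. ennreal (f u * g k u + 1)) \<longlonglongrightarrow> ennreal (f u * ln (f u) + 1)" for u
    by (intro tendsto_ennrealI tendsto_add lim tendsto_const)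
  then have "(\<integral>\<^sup>+u. ennreal (f u * ln (f u) + 1) \<partial>unit_lebesgue)
      = (\<integral>\<^sup>+u. liminf (\<lambda>k. ennreal (f u * g k u + 1)) \<partial>unit_lebesgue)"
    by (intro nn_integral_cong lim_imp_Liminf[symmetric]) simp_all
  also have "\<dots> \<le> liminf (\<lambda>k. \<integral>\<^sup>+u. ennreal (f u * g k u + 1) \<partial>unit_lebesgue)"
    by (intro nn_integral_liminf) measurable
  also have "\<dots> \<le> liminf (\<lambda>k. ennreal (1 + (c + ln (1 + exp (- real k)))))"
    by (intro Liminf_mono always_eventually allI step)
  also have "\<dots> = ennreal (1 + c)"
    by (rule lim_imp_Liminf[OF _ lim_k]) simp
  finally have "finite_entropy f \<and> rel_entropy f \<le> c"
    using \<open>0 \<le> c\<close> by (intro finite_entropyI[OF f]) auto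
  then show ?thesis by (simp add: s_eq kl_div_density)
qed

end

text \<open>The measures are pushed to the line, where they are tight; the limit on the line is then
  shown to live on [0,1] and is restricted back.\<close>

lemma unit_prob_measures_weakly_compact:
  assumes e: "\<And>k. e k \<in> unit_prob_measures"
  obtains r s where "strict_mono (r :: nat \<Rightarrow> nat)" "s \<in> unit_prob_measures"
    "weak_conv_unit (\<lambda>k. e (r k)) s"
proof -
  define m where "m k = distr (e k) borel (\<lambda>x. x)" for k
  have id_meas: "(\<lambda>x. x) \<in> borel_measurable (e k)" for k
    by (simp add: measurable_cong_sets[OF sets_unit_prob_measures[OF e] refl]
        borel_measurable_unit_lebesgue measurable_restrict_space1)
  have rd: "real_distribution (m k)" for k
  proof -
    interpret prob_space "e k" using e by (simp add: unit_prob_measures_def)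
    show ?thesis unfolding m_def
      using prob_space_distr[OF id_meas] by (simp add: real_distribution_def real_distribution_axioms_def)
  qed
  \<comment> \<open>Tightness is phrased with intervals open on the left, and the point 0 has to be
    inside.\<close>
  have "measure (m k) {-1<..1} = 1" for k
  proof -
    interpret prob_space "e k" using e by (simp add: unit_prob_measures_def)
    have "measure (m k) {-1<..1} = measure (e k) ({-1<..1} \<inter> {0..1})"
      unfolding m_def by (subst measure_distr[OF id_meas]) (auto simp: space_unit_prob_measures[OF e])
    also have "{-1<..1} \<inter> {0..1} = space (e k)" by (auto simp: space_unit_prob_measures[OF e])
    finally show ?thesis by (simp add: prob_space)
  qed
  then have "tight m"
    unfolding tight_def using rd by (intro conjI allI impI exI[of _ "-1"] exI[of _ "1::real"]) auto
  from tight_imp_convergent_subsubsequence[OF this strict_mono_id]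
  obtain r N where r: "strict_mono r" and N: "real_distribution N" and conv: "weak_conv_m (m \<circ> id \<circ> r) N"
    by auto
  interpret N: real_distribution N by fact
  have conv_int: "(\<lambda>k. \<integral>x. f x \<partial>e (r k)) \<longlonglongrightarrow> (\<integral>x. f x \<partial>N)"
    if f: "continuous_on UNIV f" and b: "\<And>x. \<bar>f x\<bar> \<le> B" for f :: "real \<Rightarrow> real" and B
  proof -
    have "(\<lambda>k. integral\<^sup>L ((m \<circ> id \<circ> r) k) f) \<longlonglongrightarrow> integral\<^sup>L N f"
      using f b rd N conv
      by (intro weak_conv_imp_integral_bdd_continuous_conv[where B = B])
         (auto simp: continuous_on_eq_continuous_at comp_def)
    moreover have "integral\<^sup>L ((m \<circ> id \<circ> r) k) f = (\<integral>x. f x \<partial>e (r k))" for k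
      using f unfolding m_def comp_def id_def
      by (subst integral_distr[OF id_meas]) (auto intro: borel_measurable_continuous_onI)
    ultimately show ?thesis by simp
  qed
  \<comment> \<open>A bounded continuous function that vanishes exactly on [0,1]: its integral under
    the limit is 0, which locates the limit.\<close>
  define g :: "real \<Rightarrow> real" where "g x = min 1 (max 0 (max (- x) (x - 1)))" for x
  have "(\<lambda>k. \<integral>x. g x \<partial>e (r k)) \<longlonglongrightarrow> (\<integral>x. g x \<partial>N)"
    unfolding g_def by (rule conv_int[of _ 1]) (auto intro!: continuous_intros)
  moreover have "(\<integral>x. g x \<partial>e k) = 0" for k
    by (rule integral_eq_zero_AE) (auto simp: g_def space_unit_prob_measures[OF e] intro!: AE_I2)
  ultimately have "(\<integral>x. g x \<partial>N) = 0" by (simp add: LIMSEQ_const_iff)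
  moreover have "integrable N g"
    unfolding g_def by (rule N.integrable_const_bound[where B = 1]) auto
  ultimately have "AE x in N. g x = 0"
    by (subst (asm) integral_nonneg_eq_0_iff_AE) (auto simp: g_def)
  then have AE: "AE x in N. x \<in> {0..1}"
    by eventually_elim (auto simp: g_def min_def max_def split: if_splits)
  define s where "s = restrict_space N {0..1}"
  have "prob_space s"
    unfolding s_def using AE by (intro prob_spaceI)
      (simp add: emeasure_restrict_space space_restrict_space N.emeasure_eq_1_AE)
  then have s: "s \<in> unit_prob_measures"
    by (simp add: unit_prob_measures_def s_def sets_restrict_space_cong[OF N.events_eq_borel])
  have "weak_conv_unit (\<lambda>k. e (r k)) s"
    unfolding weak_conv_unit_def
  proof (intro allI impI)
    fix f :: "real \<Rightarrow> real" assume f: "continuous_on {0..1} f"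
    \<comment> \<open>Extends \<open>f\<close> continuously and boundedly to the line by clamping
      the argument.\<close>
    define F where "F x = f (max 0 (min 1 x))" for x
    have F: "continuous_on UNIV F"
      unfolding F_def by (rule continuous_on_compose2[OF f]) (auto intro!: continuous_intros)
    obtain B where B: "\<And>x. x \<in> {0..1} \<Longrightarrow> \<bar>f x\<bar> \<le> B"
      using continuous_bounded_unit[OF f] by blast
    have "(\<lambda>k. \<integral>x. F x \<partial>e (r k)) \<longlonglongrightarrow> (\<integral>x. F x \<partial>N)"
      by (rule conv_int[OF F, of B]) (auto simp: F_def intro!: B)
    moreover have "(\<integral>x. F x \<partial>e (r k)) = integral\<^sup>L (e (r k)) f" for k
      by (rule Bochner_Integration.integral_cong) (auto simp: F_def space_unit_prob_measures[OF e])
    moreover have "(\<integral>x. F x \<partial>N) = integral\<^sup>L s f"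
    proof -
      have Fm: "F \<in> borel_measurable borel" using F by (rule borel_measurable_continuous_onI)
      have "integral\<^sup>L s f = integral\<^sup>L s F"
        by (rule Bochner_Integration.integral_cong) (auto simp: F_def s_def space_restrict_space)
      also have "\<dots> = (\<integral>x. indicator {0..1} x *\<^sub>R F x \<partial>N)"
        unfolding s_def by (rule integral_restrict_space) simp
      also have "\<dots> = (\<integral>x. F x \<partial>N)"
        using Fm AE by (intro integral_cong_AE) (auto elim: eventually_mono)
      finally show ?thesis by simp
    qed
    ultimately show "(\<lambda>k. integral\<^sup>L (e (r k)) f) \<longlonglongrightarrow> integral\<^sup>L s f" by simp
  qed
  then show thesis using that r s by blast
qed

section \<open>Weak limits of empirical measures\<close>

lemma borel_measurable_unit_prob_measures:
  "s \<in> unit_prob_measures \<Longrightarrow> borel_measurable s = borel_measurable unit_lebesgue"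
  by (rule measurable_cong_sets[OF sets_unit_prob_measures refl])

text \<open>An empirical measure is the law of \<open>f\<close> at a uniformly chosen non-root
  ancestor; its integrals and total mass follow from facts on pushforwards. The root is excluded
  because its empirical measure is null.\<close>

lemma empirical_eq_distr:
  assumes "x \<noteq> []" and f: "\<And>y. y \<in> nonroot_ancestors x \<Longrightarrow> f y \<in> space N"
  shows "empirical N f x = distr (uniform_count_measure (nonroot_ancestors x)) N f"
proof (rule measure_eqI)
  let ?C = "uniform_count_measure (nonroot_ancestors x)"
  have fm: "f \<in> measurable ?C N"
    using f by (simp add: measurable_cong_sets[OF sets_uniform_count_measure_count_space refl])
  fix A assume A: "A \<in> sets (empirical N f x)"
  then have "emeasure (distr ?C N f) A = emeasure ?C {y\<in>nonroot_ancestors x. f y \<in> A}"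
    using fm by (simp add: emeasure_distr space_uniform_count_measure vimage_def Int_def conj_commute)
  also have "\<dots> = ennreal (real (card {y\<in>nonroot_ancestors x. f y \<in> A}) / real (length x))"
    by (simp add: emeasure_uniform_count_measure card_nonroot_ancestors)
  also have "\<dots> = of_nat (card {y\<in>nonroot_ancestors x. f y \<in> A}) / of_nat (length x)"
    using \<open>x \<noteq> []\<close> by (simp add: divide_ennreal[symmetric] ennreal_of_nat_eq_real_of_nat)
  also have "of_nat (card {y\<in>nonroot_ancestors x. f y \<in> A}) = (\<Sum>y\<in>nonroot_ancestors x. indicator A (f y) :: ennreal)"
    by (simp add: indicator_def if_distrib sum.If_cases Int_def)
  finally show "emeasure (empirical N f x) A = emeasure (distr ?C N f) A"
    using A by (simp add: emeasure_empirical)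
qed simp

lemma integral_empirical:
  fixes g :: "'a \<Rightarrow> real"
  assumes "x \<noteq> []" and f: "\<And>y. y \<in> nonroot_ancestors x \<Longrightarrow> f y \<in> space N"
    and g: "g \<in> borel_measurable N"
  shows "integral\<^sup>L (empirical N f x) g = (\<Sum>y\<in>nonroot_ancestors x. g (f y)) / real (length x)"
  using f g by (subst empirical_eq_distr[OF assms(1,2)], simp, subst integral_distr)
    (auto simp: measurable_cong_sets[OF sets_uniform_count_measure_count_space refl]
      integral_uniform_count_measure card_nonroot_ancestors)

lemma prob_space_empirical:
  assumes "x \<noteq> []" and f: "\<And>y. y \<in> nonroot_ancestors x \<Longrightarrow> f y \<in> space N"
  shows "prob_space (empirical N f x)"
proof -
  have "nonroot_ancestors x \<noteq> {}"
    using assms(1) card_nonroot_ancestors[of x] by auto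
  then interpret prob_space "uniform_count_measure (nonroot_ancestors x)"
    by (simp add: prob_space_uniform_count_measure)
  show ?thesis
    using f by (subst empirical_eq_distr[OF assms], simp, intro prob_space_distr) (simp add: measurable_cong_sets[OF sets_uniform_count_measure_count_space refl])
qed

text \<open>Provides a countable family of test functions, indexed by rational lists, that is
  uniformly dense. Bernstein polynomials are nonnegative and sum to 1, so perturbing each
  coefficient by less than epsilon/2 moves the polynomial by at most epsilon/2.\<close>

lemma continuous_approx_rat_Bernstein:
  fixes g :: "real \<Rightarrow> real"
  assumes g: "continuous_on {0..1} g" and "0 < \<epsilon>"
  obtains q :: "rat list" where
    "\<And>x. x \<in> {0..1} \<Longrightarrow> \<bar>g x - (\<Sum>k\<le>length q - 1. of_rat (q ! k) * Bernstein (length q - 1) k x)\<bar> < \<epsilon>"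
proof -
  obtain n where n: "\<And>x. x \<in> {0..1} \<Longrightarrow> \<bar>g x - (\<Sum>k\<le>n. g (k / n) * Bernstein n k x)\<bar> < \<epsilon> / 2"
    using Bernstein_Weierstrass[OF g, of "\<epsilon> / 2"] \<open>0 < \<epsilon>\<close> by auto
  have "\<exists>r. \<bar>of_rat r - g (real k / real n)\<bar> < \<epsilon> / 2" for k :: nat
  proof -
    obtain r where "of_rat r \<in> {g (real k / real n) - \<epsilon> / 2 <..< g (real k / real n) + \<epsilon> / 2}"
      using of_rat_dense[of "g (real k / real n) - \<epsilon> / 2" "g (real k / real n) + \<epsilon> / 2"] \<open>0 < \<epsilon>\<close> by auto
    then show ?thesis by (intro exI[of _ r]) (auto simp: abs_real_def)
  qed
  then obtain r where r: "\<And>k. \<bar>of_rat (r k) - g (real k / real n)\<bar> < \<epsilon> / 2" by metis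
  \<comment> \<open>n + 1 coefficients, so the degree is recovered as
    \<open>length q - 1\<close>.\<close>
  define q where "q = map r [0..<Suc n]"
  have len: "length q - 1 = n" by (simp add: q_def)
  show thesis
  proof (rule that[of q])
    fix x :: real assume x: "x \<in> {0..1}"
    have "\<bar>(\<Sum>k\<le>n. g (k / n) * Bernstein n k x) - (\<Sum>k\<le>n. of_rat (q ! k) * Bernstein n k x)\<bar>
        = \<bar>\<Sum>k\<le>n. (g (k / n) - of_rat (r k)) * Bernstein n k x\<bar>"
      by (simp add: sum_subtractf[symmetric] left_diff_distrib q_def del: upt_Suc)
    also have "\<dots> \<le> (\<Sum>k\<le>n. \<epsilon> / 2 * Bernstein n k x)"
    proof (intro order_trans[OF sum_abs] sum_mono)
      fix k
      have "\<bar>g (k / n) - of_rat (r k)\<bar> \<le> \<epsilon> / 2" using r[of k] by (simp add: abs_minus_commute)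
      moreover have "0 \<le> Bernstein n k x" using x by (simp add: Bernstein_nonneg)
      ultimately show "\<bar>(g (k / n) - of_rat (r k)) * Bernstein n k x\<bar> \<le> \<epsilon> / 2 * Bernstein n k x"
        by (simp only: abs_mult abs_of_nonneg mult_right_mono)
    qed
    also have "\<dots> = \<epsilon> / 2" by (simp only: sum_distrib_left[symmetric] sum_Bernstein mult_1_right)
    finally show "\<bar>g x - (\<Sum>k\<le>length q - 1. of_rat (q ! k) * Bernstein (length q - 1) k x)\<bar> < \<epsilon>"
      using n[OF x] unfolding len by linarith
  qed
qed

section \<open>Almost sure statements that hold for all sequences of paths at once\<close>

context uniform_tree
begin

text \<open>Away from the root this is the integral of \<open>g\<close> against
  \<open>empirical_unit U x \<omega>\<close> for measurable \<open>g\<close>; at the root, division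
  by zero makes it 0.\<close>

definition path_avg :: "(real \<Rightarrow> real) \<Rightarrow> nat list \<Rightarrow> 'w \<Rightarrow> real" where
  "path_avg g x \<omega> = (\<Sum>y\<in>nonroot_ancestors x. g (U y \<omega>)) / real (length x)"

text \<open>Isolates the random input that a test function contributes. What follows from it is
  deterministic for a fixed outcome, and so applies to sequences of nodes chosen with knowledge of
  that outcome.\<close>

definition chernoff_bounded :: "(real \<Rightarrow> real) \<Rightarrow> 'w \<Rightarrow> bool" where
  "chernoff_bounded g \<omega> \<longleftrightarrow> (\<forall>c > ln (real d) + ln (\<integral>u. exp (g u) \<partial>unit_lebesgue).
     \<forall>\<^sub>F n in sequentially. \<forall>x\<in>level d n. (\<Sum>y\<in>nonroot_ancestors x. g (U y \<omega>)) \<le> real n * c)"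

text \<open>Only the lengths grow: the nodes need not lie on a common ray.\<close>

definition descending :: "(nat \<Rightarrow> nat list) \<Rightarrow> bool" where
  "descending x \<longleftrightarrow> range x \<subseteq> nodes d \<and> strict_mono (\<lambda>k. length (x k))"

text \<open>The bound weakens as \<open>c\<close> grows, so the countable family c0 + 1/(i+1) covers
  all \<open>c\<close> above the threshold.\<close>

lemma AE_chernoff_bounded:
  assumes "g \<in> borel_measurable unit_lebesgue" "integrable unit_lebesgue (\<lambda>u. exp (g u))"
  shows "AE \<omega> in M. chernoff_bounded g \<omega>"
proof -
  define c0 where "c0 = ln (real d) + ln (\<integral>u. exp (g u) \<partial>unit_lebesgue)"
  have "AE \<omega> in M. \<forall>i. \<forall>\<^sub>F n in sequentially. \<forall>x\<in>level d n.
      (\<Sum>y\<in>nonroot_ancestors x. g (U y \<omega>)) \<le> real n * (c0 + 1 / real (Suc i))"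
    unfolding AE_all_countable
    using AE_eventually_ancestor_sum_le[OF assms] by (auto simp: c0_def)
  then show ?thesis
  proof eventually_elim
    case (elim \<omega>)
    show ?case unfolding chernoff_bounded_def c0_def[symmetric]
    proof (intro allI impI)
      fix c assume "c0 < c"
      then obtain i where i: "1 / real (Suc i) < c - c0"
        using reals_Archimedean[of "c - c0"] by (auto simp: inverse_eq_divide)
      show "\<forall>\<^sub>F n in sequentially. \<forall>x\<in>level d n. (\<Sum>y\<in>nonroot_ancestors x. g (U y \<omega>)) \<le> real n * c"
        using elim[rule_format, of i]
      proof eventually_elim
        case (elim n)
        have "real n * (c0 + 1 / real (Suc i)) \<le> real n * c" using i by (intro mult_left_mono) auto
        then show ?case using elim by force
      qed
    qed
  qed
qed

text \<open>Only index 0 can carry the root, so later arguments shift the sequence by one or argue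
  eventually.\<close>

lemma descendingD:
  assumes "descending x"
  shows "x k \<in> nodes d" "k \<le> length (x k)" "0 < k \<Longrightarrow> x k \<noteq> []"
  using assms seq_suble[of "\<lambda>k. length (x k)" k] by (auto simp: descending_def)

lemma descending_subseq: "descending x \<Longrightarrow> strict_mono r \<Longrightarrow> descending (\<lambda>k. x (r k))"
  by (auto simp: descending_def strict_mono_def)

lemma path_avg_chernoff:
  assumes b: "chernoff_bounded g \<omega>" and x: "descending x"
    and c: "ln (real d) + ln (\<integral>u. exp (g u) \<partial>unit_lebesgue) < c"
  shows "\<forall>\<^sub>F k in sequentially. path_avg g (x k) \<omega> \<le> c"
proof -
  obtain N where N: "\<And>n x. N \<le> n \<Longrightarrow> x \<in> level d n \<Longrightarrow> (\<Sum>y\<in>nonroot_ancestors x. g (U y \<omega>)) \<le> real n * c"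
    using b c unfolding chernoff_bounded_def eventually_sequentially by blast
  show ?thesis
  proof (rule eventually_mono[OF eventually_ge_at_top[of "Suc N"]])
    fix k assume "Suc N \<le> k"
    then have "N \<le> length (x k)" "0 < length (x k)"
      using descendingD[OF x, of k] by auto
    then show "path_avg g (x k) \<omega> \<le> c"
      using N[of "length (x k)" "x k"] descendingD(1)[OF x, of k]
      by (simp add: path_avg_def divide_le_eq mult.commute)
  qed
qed

lemma ancestor_in_unit: "x \<in> nodes d \<Longrightarrow> \<omega> \<in> space M \<Longrightarrow> y \<in> nonroot_ancestors x \<Longrightarrow> U y \<omega> \<in> {0..1}"
  using U_in_unit[of y \<omega>] nonroot_ancestors_subset_nodes[of x d] by auto

lemma empirical_unit:
  assumes "x \<in> nodes d" "x \<noteq> []" "\<omega> \<in> space M"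
  shows "empirical_unit U x \<omega> \<in> unit_prob_measures"
    "g \<in> borel_measurable unit_lebesgue \<Longrightarrow> integral\<^sup>L (empirical_unit U x \<omega>) g = path_avg g x \<omega>"
proof -
  have *: "U y \<omega> \<in> space (restrict_space borel {0..1})" if "y \<in> nonroot_ancestors x" for y
    using ancestor_in_unit[OF assms(1,3) that] by (simp add: space_restrict_space)
  show "empirical_unit U x \<omega> \<in> unit_prob_measures"
    using prob_space_empirical[OF assms(2), of "\<lambda>y. U y \<omega>"] *
    by (simp add: unit_prob_measures_def empirical_unit_def)
  show "integral\<^sup>L (empirical_unit U x \<omega>) g = path_avg g x \<omega>" if "g \<in> borel_measurable unit_lebesgue"
    using integral_empirical[OF assms(2) *, of "\<lambda>y. y" g] that *
    by (simp add: empirical_unit_def path_avg_def borel_measurable_unit_lebesgue integral_empirical[OF assms(2)])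
qed

lemma path_avg_mono:
  assumes "x \<in> nodes d" "\<omega> \<in> space M" "\<And>u. u \<in> {0..1} \<Longrightarrow> g u \<le> h u"
  shows "path_avg g x \<omega> \<le> path_avg h x \<omega>"
  unfolding path_avg_def using assms ancestor_in_unit[OF assms(1,2)]
  by (intro divide_right_mono sum_mono) auto

lemma path_avg_linear:
  "path_avg (\<lambda>u. g u + h u) x \<omega> = path_avg g x \<omega> + path_avg h x \<omega>"
  "path_avg (\<lambda>u. g u - h u) x \<omega> = path_avg g x \<omega> - path_avg h x \<omega>"
  "path_avg (\<lambda>u. a * g u) x \<omega> = a * path_avg g x \<omega>"
  by (simp_all add: path_avg_def sum.distrib sum_subtractf sum_distrib_left add_divide_distrib diff_divide_distrib)

lemma weak_conv_path_avg:
  assumes "descending x" "\<omega> \<in> space M" "weak_conv_unit (\<lambda>k. empirical_unit U (x k) \<omega>) s" "continuous_on {0..1} g"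
  shows "(\<lambda>k. path_avg g (x k) \<omega>) \<longlonglongrightarrow> integral\<^sup>L s g"
proof (rule Lim_transform_eventually)
  show "(\<lambda>k. integral\<^sup>L (empirical_unit U (x k) \<omega>) g) \<longlonglongrightarrow> integral\<^sup>L s g"
    using assms by (simp add: weak_conv_unit_def)
  show "\<forall>\<^sub>F k in sequentially. integral\<^sup>L (empirical_unit U (x k) \<omega>) g = path_avg g (x k) \<omega>"
    using eventually_gt_at_top[of "0::nat"]
    by eventually_elim (use assms descendingD[OF assms(1)] empirical_unit(2) continuous_imp_measurable_unit in auto)
qed

text \<open>The null set is fixed for the rational Bernstein polynomials before any sequence or
  limit is chosen. Replacing a continuous \<open>g\<close> by a polynomial within e/2 costs e/2 on
  each side of the Donsker-Varadhan inequality.\<close>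

lemma AE_weak_limit_in_kl_ball:
  "AE \<omega> in M. \<forall>x s. descending x \<longrightarrow> s \<in> unit_prob_measures \<longrightarrow>
    weak_conv_unit (\<lambda>k. empirical_unit U (x k) \<omega>) s \<longrightarrow> s \<in> kl_ball d"
proof -
  define p where "p q x = (\<Sum>k\<le>length q - 1. of_rat (q ! k) * Bernstein (length q - 1) k x)" for q :: "rat list" and x :: real
  have pc: "continuous_on A (p q)" for q A
    unfolding p_def Bernstein_def by (intro continuous_intros)
  have cont_int: "integrable s g" if s: "s \<in> unit_prob_measures" and g: "continuous_on {0..1} g" for s and g :: "real \<Rightarrow> real"
  proof -
    obtain B where B: "\<And>x. x \<in> {0..1} \<Longrightarrow> \<bar>g x\<bar> \<le> B"
      using continuous_bounded_unit[OF g] by blast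
    show ?thesis
      using s B continuous_imp_measurable_unit[OF g]
      by (intro integrable_unit_bounded[where C = B])
        (auto simp: unit_prob_measures_def space_unit_prob_measures[OF s] measurable_cong_sets[OF sets_unit_prob_measures[OF s] refl])
  qed
  have L: "unit_lebesgue \<in> unit_prob_measures"
    by (simp add: unit_prob_measures_def unit_lebesgue.prob_space_axioms sets_unit_lebesgue)
  have ec: "integrable unit_lebesgue (\<lambda>u. exp (g u))" if "continuous_on {0..1} g" for g :: "real \<Rightarrow> real"
    using that by (intro cont_int[OF L] continuous_intros)
  have "AE \<omega> in M. \<forall>q. chernoff_bounded (p q) \<omega>"
    unfolding AE_all_countable
    by (intro allI AE_chernoff_bounded continuous_imp_measurable_unit pc ec)
  then show ?thesis using AE_space
  proof eventually_elim
    case (elim \<omega>)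
    show ?case
    proof (intro allI impI)
      fix x s assume x: "descending x" and s: "s \<in> unit_prob_measures"
        and conv: "weak_conv_unit (\<lambda>k. empirical_unit U (x k) \<omega>) s"
      interpret s: prob_space s using s by (simp add: unit_prob_measures_def)
      have "integral\<^sup>L s g \<le> ln (real d) + ln (\<integral>u. exp (g u) \<partial>unit_lebesgue)" if "continuous_on UNIV g" for g :: "real \<Rightarrow> real"
      proof (rule field_le_epsilon)
        fix e :: real assume "0 < e"
        have g: "continuous_on {0..1} g" using that continuous_on_subset by blast
        obtain q where q: "\<And>x. x \<in> {0..1} \<Longrightarrow> \<bar>g x - p q x\<bar> < e / 2"
          using continuous_approx_rat_Bernstein[OF g, of "e / 2"] \<open>0 < e\<close> unfolding p_def by auto
        have "integral\<^sup>L s g \<le> (\<integral>u. p q u + e / 2 \<partial>s)"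
        proof (intro integral_mono cont_int[OF s g])
          show "integrable s (\<lambda>u. p q u + e / 2)" using cont_int[OF s pc] by simp
          fix u assume "u \<in> space s"
          then show "g u \<le> p q u + e / 2"
            using q[of u] unfolding space_unit_prob_measures[OF s] by linarith
        qed
        also have "\<dots> = integral\<^sup>L s (p q) + e / 2"
          using cont_int[OF s pc] s.prob_space by simp
        also have "integral\<^sup>L s (p q) \<le> ln (real d) + ln (\<integral>u. exp (p q u) \<partial>unit_lebesgue)"
        proof (rule dense_ge)
          fix c assume "ln (real d) + ln (\<integral>u. exp (p q u) \<partial>unit_lebesgue) < c"
          then have "\<forall>\<^sub>F k in sequentially. path_avg (p q) (x k) \<omega> \<le> c"
            using elim(1) x by (intro path_avg_chernoff) auto
          then show "integral\<^sup>L s (p q) \<le> c"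
            by (intro tendsto_upperbound[OF weak_conv_path_avg[OF x elim(2) conv pc]]) auto
        qed
        also have "ln (\<integral>u. exp (p q u) \<partial>unit_lebesgue) \<le> ln (exp (e / 2) * (\<integral>u. exp (g u) \<partial>unit_lebesgue))"
        proof -
          have "(\<integral>u. exp (p q u) \<partial>unit_lebesgue) \<le> (\<integral>u. exp (e / 2) * exp (g u) \<partial>unit_lebesgue)"
          proof (intro integral_mono ec pc integrable_mult_right g)
            fix u assume "u \<in> space unit_lebesgue"
            then have "p q u \<le> e / 2 + g u" using q[of u] unfolding space_unit_lebesgue by linarith
            then show "exp (p q u) \<le> exp (e / 2) * exp (g u)" by (simp add: exp_add[symmetric])
          qed
          moreover have "0 < (\<integral>u. exp (p q u) \<partial>unit_lebesgue)" by (intro integral_exp_pos ec pc)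
          ultimately show ?thesis by simp
        qed
        also have "\<dots> = e / 2 + ln (\<integral>u. exp (g u) \<partial>unit_lebesgue)"
          using integral_exp_pos[OF ec[OF g]] by (simp add: ln_mult)
        finally show "integral\<^sup>L s g \<le> ln (real d) + ln (\<integral>u. exp (g u) \<partial>unit_lebesgue) + e"
          by (simp add: algebra_simps)
      qed
      then show "s \<in> kl_ball d"
        using s kl_div_le_of_continuous_bound[OF s] by (simp add: kl_ball_def)
    qed
  qed
qed

text \<open>Compares \<open>h\<close> with a continuous approximant \<open>g n\<close>, for which
  weak convergence applies. Almost everywhere closeness means nothing for atomic empirical measures;
  what makes the averages of |h - g_n| small is the Chernoff bound for i |h - g_n|.\<close>

lemma AE_path_avg_tendsto:
  assumes hm [measurable]: "h \<in> borel_measurable unit_lebesgue" and hb: "\<And>u. \<bar>h u\<bar> \<le> C"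
  shows "AE \<omega> in M. \<forall>x s. descending x \<longrightarrow> s \<in> kl_ball d \<longrightarrow>
    weak_conv_unit (\<lambda>k. empirical_unit U (x k) \<omega>) s \<longrightarrow> (\<lambda>k. path_avg h (x k) \<omega>) \<longlonglongrightarrow> integral\<^sup>L s h"
proof -
  obtain g :: "nat \<Rightarrow> real \<Rightarrow> real" where g: "\<And>n. continuous_on UNIV (g n)" "\<And>n u. \<bar>g n u\<bar> \<le> C"
    "AE u in unit_lebesgue. (\<lambda>n. g n u) \<longlonglongrightarrow> h u"
    using bounded_measurable_approx_continuous[OF hm hb] by blast
  have gc: "continuous_on A (g n)" for A n using g(1) by (rule continuous_on_subset) auto
  have [measurable]: "g n \<in> borel_measurable unit_lebesgue" for n
    by (rule continuous_imp_measurable_unit[OF gc])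
  have diff: "\<bar>h u - g n u\<bar> \<le> 2 * C" for n u using hb[of u] g(2)[of n u] by linarith
  have eb: "\<bar>exp (\<theta> * \<bar>h u - g n u\<bar>)\<bar> \<le> exp (\<theta> * (2 * C))" if "0 \<le> \<theta>" for \<theta> n u
    using diff[of u n] that by (simp add: mult_left_mono)
  have "AE \<omega> in M. \<forall>i n. chernoff_bounded (\<lambda>u. real i * \<bar>h u - g n u\<bar>) \<omega>"
    unfolding AE_all_countable
  proof (intro allI AE_chernoff_bounded)
    show "integrable unit_lebesgue (\<lambda>u. exp (real i * \<bar>h u - g n u\<bar>))" for i n
      by (rule integrable_unit_bounded[OF unit_lebesgue.prob_space_axioms _ eb]) simp_all
  qed simp
  then show ?thesis using AE_space
  proof eventually_elim
    case (elim \<omega>)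
    show ?case
    proof (intro allI impI tendstoI)
      fix x s and e :: real assume x: "descending x" and s_ball: "s \<in> kl_ball d" and "0 < e"
        and conv: "weak_conv_unit (\<lambda>k. empirical_unit U (x k) \<omega>) s"
      have s: "s \<in> unit_prob_measures" using s_ball by (simp add: kl_ball_def)
      interpret s: prob_space s using s by (simp add: unit_prob_measures_def)
      have ac: "absolutely_continuous unit_lebesgue s"
        using s_ball by (auto simp: kl_ball_def kl_div_def split: if_splits)
      have "(\<lambda>n. integral\<^sup>L s (g n)) \<longlonglongrightarrow> integral\<^sup>L s h"
        by (rule tendsto_expectation_bounded[OF s.prob_space_axioms _ _ g(2)
          AE_absolutely_continuous[OF ac sets_unit_prob_measures[OF s] g(3)]])
          (simp_all add: borel_measurable_unit_prob_measures[OF s])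
      then have "\<forall>\<^sub>F n in sequentially. dist (integral\<^sup>L s (g n)) (integral\<^sup>L s h) < e / 4"
        using \<open>0 < e\<close> by (intro tendstoD) auto
      \<comment> \<open>\<open>i\<close> comes first and absorbs ln d; then \<open>n\<close> is
        taken large for this \<open>i\<close>. The two shares e/8 give averages of |h - g_n| at most
        e/4, one of three errors e/4.\<close>
      moreover obtain i where i: "ln (real d) / (e / 8) < real i" "0 < i"
        using reals_Archimedean2[of "max 0 (ln (real d) / (e / 8))"] by auto
      moreover have "(\<lambda>n. \<integral>u. exp (real i * \<bar>h u - g n u\<bar>) \<partial>unit_lebesgue) \<longlonglongrightarrow> (\<integral>u. 1 \<partial>unit_lebesgue)"
      proof (rule tendsto_expectation_bounded[OF unit_lebesgue.prob_space_axioms _ _ eb])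
        show "AE u in unit_lebesgue. (\<lambda>n. exp (real i * \<bar>h u - g n u\<bar>)) \<longlonglongrightarrow> 1"
          using g(3)
        proof eventually_elim
          case (elim u)
          then have "(\<lambda>n. exp (real i * \<bar>h u - g n u\<bar>)) \<longlonglongrightarrow> exp (real i * \<bar>h u - h u\<bar>)"
            by (intro tendsto_intros)
          then show ?case by simp
        qed
      qed measurable
      then have "(\<lambda>n. ln (\<integral>u. exp (real i * \<bar>h u - g n u\<bar>) \<partial>unit_lebesgue)) \<longlonglongrightarrow> ln 1"
        using unit_lebesgue.prob_space by (intro tendsto_intros) auto
      then have "\<forall>\<^sub>F n in sequentially. ln (\<integral>u. exp (real i * \<bar>h u - g n u\<bar>) \<partial>unit_lebesgue) < e / 8"
        using \<open>0 < e\<close> by (intro order_tendstoD) auto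
      ultimately have "\<forall>\<^sub>F n in sequentially. dist (integral\<^sup>L s (g n)) (integral\<^sup>L s h) < e / 4 \<and>
          ln (\<integral>u. exp (real i * \<bar>h u - g n u\<bar>) \<partial>unit_lebesgue) < e / 8"
        by (intro eventually_conj)
      then obtain n where n: "dist (integral\<^sup>L s (g n)) (integral\<^sup>L s h) < e / 4"
          "ln (\<integral>u. exp (real i * \<bar>h u - g n u\<bar>) \<partial>unit_lebesgue) < e / 8"
        by (auto simp: eventually_sequentially)
      have "1 * (e / 8) \<le> real i * (e / 8)" using i(2) \<open>0 < e\<close> by (intro mult_right_mono) auto
      moreover have "ln (real d) < real i * (e / 8)" using i \<open>0 < e\<close> by (simp add: pos_divide_less_eq)
      ultimately have "ln (real d) + ln (\<integral>u. exp (real i * \<bar>h u - g n u\<bar>) \<partial>unit_lebesgue) < real i * (e / 4)"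
        using n(2) by simp
      from path_avg_chernoff[OF elim(1)[rule_format] x this]
      have "\<forall>\<^sub>F k in sequentially. path_avg (\<lambda>u. \<bar>h u - g n u\<bar>) (x k) \<omega> \<le> e / 4"
        using i(2) by (simp add: path_avg_linear)
      moreover have "\<forall>\<^sub>F k in sequentially. dist (path_avg (g n) (x k) \<omega>) (integral\<^sup>L s (g n)) < e / 4"
        using weak_conv_path_avg[OF x elim(2) conv gc] \<open>0 < e\<close> by (intro tendstoD) auto
      ultimately show "\<forall>\<^sub>F k in sequentially. dist (path_avg h (x k) \<omega>) (integral\<^sup>L s h) < e"
      proof eventually_elim
        case (elim k)
        have "path_avg (\<lambda>u. h u - g n u) (x k) \<omega> \<le> path_avg (\<lambda>u. \<bar>h u - g n u\<bar>) (x k) \<omega>"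
          "path_avg (\<lambda>u. g n u - h u) (x k) \<omega> \<le> path_avg (\<lambda>u. \<bar>h u - g n u\<bar>) (x k) \<omega>"
          using descendingD(1)[OF x] \<open>\<omega> \<in> space M\<close> by (intro path_avg_mono; simp)+
        then have "\<bar>path_avg h (x k) \<omega> - path_avg (g n) (x k) \<omega>\<bar> \<le> e / 4"
          using elim(1) unfolding path_avg_linear by linarith
        then show ?case using elim(2) n(1) \<open>0 < e\<close> unfolding dist_real_def by linarith
      qed
    qed
  qed
qed

end

text \<open>The moment hypothesis of the theorem enters as finiteness of every exponential moment of
  the negative part; \<open>integrable_exp_of_powr\<close> supplies it.\<close>

locale weighted_tree = uniform_tree +
  fixes \<tau> :: "real \<Rightarrow> real"
  assumes measurable_weight [measurable]: "\<tau> \<in> borel_measurable unit_lebesgue"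
    and exp_moment: "\<And>\<theta>. integrable unit_lebesgue (\<lambda>u. exp (\<theta> * max (- \<tau> u) 0))"
begin

lemma kl_ballE:
  assumes "s \<in> kl_ball d"
  obtains f where "finite_entropy f" "s = density unit_lebesgue f" "rel_entropy f \<le> ln (real d)"
    "kl_div s unit_lebesgue = ereal (rel_entropy f)"
proof -
  have "s \<in> unit_prob_measures" and le: "kl_div s unit_lebesgue \<le> ereal (ln (real d))"
    using assms by (auto simp: kl_ball_def)
  moreover have "kl_div s unit_lebesgue < \<infinity>"
    using le_less_trans[OF le, of \<infinity>] by simp
  ultimately obtain f where "finite_entropy f" "s = density unit_lebesgue f"
    "kl_div s unit_lebesgue = ereal (rel_entropy f)"
    using kl_div_finiteE by blast
  then show thesis using that le by simp
qed



lemma integrable_neg_weight: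
  assumes f: "finite_entropy f"
  shows "integrable (density unit_lebesgue f) (\<lambda>u. max (- \<tau> u) 0)"
proof -
  have "integrable unit_lebesgue (\<lambda>u. f u * max (- \<tau> u) 0)"
    using exp_moment[of 1] by (intro integrable_mult_of_exp[OF f]) auto
  then show ?thesis by (simp add: integrable_density_unit[OF finite_entropyD(1)[OF f]])
qed

text \<open>Truncations \<open>h K\<close> of the weight are bounded, so their averages converge,
  and \<open>h K\<close> is at most the weight plus the negative tail \<open>t K\<close>. Chernoff
  bounds make the tail averages small uniformly along long paths. Nothing controls the positive
  tail, hence lower semicontinuity only.\<close>

lemma AE_ext_integral_le:
  "AE \<omega> in M. \<forall>x s l. descending x \<longrightarrow> s \<in> kl_ball d \<longrightarrow>
    weak_conv_unit (\<lambda>k. empirical_unit U (x k) \<omega>) s \<longrightarrow>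
    (\<lambda>k. path_avg \<tau> (x k) \<omega>) \<longlonglongrightarrow> l \<longrightarrow> ext_integral \<tau> s \<le> ereal l"
proof -
  define h where "h K u = max (- real K) (min (real K) (\<tau> u))" for K u
  define t where "t K u = max (- \<tau> u - real K) 0" for K u
  have [measurable]: "h K \<in> borel_measurable unit_lebesgue" "t K \<in> borel_measurable unit_lebesgue" for K
    unfolding h_def t_def by measurable
  have t: "0 \<le> t K u" "t K u \<le> max (- \<tau> u) 0" for K u by (auto simp: t_def)
  have te: "integrable unit_lebesgue (\<lambda>u. exp (real i * t K u))" for i K
    by (rule Bochner_Integration.integrable_bound[OF exp_moment[of "real i"]])
       (auto intro!: mult_left_mono t)
  have hb: "\<bar>h K u\<bar> \<le> real K" for K u by (auto simp: h_def)
  have "AE \<omega> in M. \<forall>i K. chernoff_bounded (\<lambda>u. real i * t K u) \<omega>"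
    unfolding AE_all_countable by (intro allI AE_chernoff_bounded te) auto
  moreover have "AE \<omega> in M. \<forall>K. \<forall>x s. descending x \<longrightarrow> s \<in> kl_ball d \<longrightarrow>
      weak_conv_unit (\<lambda>k. empirical_unit U (x k) \<omega>) s \<longrightarrow> (\<lambda>k. path_avg (h K) (x k) \<omega>) \<longlonglongrightarrow> integral\<^sup>L s (h K)"
    unfolding AE_all_countable using AE_path_avg_tendsto[OF _ hb] by auto
  ultimately show ?thesis using AE_space
  proof eventually_elim
    case (elim \<omega>)
    show ?case
    proof (intro allI impI)
      fix x s l assume x: "descending x" and s_ball: "s \<in> kl_ball d"
        and conv: "weak_conv_unit (\<lambda>k. empirical_unit U (x k) \<omega>) s"
        and lim: "(\<lambda>k. path_avg \<tau> (x k) \<omega>) \<longlonglongrightarrow> l"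
      have s: "s \<in> unit_prob_measures" using s_ball by (simp add: kl_ball_def)
      interpret s: prob_space s using s by (simp add: unit_prob_measures_def)
      obtain f where "finite_entropy f" "s = density unit_lebesgue f" using kl_ballE[OF s_ball] .
      then have neg: "integrable s (\<lambda>u. max (- \<tau> u) 0)" using integrable_neg_weight by simp
      define m where "m = (\<integral>u. max (- \<tau> u) 0 \<partial>s)"
      have hi: "integrable s (h K)" for K
        by (rule integrable_unit_bounded[OF s.prob_space_axioms _ hb])
          (simp add: borel_measurable_unit_prob_measures[OF s])
      have bound: "\<forall>\<^sub>F K in sequentially. integral\<^sup>L s (h K) \<le> l + e" if "0 < e" for e
      proof -
        \<comment> \<open>\<open>i\<close> makes ln d at most half of i * e; afterwards
          \<open>K\<close> large makes the exponential integral of the tail close to 1, dominated by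
          an exponential moment.\<close>
        obtain i where i: "ln (real d) / (e / 2) < real i" "0 < i"
          using reals_Archimedean2[of "max 0 (ln (real d) / (e / 2))"] by auto
        have "(\<lambda>K. \<integral>u. exp (real i * t K u) \<partial>unit_lebesgue) \<longlonglongrightarrow> (\<integral>u. 1 \<partial>unit_lebesgue)"
        proof (rule integral_dominated_convergence[OF _ _ exp_moment[of "real i"]])
          show "AE u in unit_lebesgue. (\<lambda>K. exp (real i * t K u)) \<longlonglongrightarrow> 1"
          proof (rule AE_I2)
            fix u
            obtain N :: nat where N: "- \<tau> u < real N" using reals_Archimedean2 by blast
            have "exp (real i * t K u) = 1" if "N \<le> K" for K
              using N that by (simp add: t_def)
            then have "\<forall>\<^sub>F K in sequentially. exp (real i * t K u) = 1"
              unfolding eventually_sequentially by auto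
            then show "(\<lambda>K. exp (real i * t K u)) \<longlonglongrightarrow> 1" by (rule tendsto_eventually)
          qed
          show "AE u in unit_lebesgue. norm (exp (real i * t K u)) \<le> exp (real i * max (- \<tau> u) 0)" for K
            by (auto intro!: mult_left_mono t)
        qed measurable
        then have "(\<lambda>K. ln (\<integral>u. exp (real i * t K u) \<partial>unit_lebesgue)) \<longlonglongrightarrow> ln 1"
          using unit_lebesgue.prob_space by (intro tendsto_intros) auto
        then have "\<forall>\<^sub>F K in sequentially. ln (\<integral>u. exp (real i * t K u) \<partial>unit_lebesgue) < e / 2"
          using \<open>0 < e\<close> by (intro order_tendstoD) auto
        then show ?thesis
        proof eventually_elim
          case (elim K)
          have "1 * (e / 2) \<le> real i * (e / 2)" using i(2) \<open>0 < e\<close> by (intro mult_right_mono) auto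
          moreover have "ln (real d) < real i * (e / 2)" using i \<open>0 < e\<close> by (simp add: pos_divide_less_eq)
          ultimately have "ln (real d) + ln (\<integral>u. exp (real i * t K u) \<partial>unit_lebesgue) < real i * e"
            using elim by simp
          from path_avg_chernoff[OF \<open>\<forall>i K. chernoff_bounded _ \<omega>\<close>[rule_format] x this]
          have tail: "\<forall>\<^sub>F k in sequentially. path_avg (t K) (x k) \<omega> \<le> e"
            using i(2) by (simp add: path_avg_linear)
          have "\<forall>\<^sub>F k in sequentially. path_avg (h K) (x k) \<omega> \<le> path_avg \<tau> (x k) \<omega> + e"
            using tail
          proof eventually_elim
            case (elim k)
            have "path_avg (h K) (x k) \<omega> \<le> path_avg (\<lambda>u. \<tau> u + t K u) (x k) \<omega>"
              using descendingD(1)[OF x] \<open>\<omega> \<in> space M\<close> by (intro path_avg_mono) (auto simp: h_def t_def)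
            then show ?case using elim by (simp add: path_avg_linear)
          qed
          moreover have "(\<lambda>k. path_avg \<tau> (x k) \<omega> + e) \<longlonglongrightarrow> l + e" by (intro tendsto_intros lim)
          moreover have "(\<lambda>k. path_avg (h K) (x k) \<omega>) \<longlonglongrightarrow> integral\<^sup>L s (h K)"
            using \<open>\<forall>K x s. _ x s K\<close> x s_ball conv by blast
          ultimately show ?case
            by (intro tendsto_le[OF sequentially_bot]) auto
        qed
      qed
      \<comment> \<open>Adding the integrable negative part makes the truncations nonnegative, so
        Fatou's lemma applies as \<open>K\<close> grows.\<close>
      have pos: "(\<integral>\<^sup>+u. ennreal (\<tau> u + max (- \<tau> u) 0) \<partial>s) \<le> ennreal (l + e + m)" if "0 < e" for e
      proof -
        have "(\<integral>\<^sup>+u. ennreal (\<tau> u + max (- \<tau> u) 0) \<partial>s) = (\<integral>\<^sup>+u. liminf (\<lambda>K. ennreal (h K u + max (- \<tau> u) 0)) \<partial>s)"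
        proof (intro nn_integral_cong lim_imp_Liminf[symmetric])
          fix u
          obtain N :: nat where N: "\<bar>\<tau> u\<bar> < real N" using reals_Archimedean2 by blast
          have "h K u = \<tau> u" if "N \<le> K" for K
            using N that by (simp add: h_def)
          then have "\<forall>\<^sub>F K in sequentially. ennreal (h K u + max (- \<tau> u) 0) = ennreal (\<tau> u + max (- \<tau> u) 0)"
            unfolding eventually_sequentially by (intro exI[of _ N]) simp
          then show "(\<lambda>K. ennreal (h K u + max (- \<tau> u) 0)) \<longlonglongrightarrow> ennreal (\<tau> u + max (- \<tau> u) 0)"
            by (rule tendsto_eventually)
        qed simp
        also have "\<dots> \<le> liminf (\<lambda>K. \<integral>\<^sup>+u. ennreal (h K u + max (- \<tau> u) 0) \<partial>s)"
          by (intro nn_integral_liminf) (simp add: borel_measurable_unit_prob_measures[OF s])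
        also have "\<dots> \<le> liminf (\<lambda>K. ennreal (l + e + m))"
        proof (intro Liminf_mono eventually_mono[OF bound[OF that]])
          fix K assume "integral\<^sup>L s (h K) \<le> l + e"
          moreover have "(\<integral>\<^sup>+u. ennreal (h K u + max (- \<tau> u) 0) \<partial>s) = ennreal (integral\<^sup>L s (h K) + m)"
          proof (subst nn_integral_eq_integral)
            show "AE u in s. 0 \<le> h K u + max (- \<tau> u) 0" by (auto simp: h_def)
          qed (use hi[of K] neg in \<open>auto simp: m_def\<close>)
          ultimately show "(\<integral>\<^sup>+u. ennreal (h K u + max (- \<tau> u) 0) \<partial>s) \<le> ennreal (l + e + m)"
            by (simp add: ennreal_leI)
        qed
        also have "\<dots> = ennreal (l + e + m)" by (simp add: Liminf_const)
        finally show ?thesis .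
      qed
      have "integrable s (\<lambda>u. \<tau> u + max (- \<tau> u) 0)"
        using pos[of 1] by (intro integrableI_bounded)
          (auto simp: borel_measurable_unit_prob_measures[OF s] intro: le_less_trans)
      from Bochner_Integration.integrable_diff[OF this neg] have i: "integrable s \<tau>" by simp
      have "integral\<^sup>L s \<tau> \<le> l"
      proof (rule field_le_epsilon)
        fix e :: real assume "0 < e"
        have "ennreal (integral\<^sup>L s \<tau> + m) = (\<integral>\<^sup>+u. ennreal (\<tau> u + max (- \<tau> u) 0) \<partial>s)"
          using i neg by (subst nn_integral_eq_integral) (auto simp: m_def max_def)
        also have "\<dots> \<le> ennreal (l + e + m)" by (rule pos[OF \<open>0 < e\<close>])
        finally have le: "ennreal (integral\<^sup>L s \<tau> + m) \<le> ennreal (l + e + m)" .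
        \<comment> \<open>\<open>ennreal\<close> sends negative reals to 0, so the inequality can be
          read back in the reals only with this sign.\<close>
        have "0 \<le> l + e + m"
        proof -
          obtain K where K: "integral\<^sup>L s (h K) \<le> l + e"
            using bound[OF \<open>0 < e\<close>] by (auto simp: eventually_sequentially)
          have "0 \<le> (\<integral>u. h K u + max (- \<tau> u) 0 \<partial>s)" by (rule Bochner_Integration.integral_nonneg) (auto simp: h_def)
          then show ?thesis using K hi[of K] neg by (simp add: m_def)
        qed
        then show "integral\<^sup>L s \<tau> \<le> l + e" using le by simp
      qed
      then show "ext_integral \<tau> s \<le> ereal l" by (simp add: ext_integral_eq_integral[OF i])
    qed
  qed
qed

end

section \<open>Tilting\<close>

lemma exists_bounded_weight_set:
  assumes \<tau> [measurable]: "\<tau> \<in> borel_measurable unit_lebesgue" and "p < 1"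
  obtains K :: nat where "p < measure unit_lebesgue {u\<in>space unit_lebesgue. \<bar>\<tau> u :: real\<bar> \<le> real K}"
proof -
  have "{u\<in>space unit_lebesgue. \<bar>\<tau> u\<bar> \<le> real K} \<in> sets unit_lebesgue" for K
    by measurable
  then have "(\<lambda>K. measure unit_lebesgue {u\<in>space unit_lebesgue. \<bar>\<tau> u\<bar> \<le> real K})
    \<longlonglongrightarrow> measure unit_lebesgue (\<Union>K. {u\<in>space unit_lebesgue. \<bar>\<tau> u\<bar> \<le> real K})"
    by (intro unit_lebesgue.finite_Lim_measure_incseq) (auto simp: incseq_def simp del: space_unit_lebesgue)
  also have "(\<Union>K. {u\<in>space unit_lebesgue. \<bar>\<tau> u\<bar> \<le> real K}) = space unit_lebesgue"
    using real_arch_simple by auto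
  finally have "\<forall>\<^sub>F K in sequentially. p < measure unit_lebesgue {u\<in>space unit_lebesgue. \<bar>\<tau> u\<bar> \<le> real K}"
    using \<open>p < 1\<close> unit_lebesgue.prob_space by (intro order_tendstoD) auto
  then show thesis using that by (auto simp: eventually_sequentially)
qed

lemma exists_small_convex_weight:
  fixes a b c :: real
  assumes "a < c"
  obtains t where "0 < t" "t \<le> 1" "(1 - t) * a + t * b < c"
proof -
  have "((\<lambda>t. (1 - t) * a + t * b) \<longlongrightarrow> (1 - 0) * a + 0 * b) (at_right 0)"
    by (intro tendsto_intros)
  then have "\<forall>\<^sub>F t in at_right 0. (1 - t) * a + t * b < c"
    using assms by (intro order_tendstoD) auto
  moreover have "\<forall>\<^sub>F t in at_right (0::real). t \<in> {0<..<1}"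
    by (rule eventually_at_right_real) simp
  ultimately have "\<forall>\<^sub>F t in at_right (0::real). t \<in> {0<..<1} \<and> (1 - t) * a + t * b < c"
    by eventually_elim simp
  then obtain t where "t \<in> {0<..<1}" "(1 - t) * a + t * b < c"
    using eventually_happens'[of "at_right (0::real)"] by (auto simp: trivial_limit_at_right_real)
  then show thesis using that[of t] by auto
qed

text \<open>Lebesgue measure has entropy 0 but may give the weight an infinite mean. The uniform law
  on a set where the weight is bounded has finite mean, and its entropy is small when that set is
  nearly everything.\<close>

lemma exists_bounded_uniform_density:
  assumes \<tau> [measurable]: "\<tau> \<in> borel_measurable unit_lebesgue" and "0 < c"
  obtains h where "finite_entropy h" "rel_entropy h < c" "integrable unit_lebesgue (\<lambda>u. h u * \<tau> u)"
proof -
  \<comment> \<open>Measure above exp (-c) is the same as entropy below c.\<close>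
  obtain K :: nat where K: "exp (- c) < measure unit_lebesgue {u\<in>space unit_lebesgue. \<bar>\<tau> u\<bar> \<le> real K}"
    using exists_bounded_weight_set[OF \<tau>, of "exp (- c)"] \<open>0 < c\<close> by auto
  define B where "B = {u\<in>space unit_lebesgue. \<bar>\<tau> u\<bar> \<le> real K}"
  have B: "B \<in> sets unit_lebesgue" unfolding B_def by measurable
  have pos: "0 < measure unit_lebesgue B" "exp (- c) < measure unit_lebesgue B"
    using K less_trans[OF exp_gt_zero K] by (auto simp: B_def)
  note h = finite_entropy_uniform_on[OF B pos(1)]
  have "- c < ln (measure unit_lebesgue B)"
    using pos by (subst exp_less_cancel_iff[symmetric]) simp
  then have "rel_entropy (uniform_density B) < c" by (simp add: h(2))
  moreover have "integrable unit_lebesgue (\<lambda>u. uniform_density B u * \<tau> u)"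
  proof (rule integrable_unit_bounded[OF unit_lebesgue.prob_space_axioms])
    show "\<bar>uniform_density B u * \<tau> u\<bar> \<le> real K / measure unit_lebesgue B" for u
    proof (cases "u \<in> B")
      case True
      then have "\<bar>\<tau> u\<bar> \<le> real K" by (simp add: B_def)
      then show ?thesis using True pos(1) by (simp add: uniform_density_def abs_mult divide_right_mono)
    qed (use pos(1) in \<open>simp add: uniform_density_def\<close>)
    show "(\<lambda>u. uniform_density B u * \<tau> u) \<in> borel_measurable unit_lebesgue"
      using prob_densityD(4)[OF finite_entropyD(1)[OF h(1)]] by measurable
  qed
  ultimately show thesis using that h(1) by blast
qed

lemma integral_mixture:
  fixes f g w :: "real \<Rightarrow> real" and t :: real
  assumes "integrable unit_lebesgue (\<lambda>u. f u * w u)" "integrable unit_lebesgue (\<lambda>u. g u * w u)"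
  shows "integrable unit_lebesgue (\<lambda>u. ((1 - t) * f u + t * g u) * w u)"
    "(\<integral>u. ((1 - t) * f u + t * g u) * w u \<partial>unit_lebesgue)
      = (1 - t) * (\<integral>u. f u * w u \<partial>unit_lebesgue) + t * (\<integral>u. g u * w u \<partial>unit_lebesgue)"
proof -
  have eq: "((1 - t) * f u + t * g u) * w u = (1 - t) * (f u * w u) + t * (g u * w u)" for u
    by (simp add: algebra_simps)
  show "integrable unit_lebesgue (\<lambda>u. ((1 - t) * f u + t * g u) * w u)"
    "(\<integral>u. ((1 - t) * f u + t * g u) * w u \<partial>unit_lebesgue)
      = (1 - t) * (\<integral>u. f u * w u \<partial>unit_lebesgue) + t * (\<integral>u. g u * w u \<partial>unit_lebesgue)"
    unfolding eq using assms by simp_all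
qed

text \<open>Moves from the boundary of the entropy ball into its interior: mix in a small share of a
  law of smaller entropy and finite mean. The strict inequality for the mean survives a small
  share.\<close>

lemma decrease_rel_entropy:
  assumes f: "finite_entropy f" "rel_entropy f \<le> c" "0 < c"
    and \<tau> [measurable]: "\<tau> \<in> borel_measurable unit_lebesgue"
    and i: "integrable unit_lebesgue (\<lambda>u. f u * \<tau> u)" "(\<integral>u. f u * \<tau> u \<partial>unit_lebesgue) < \<eta>"
  obtains g where "finite_entropy g" "rel_entropy g < c" "integrable unit_lebesgue (\<lambda>u. g u * \<tau> u)"
    "(\<integral>u. g u * \<tau> u \<partial>unit_lebesgue) < \<eta>"
proof -
  obtain h where h: "finite_entropy h" "rel_entropy h < c" "integrable unit_lebesgue (\<lambda>u. h u * \<tau> u)"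
    using exists_bounded_uniform_density[OF \<tau> f(3)] .
  obtain t where t: "0 < t" "t \<le> 1"
    "(1 - t) * (\<integral>u. f u * \<tau> u \<partial>unit_lebesgue) + t * (\<integral>u. h u * \<tau> u \<partial>unit_lebesgue) < \<eta>"
    using exists_small_convex_weight[OF i(2)] by blast
  note mix = finite_entropy_mix(1,2)[OF f(1) h(1) less_imp_le[OF t(1)] t(2)]
  have "(1 - t) * rel_entropy f + t * rel_entropy h < (1 - t) * c + t * c"
    using f(2) h(2) t by (intro add_le_less_mono mult_left_mono mult_strict_left_mono) auto
  then have "rel_entropy (\<lambda>u. (1 - t) * f u + t * h u) < c"
    using mix(2) by (simp add: algebra_simps)
  then show thesis
    using that[OF mix(1)] integral_mixture[OF i(1) h(3), of t] t(3) by simp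
qed

text \<open>Conditions the law on the set \<open>A K\<close> where the weight and the log density
  are bounded by \<open>K\<close>. With Z the mass of this set, the conditioned entropy is E/Z - ln
  Z; entropy and mean converge to the original ones, so the strict inequalities hold for some
  \<open>K\<close>. The boundedness is for Hoeffding's inequality.\<close>

lemma truncate_density:
  assumes f: "finite_entropy f" "rel_entropy f < c"
    and \<tau> [measurable]: "\<tau> \<in> borel_measurable unit_lebesgue"
    and i: "integrable unit_lebesgue (\<lambda>u. f u * \<tau> u)" "(\<integral>u. f u * \<tau> u \<partial>unit_lebesgue) < \<eta>"
  obtains g C where "finite_entropy g" "rel_entropy g < c" "integrable unit_lebesgue (\<lambda>u. g u * \<tau> u)"
    "(\<integral>u. g u * \<tau> u \<partial>unit_lebesgue) < \<eta>" "0 < C" "\<And>u. 0 < g u \<Longrightarrow> \<bar>\<tau> u\<bar> \<le> C \<and> \<bar>ln (g u)\<bar> \<le> C"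
proof -
  note D = prob_densityD[OF finite_entropyD(1)[OF f(1)]]
  note [measurable] = D(4)
  define A where "A K = {u\<in>space unit_lebesgue. \<bar>\<tau> u\<bar> \<le> real K \<and> 0 < f u \<and> \<bar>ln (f u)\<bar> \<le> real K}" for K
  have [measurable]: "A K \<in> sets unit_lebesgue" for K unfolding A_def by measurable
  \<comment> \<open>The sets \<open>A K\<close> exhaust only the region where the density is
    positive, hence the condition that \<open>w\<close> vanish outside it.\<close>
  have lim: "(\<lambda>K. \<integral>u. indicator (A K) u * w u \<partial>unit_lebesgue) \<longlonglongrightarrow> integral\<^sup>L unit_lebesgue w"
    if w: "integrable unit_lebesgue w" and w0: "\<And>u. f u = 0 \<Longrightarrow> w u = 0" for w :: "real \<Rightarrow> real"
  proof (rule integral_dominated_convergence[where w = "\<lambda>u. \<bar>w u\<bar>"])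
    show "AE u in unit_lebesgue. (\<lambda>K. indicator (A K) u * w u) \<longlonglongrightarrow> w u"
    proof (rule AE_I2)
      fix u assume u: "u \<in> space unit_lebesgue"
      show "(\<lambda>K. indicator (A K) u * w u) \<longlonglongrightarrow> w u"
      proof (cases "f u = 0")
        case False
        then have "0 < f u" using D(1)[of u] by simp
        obtain N :: nat where N: "max \<bar>\<tau> u\<bar> \<bar>ln (f u)\<bar> < real N" using reals_Archimedean2 by blast
        have "indicator (A K) u * w u = w u" if "N \<le> K" for K
          using N that u \<open>0 < f u\<close> by (simp add: A_def)
        then have "\<forall>\<^sub>F K in sequentially. indicator (A K) u * w u = w u"
          unfolding eventually_sequentially by (intro exI[of _ N]) simp
        then show ?thesis by (rule tendsto_eventually)
      qed (simp add: w0)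
    qed
    show "AE u in unit_lebesgue. norm (indicator (A K) u * w u) \<le> \<bar>w u\<bar>" for K
      by (auto simp: indicator_def)
  qed (use w in auto)
  define Z E m where "Z K = (\<integral>u. indicator (A K) u * f u \<partial>unit_lebesgue)"
    and "E K = (\<integral>u. indicator (A K) u * (f u * ln (f u)) \<partial>unit_lebesgue)"
    and "m K = (\<integral>u. indicator (A K) u * (f u * \<tau> u) \<partial>unit_lebesgue)" for K
  have Z: "Z \<longlonglongrightarrow> 1" unfolding Z_def using lim[OF D(2)] D(3) by simp
  have E: "E \<longlonglongrightarrow> rel_entropy f"
    unfolding E_def rel_entropy_def using lim[OF finite_entropyD(2)[OF f(1)]] by simp
  have m: "m \<longlonglongrightarrow> (\<integral>u. f u * \<tau> u \<partial>unit_lebesgue)" unfolding m_def using lim[OF i(1)] by simp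
  have "(\<lambda>K. E K / Z K - ln (Z K)) \<longlonglongrightarrow> rel_entropy f / 1 - ln 1"
    by (intro tendsto_intros E Z) auto
  then have "\<forall>\<^sub>F K in sequentially. E K / Z K - ln (Z K) < c"
    using f(2) by (intro order_tendstoD) auto
  moreover have "(\<lambda>K. m K / Z K) \<longlonglongrightarrow> (\<integral>u. f u * \<tau> u \<partial>unit_lebesgue) / 1"
    by (intro tendsto_intros m Z) auto
  then have "\<forall>\<^sub>F K in sequentially. m K / Z K < \<eta>"
    using i(2) by (intro order_tendstoD) auto
  moreover have "\<forall>\<^sub>F K in sequentially. 0 < Z K"
    using Z by (intro order_tendstoD) auto
  ultimately have "\<forall>\<^sub>F K in sequentially. E K / Z K - ln (Z K) < c \<and> m K / Z K < \<eta> \<and> 0 < Z K"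
    by eventually_elim auto
  then obtain K where K: "E K / Z K - ln (Z K) < c" "m K / Z K < \<eta>" "0 < Z K"
    by (auto simp: eventually_sequentially)
  define g where "g u = indicator (A K) u * f u / Z K" for u
  have int: "integrable unit_lebesgue (\<lambda>u. indicator (A K) u * w u)" if "integrable unit_lebesgue w" for w :: "real \<Rightarrow> real"
    using integrable_mult_indicator[OF _ that, of "A K"] by simp
  note ints = int[OF D(2)] int[OF finite_entropyD(2)[OF f(1)]] int[OF i(1)]
  have pd: "prob_density g"
    using K(3) D(1) ints(1) by (auto simp: prob_density_def g_def[abs_def] Z_def)
  have e: "g u * ln (g u) = (indicator (A K) u * (f u * ln (f u))) / Z K - ln (Z K) * (indicator (A K) u * f u) / Z K" for u
    using K(3) by (auto simp: g_def A_def indicator_def ln_div field_simps)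
  have fe: "finite_entropy g"
    unfolding finite_entropy_def e using pd ints by simp
  have "rel_entropy g = E K / Z K - ln (Z K) * Z K / Z K"
    unfolding rel_entropy_def e using ints by (simp add: E_def Z_def)
  then have re: "rel_entropy g < c" using K by simp
  have t: "g u * \<tau> u = (indicator (A K) u * (f u * \<tau> u)) / Z K" for u by (simp add: g_def)
  have it: "integrable unit_lebesgue (\<lambda>u. g u * \<tau> u)" "(\<integral>u. g u * \<tau> u \<partial>unit_lebesgue) < \<eta>"
    unfolding t using ints K(2) by (auto simp: m_def)
  have bd: "\<bar>\<tau> u\<bar> \<le> real K + \<bar>ln (Z K)\<bar> + 1 \<and> \<bar>ln (g u)\<bar> \<le> real K + \<bar>ln (Z K)\<bar> + 1" if "0 < g u" for u
  proof -
    have u: "u \<in> A K" using that by (cases "u \<in> A K") (auto simp: g_def)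
    then have "ln (g u) = ln (f u) - ln (Z K)" using K(3) by (auto simp: g_def A_def ln_div)
    then show ?thesis using u unfolding A_def by auto
  qed
  show thesis using that[OF fe re it _ bd] by simp
qed

text \<open>A weak law of large numbers, obtained from Hoeffding's inequality with a geometric
  rate.\<close>

lemma iid_sum_large_deviation:
  fixes s :: "real measure"
  assumes s: "prob_space s" and g [measurable]: "g \<in> borel_measurable s"
    and b: "AE u in s. \<bar>g u\<bar> \<le> C" "0 < C" and mean: "integral\<^sup>L s g < a"
  shows "(\<lambda>k. measure (PiM {..<k} (\<lambda>_. s)) {u\<in>space (PiM {..<k} (\<lambda>_. s)). real k * a \<le> (\<Sum>i<k. g (u i))}) \<longlonglongrightarrow> 0"
proof -
  define m where "m = integral\<^sup>L s g"
  \<comment> \<open>Hoeffding's exponent -2 (k (a - m))^2 / (k (2C)^2) equals k times the exponent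
    in \<open>r\<close>.\<close>
  define r where "r = exp (- ((a - m)\<^sup>2 / (2 * C\<^sup>2)))"
  have "r < 1" using mean b(2) by (simp add: r_def m_def)
  interpret s: prob_space s by fact
  have le: "measure (PiM {..<k} (\<lambda>_. s)) {u\<in>space (PiM {..<k} (\<lambda>_. s)). real k * a \<le> (\<Sum>i<k. g (u i))} \<le> r ^ k"
    if "0 < k" for k
  proof -
    let ?P = "PiM {..<k} (\<lambda>_. s)"
    interpret P: prob_space ?P by (intro prob_space_PiM s)
    have comp: "distr ?P s (\<lambda>u. u i) = s" if "i < k" for i
      using that s by (intro distr_PiM_component) auto
    have [measurable]: "(\<lambda>u. u i) \<in> measurable ?P s" if "i < k" for i
      using that by (intro measurable_component_singleton) auto
    have "P.indep_vars (\<lambda>_. s) (\<lambda>i u. u i) {..<k}"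
    proof (subst P.indep_vars_iff_distr_eq_PiM')
      have "distr ?P ?P (\<lambda>x. \<lambda>i\<in>{..<k}. x i) = distr ?P ?P (\<lambda>x. x)"
        by (intro distr_cong refl) (auto simp: space_PiM PiE_restrict)
      also have "\<dots> = ?P" by simp
      also have "\<dots> = (\<Pi>\<^sub>M i\<in>{..<k}. distr ?P s (\<lambda>u. u i))"
        by (intro PiM_cong) (auto simp: comp)
      finally show "distr ?P ?P (\<lambda>x. \<lambda>i\<in>{..<k}. x i) = (\<Pi>\<^sub>M i\<in>{..<k}. distr ?P s (\<lambda>u. u i))" .
    qed (use that in auto)
    then have ind: "P.indep_vars (\<lambda>_. borel) (\<lambda>i u. g (u i)) {..<k}"
      by (rule P.indep_vars_compose2) auto
    have E: "integral\<^sup>L ?P (\<lambda>u. g (u i)) = m" if "i < k" for i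
      using that unfolding m_def by (subst (2) comp[OF that, symmetric], subst integral_distr) auto
    have AE: "AE u in ?P. g (u i) \<in> {-C..C}" if "i < k" for i
    proof -
      have "AE u in distr ?P s (\<lambda>u. u i). \<bar>g u\<bar> \<le> C" unfolding comp[OF that] by (rule b(1))
      then have "AE u in ?P. \<bar>g (u i)\<bar> \<le> C" using that by (subst (asm) AE_distr_iff) auto
      then show ?thesis by eventually_elim (auto simp: abs_le_iff)
    qed
    interpret H: Hoeffding_ineq ?P "{..<k}" "\<lambda>i u. g (u i)" "\<lambda>_. - C" "\<lambda>_. C" "\<Sum>i<k. integral\<^sup>L ?P (\<lambda>u. g (u i))"
      by unfold_locales (use ind AE in auto)
    have "measure ?P {u\<in>space ?P. (\<Sum>i<k. integral\<^sup>L ?P (\<lambda>u. g (u i))) + real k * (a - m) \<le> (\<Sum>i<k. g (u i))}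
        \<le> exp (- 2 * (real k * (a - m))\<^sup>2 / (\<Sum>i<k. (C - - C)\<^sup>2))"
      using mean b(2) that by (intro H.Hoeffding_ineq_ge) (auto simp: m_def)
    also have "(\<Sum>i<k. integral\<^sup>L ?P (\<lambda>u. g (u i))) + real k * (a - m) = real k * a"
      by (simp add: E right_diff_distrib)
    also have "- 2 * (real k * (a - m))\<^sup>2 / (\<Sum>i<k. (C - - C)\<^sup>2) = real k * - ((a - m)\<^sup>2 / (2 * C\<^sup>2))"
      using that b(2) by (simp add: field_simps power2_eq_square)
    finally show ?thesis by (simp only: r_def exp_of_nat_mult)
  qed
  show ?thesis
  proof (rule tendsto_sandwich[OF _ _ tendsto_const])
    show "(\<lambda>k. r ^ k) \<longlonglongrightarrow> 0" using \<open>r < 1\<close> by (intro LIMSEQ_power_zero) (simp add: r_def)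
    show "\<forall>\<^sub>F k in sequentially. measure (PiM {..<k} (\<lambda>_. s)) {u\<in>space (PiM {..<k} (\<lambda>_. s)). real k * a \<le> (\<Sum>i<k. g (u i))} \<le> r ^ k"
      using le by (intro eventually_mono[OF eventually_gt_at_top[of 0]])
  qed simp
qed

lemma density_PiM_unit:
  assumes f: "prob_density f" and "finite I"
  shows "density (PiM I (\<lambda>_. unit_lebesgue)) (\<lambda>u. \<Prod>i\<in>I. ennreal (f (u i))) = PiM I (\<lambda>_. density unit_lebesgue f)"
proof -
  note [measurable] = prob_densityD(4)[OF f]
  have "prob_space (density unit_lebesgue f)"
    using unit_prob_measures_density[OF f] by (simp add: unit_prob_measures_def)
  then interpret D: product_sigma_finite "\<lambda>_. density unit_lebesgue f"
    by (simp add: product_sigma_finite_def prob_space_imp_sigma_finite)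
  interpret L: product_sigma_finite "\<lambda>_. unit_lebesgue"
    by (simp add: product_sigma_finite_def unit_lebesgue.sigma_finite_measure_axioms)
  show ?thesis
  proof (rule D.PiM_eqI[OF \<open>finite I\<close>])
    show "sets (density (PiM I (\<lambda>_. unit_lebesgue)) (\<lambda>u. \<Prod>i\<in>I. ennreal (f (u i)))) = sets (PiM I (\<lambda>_. density unit_lebesgue f))"
      by (simp cong: sets_PiM_cong)
    fix A assume A: "\<And>i. i \<in> I \<Longrightarrow> A i \<in> sets (density unit_lebesgue f)"
    have "emeasure (density (PiM I (\<lambda>_. unit_lebesgue)) (\<lambda>u. \<Prod>i\<in>I. ennreal (f (u i)))) (Pi\<^sub>E I A)
        = (\<integral>\<^sup>+u. (\<Prod>i\<in>I. ennreal (f (u i))) * indicator (Pi\<^sub>E I A) u \<partial>PiM I (\<lambda>_. unit_lebesgue))"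
      using A \<open>finite I\<close> by (intro emeasure_density) (auto intro!: sets_PiM_I_finite)
    also have "\<dots> = (\<integral>\<^sup>+u. (\<Prod>i\<in>I. ennreal (f (u i)) * indicator (A i) (u i)) \<partial>PiM I (\<lambda>_. unit_lebesgue))"
    proof (rule nn_integral_cong)
      fix u assume u: "u \<in> space (PiM I (\<lambda>_. unit_lebesgue))"
      show "(\<Prod>i\<in>I. ennreal (f (u i))) * indicator (Pi\<^sub>E I A) u = (\<Prod>i\<in>I. ennreal (f (u i)) * indicator (A i) (u i))"
      proof (cases "u \<in> Pi\<^sub>E I A")
        case True
        then have "indicator (A i) (u i) = (1::ennreal)" if "i \<in> I" for i
          using PiE_mem[OF True that] by simp
        then show ?thesis using True by simp
      next
        case False
        then obtain i where "i \<in> I" "u i \<notin> A i" using u by (auto simp: space_PiM PiE_def)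
        then have "(\<Prod>i\<in>I. ennreal (f (u i)) * indicator (A i) (u i)) = 0"
          using \<open>finite I\<close> by (intro prod_zero bexI[of _ i]) auto
        then show ?thesis using False by simp
      qed
    qed
    also have "\<dots> = (\<Prod>i\<in>I. \<integral>\<^sup>+u. ennreal (f u) * indicator (A i) u \<partial>unit_lebesgue)"
      using A by (intro L.product_nn_integral_prod \<open>finite I\<close>) simp
    also have "\<dots> = (\<Prod>i\<in>I. emeasure (density unit_lebesgue f) (A i))"
      using A by (intro prod.cong refl emeasure_density[symmetric]) auto
    finally show "emeasure (density (PiM I (\<lambda>_. unit_lebesgue)) (\<lambda>u. \<Prod>i\<in>I. ennreal (f (u i)))) (Pi\<^sub>E I A)
      = (\<Prod>i\<in>I. emeasure (density unit_lebesgue f) (A i))" .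
  qed
qed

text \<open>The lower bound in Cramer's theorem: under the product of the tilted laws a block has small sum
  with probability close to one, and there the likelihood ratio is at most \<open>exp (h * k)\<close> for any
  \<open>h > rel_entropy f\<close>.\<close>

lemma exists_supercritical_block:
  assumes f: "finite_entropy f" "rel_entropy f < c"
    and \<tau> [measurable]: "\<tau> \<in> borel_measurable unit_lebesgue"
    and i: "integrable unit_lebesgue (\<lambda>u. f u * \<tau> u)" "(\<integral>u. f u * \<tau> u \<partial>unit_lebesgue) < \<eta>"
  obtains k C where "0 < k" "0 < C"
    "1 < exp c ^ k * measure (PiM {..<k} (\<lambda>_. unit_lebesgue))
      {u\<in>space (PiM {..<k} (\<lambda>_. unit_lebesgue)). (\<Sum>i<k. \<tau> (u i)) \<le> real k * \<eta> \<and> (\<forall>i<k. \<tau> (u i) \<le> C)}"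
proof -
  \<comment> \<open>The truncation serves twice: bounded summands for the law of large numbers, and
    the cap \<open>C\<close> on single weights in the conclusion.\<close>
  obtain g C where g: "finite_entropy g" "rel_entropy g < c" "integrable unit_lebesgue (\<lambda>u. g u * \<tau> u)"
    "(\<integral>u. g u * \<tau> u \<partial>unit_lebesgue) < \<eta>" and C: "0 < C" "\<And>u. 0 < g u \<Longrightarrow> \<bar>\<tau> u\<bar> \<le> C \<and> \<bar>ln (g u)\<bar> \<le> C"
    using truncate_density[OF f \<tau> i] by blast
  note D = prob_densityD[OF finite_entropyD(1)[OF g(1)]]
  note [measurable] = D(4)
  \<comment> \<open>The gap between \<open>h\<close> and \<open>c\<close> leaves an exponentially
    growing factor exp (c - h)^k to spare.\<close>
  obtain h where h: "rel_entropy g < h" "h < c" using dense[OF g(2)] by blast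
  define s where "s = density unit_lebesgue g"
  define Q P where "Q k = PiM {..<k} (\<lambda>_. s)" and "P k = PiM {..<k} (\<lambda>_. unit_lebesgue)" for k :: nat
  have s: "prob_space s" using unit_prob_measures_density[OF finite_entropyD(1)[OF g(1)]]
    by (simp add: unit_prob_measures_def s_def)
  have sets_s [measurable_cong]: "sets s = sets unit_lebesgue" by (simp add: s_def)
  have QP: "Q k = density (P k) (\<lambda>u. \<Prod>i<k. ennreal (g (u i)))" for k
    unfolding Q_def P_def s_def using density_PiM_unit[OF finite_entropyD(1)[OF g(1)], of "{..<k}"] by simp
  have space_QP: "space (Q k) = space (P k)" for k by (simp add: QP)
  have AEpos: "AE u in s. 0 < g u" unfolding s_def by (intro AE_density_pos) simp
  have 1: "(\<lambda>k. measure (Q k) {u\<in>space (Q k). real k * \<eta> \<le> (\<Sum>i<k. \<tau> (u i))}) \<longlonglongrightarrow> 0"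
    unfolding Q_def
  proof (rule iid_sum_large_deviation[OF s _ _ C(1)])
    show "AE u in s. \<bar>\<tau> u\<bar> \<le> C" using AEpos by eventually_elim (use C in auto)
    show "integral\<^sup>L s \<tau> < \<eta>" using g(4) by (simp add: s_def integrable_density_unit[OF finite_entropyD(1)[OF g(1)]])
  qed (simp add: s_def)
  have 2: "(\<lambda>k. measure (Q k) {u\<in>space (Q k). real k * h \<le> (\<Sum>i<k. ln (g (u i)))}) \<longlonglongrightarrow> 0"
    unfolding Q_def
  proof (rule iid_sum_large_deviation[OF s _ _ C(1)])
    show "AE u in s. \<bar>ln (g u)\<bar> \<le> C" using AEpos by eventually_elim (use C in auto)
    show "(\<integral>u. ln (g u) \<partial>s) < h"
      using h(1) by (simp add: s_def integrable_density_unit[OF finite_entropyD(1)[OF g(1)]] rel_entropy_def)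
  qed (simp add: s_def)
  have 3: "filterlim (\<lambda>k. exp (c - h) ^ k) at_top sequentially"
    using h filterlim_at_infinity_imp_norm_at_top[OF filterlim_realpow_sequentially_gt1, of "exp (c - h)"]
    by (simp add: norm_power)
  have "\<forall>\<^sub>F k in sequentially. 0 < k \<and> measure (Q k) {u\<in>space (Q k). real k * \<eta> \<le> (\<Sum>i<k. \<tau> (u i))} < 1/4 \<and>
      measure (Q k) {u\<in>space (Q k). real k * h \<le> (\<Sum>i<k. ln (g (u i)))} < 1/4 \<and> 2 < exp (c - h) ^ k"
  proof (intro eventually_conj eventually_gt_at_top)
    show "\<forall>\<^sub>F k in sequentially. 2 < exp (c - h) ^ k"
      using 3 by (simp add: filterlim_at_top_dense)
  qed (rule order_tendstoD[OF 1] order_tendstoD[OF 2], simp)+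
  \<comment> \<open>Two failure probabilities below 1/4 leave tilted mass at least 1/2 for
    \<open>S\<close>; the last inequality makes up for this factor 1/2 at the end.\<close>
  then obtain k where k: "0 < k" "measure (Q k) {u\<in>space (Q k). real k * \<eta> \<le> (\<Sum>i<k. \<tau> (u i))} < 1/4"
      "measure (Q k) {u\<in>space (Q k). real k * h \<le> (\<Sum>i<k. ln (g (u i)))} < 1/4" "2 < exp (c - h) ^ k"
    by (auto simp: eventually_sequentially)
  interpret Q: prob_space "Q k" unfolding Q_def by (intro prob_space_PiM s)
  interpret P: prob_space "P k" unfolding P_def by (intro prob_space_PiM prob_space_unit_lebesgue)
  have [measurable]: "(\<lambda>u. u i) \<in> measurable (P k) unit_lebesgue" "(\<lambda>u. u i) \<in> measurable (Q k) unit_lebesgue" if "i < k" for i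
  proof -
    show *: "(\<lambda>u. u i) \<in> measurable (P k) unit_lebesgue"
      unfolding P_def using that by (intro measurable_component_singleton) simp
    then show "(\<lambda>u. u i) \<in> measurable (Q k) unit_lebesgue" by (simp add: QP)
  qed
  define G where "G = {u\<in>space (P k). (\<Sum>i<k. \<tau> (u i)) \<le> real k * \<eta> \<and> (\<forall>i<k. \<tau> (u i) \<le> C)}"
  define S where "S = {u\<in>space (P k). (\<Sum>i<k. \<tau> (u i)) < real k * \<eta> \<and> (\<Sum>i<k. ln (g (u i))) < real k * h \<and> (\<forall>i<k. 0 < g (u i))}"
  have [measurable]: "S \<in> sets (P k)" "G \<in> sets (P k)" unfolding S_def G_def by measurable
  have SG: "S \<subseteq> G" using C(2) by (fastforce simp: S_def G_def abs_le_iff)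
  define B1 B2 where "B1 = {u\<in>space (Q k). real k * \<eta> \<le> (\<Sum>i<k. \<tau> (u i))}"
    and "B2 = {u\<in>space (Q k). real k * h \<le> (\<Sum>i<k. ln (g (u i)))}"
  have [measurable]: "B1 \<in> sets (Q k)" "B2 \<in> sets (Q k)" unfolding B1_def B2_def by measurable
  have SQ [measurable]: "S \<in> sets (Q k)" using \<open>S \<in> sets (P k)\<close> by (simp add: QP)
  have "AE u in Q k. \<forall>i\<in>{..<k}. 0 < g (u i)"
    unfolding Q_def using AEpos s by (intro eventually_ball_finite ballI AE_PiM_component) auto
  then have "AE u in Q k. u \<in> S \<union> (B1 \<union> B2)"
    using AE_space by eventually_elim (auto simp: S_def B1_def B2_def space_QP)
  then have "1 = measure (Q k) (S \<union> (B1 \<union> B2))"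
    by (subst Q.prob_eq_1[THEN iffD2]) auto
  also have "\<dots> \<le> measure (Q k) S + (measure (Q k) B1 + measure (Q k) B2)"
    by (intro order_trans[OF measure_Un_le] add_left_mono measure_Un_le) auto
  finally have half: "1/2 \<le> measure (Q k) S" using k(2,3) by (simp add: B1_def B2_def)
  have "emeasure (Q k) S = (\<integral>\<^sup>+u. (\<Prod>i<k. ennreal (g (u i))) * indicator S u \<partial>P k)"
    unfolding QP by (intro emeasure_density) measurable
  also have "\<dots> \<le> (\<integral>\<^sup>+u. ennreal (exp h ^ k) * indicator S u \<partial>P k)"
  proof (rule nn_integral_mono)
    fix u
    have "(\<Prod>i<k. ennreal (g (u i))) \<le> ennreal (exp h ^ k)" if "u \<in> S"
    proof -
      have "(\<Prod>i<k. g (u i)) = (\<Prod>i<k. exp (ln (g (u i))))"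
        using that by (intro prod.cong) (auto simp: S_def)
      also have "\<dots> = exp (\<Sum>i<k. ln (g (u i)))" by (simp add: exp_sum)
      also have "\<dots> \<le> exp (real k * h)" using that by (simp add: S_def)
      also have "\<dots> = exp h ^ k" by (rule exp_of_nat_mult)
      finally show ?thesis by (simp add: prod_ennreal D(1) ennreal_leI)
    qed
    then show "(\<Prod>i<k. ennreal (g (u i))) * indicator S u \<le> ennreal (exp h ^ k) * indicator S u"
      by (auto simp: indicator_def)
  qed
  also have "\<dots> = ennreal (exp h ^ k) * emeasure (P k) S"
    by (rule nn_integral_cmult_indicator) measurable
  finally have "measure (Q k) S \<le> exp h ^ k * measure (P k) S"
    by (simp add: Q.emeasure_eq_measure P.emeasure_eq_measure ennreal_mult'[symmetric])
  also have "\<dots> \<le> exp h ^ k * measure (P k) G"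
    using SG by (intro mult_left_mono P.finite_measure_mono) auto
  finally have half': "1/2 \<le> exp h ^ k * measure (P k) G" using half by linarith
  have "1 = 2 * (1/2::real)" by simp
  also have "\<dots> \<le> 2 * (exp h ^ k * measure (P k) G)" using half' by (intro mult_left_mono) auto
  also have "\<dots> < exp (c - h) ^ k * (exp h ^ k * measure (P k) G)"
    using k(4) half' by (intro mult_strict_right_mono) auto
  also have "\<dots> = exp c ^ k * measure (P k) G"
    by (simp add: mult.assoc[symmetric] power_mult_distrib[symmetric] exp_add[symmetric])
  finally show thesis using that[OF k(1) C(1)] by (simp add: G_def P_def)
qed

section \<open>Percolation of good blocks\<close>

text \<open>With N the number of events that occur, 0 <= (1 - tN)^2 gives 2tN - t^2 N^2 <= 1, and
  the left side is 0 when N = 0. Take expectations. The parameter t stays free, which avoids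
  dividing by the second moment.\<close>

lemma (in prob_space) second_moment_union_bound:
  assumes "finite Z" and A: "\<And>z. z \<in> Z \<Longrightarrow> A z \<in> events"
  shows "2 * t * (\<Sum>z\<in>Z. prob (A z)) - t\<^sup>2 * (\<Sum>z\<in>Z. \<Sum>z'\<in>Z. prob (A z \<inter> A z')) \<le> prob (\<Union>z\<in>Z. A z)"
proof -
  define N where "N \<omega> = (\<Sum>z\<in>Z. indicator (A z) \<omega> :: real)" for \<omega>
  have ind [measurable]: "(indicator (A z) :: 'a \<Rightarrow> real) \<in> borel_measurable M" if "z \<in> Z" for z
    using A[OF that] by simp
  have i: "integrable M (indicator (A z) :: 'a \<Rightarrow> real)" if "z \<in> Z" for z
    using A[OF that] by (simp add: less_top[symmetric])
  have ii: "integrable M (indicator (A z \<inter> A z') :: 'a \<Rightarrow> real)" if "z \<in> Z" "z' \<in> Z" for z z'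
    using A that by (simp add: less_top[symmetric] sets.Int)
  have N2: "(N \<omega>)\<^sup>2 = (\<Sum>z\<in>Z. \<Sum>z'\<in>Z. indicator (A z \<inter> A z') \<omega>)" for \<omega>
    by (simp add: N_def power2_eq_square sum_product indicator_inter_arith)
  have iN: "integrable M N" "integrable M (\<lambda>\<omega>. (N \<omega>)\<^sup>2)"
    unfolding N_def[abs_def] N2[unfolded N_def] using i ii by (auto intro!: Bochner_Integration.integrable_sum)
  have U: "(\<Union>z\<in>Z. A z) \<in> events" using assms by auto
  have m: "A z \<inter> space M = A z" if "z \<in> Z" for z using sets.sets_into_space[OF A[OF that]] by auto
  have EN: "expectation N = (\<Sum>z\<in>Z. prob (A z))"
    unfolding N_def[abs_def] using i by (simp add: m Bochner_Integration.integral_sum)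
  have EN2: "expectation (\<lambda>\<omega>. (N \<omega>)\<^sup>2) = (\<Sum>z\<in>Z. \<Sum>z'\<in>Z. prob (A z \<inter> A z'))"
    unfolding N2 using ii m
    by (subst Bochner_Integration.integral_sum, force intro!: Bochner_Integration.integrable_sum,
        intro sum.cong refl, subst Bochner_Integration.integral_sum) (auto intro!: sum.cong simp: Int_assoc)
  have "2 * t * N \<omega> - t\<^sup>2 * (N \<omega>)\<^sup>2 \<le> indicator (\<Union>z\<in>Z. A z) \<omega>" for \<omega>
  proof (cases "\<omega> \<in> (\<Union>z\<in>Z. A z)")
    case True
    have "0 \<le> (1 - t * N \<omega>)\<^sup>2" by simp
    then show ?thesis using True by (simp add: power2_eq_square algebra_simps)
  next
    case False
    then have "N \<omega> = 0" unfolding N_def by (intro sum.neutral) auto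
    then show ?thesis using False by simp
  qed
  then have "expectation (\<lambda>\<omega>. 2 * t * N \<omega> - t\<^sup>2 * (N \<omega>)\<^sup>2) \<le> expectation (indicator (\<Union>z\<in>Z. A z))"
    using iN U by (intro integral_mono) (auto simp: less_top[symmetric])
  moreover have "(\<Union>z\<in>Z. A z) \<inter> space M = (\<Union>z\<in>Z. A z)" using m by auto
  ultimately show ?thesis using iN by (simp add: EN EN2 del: UN_simps)
qed

text \<open>Coordinates of a product measure are independent, hence so are its restrictions to
  disjoint index sets. The independence of a block from the subtree behind it, and of two subtrees,
  is drawn from here.\<close>

lemma prob_PiM_disjoint_coordinates:
  assumes "I \<noteq> {}" and M: "\<And>i. i \<in> I \<Longrightarrow> prob_space (M i)" and J: "J \<inter> K = {}" "J \<subseteq> I" "K \<subseteq> I"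
    and Q [measurable]: "Measurable.pred (PiM J M) Q" and R [measurable]: "Measurable.pred (PiM K M) R"
  defines "P \<equiv> PiM I M"
  shows "measure P {u\<in>space P. Q (restrict u J) \<and> R (restrict u K)}
    = measure P {u\<in>space P. Q (restrict u J)} * measure P {u\<in>space P. R (restrict u K)}"
proof -
  interpret prob_space P unfolding P_def using M by (intro prob_space_PiM)
  have "indep_vars M (\<lambda>i u. u i) I"
  proof (subst indep_vars_iff_distr_eq_PiM'[OF \<open>I \<noteq> {}\<close>])
    have "distr P (PiM I M) (\<lambda>x. \<lambda>i\<in>I. x i) = distr P (PiM I M) (\<lambda>x. x)"
      by (intro distr_cong refl) (auto simp: P_def space_PiM PiE_restrict)
    also have "\<dots> = PiM I M" by (simp add: P_def)
    also have "\<dots> = (\<Pi>\<^sub>M i\<in>I. distr P (M i) (\<lambda>u. u i))"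
      unfolding P_def by (intro PiM_cong refl distr_PiM_component[symmetric]) (auto intro: M)
    finally show "distr P (PiM I M) (\<lambda>x. \<lambda>i\<in>I. x i) = (\<Pi>\<^sub>M i\<in>I. distr P (M i) (\<lambda>u. u i))" .
  qed (auto simp: P_def)
  from indep_varD[OF indep_var_restrict[OF this J], of "{v\<in>space (PiM J M). Q v}" "{v\<in>space (PiM K M). R v}"]
  have "prob ((\<lambda>x. (\<lambda>i\<in>J. x i, \<lambda>i\<in>K. x i)) -` ({v\<in>space (PiM J M). Q v} \<times> {v\<in>space (PiM K M). R v}) \<inter> space P)
    = prob ((\<lambda>x. \<lambda>i\<in>J. x i) -` {v\<in>space (PiM J M). Q v} \<inter> space P) * prob ((\<lambda>x. \<lambda>i\<in>K. x i) -` {v\<in>space (PiM K M). R v} \<inter> space P)"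
    by simp
  moreover have "restrict u L \<in> space (PiM L M)" if "u \<in> space P" "L \<subseteq> I" for u L
    using that by (auto simp: P_def space_PiM)
  then have "(\<lambda>x. (\<lambda>i\<in>J. x i, \<lambda>i\<in>K. x i)) -` ({v\<in>space (PiM J M). Q v} \<times> {v\<in>space (PiM K M). R v}) \<inter> space P
      = {u\<in>space P. Q (restrict u J) \<and> R (restrict u K)}"
    "(\<lambda>x. \<lambda>i\<in>J. x i) -` {v\<in>space (PiM J M). Q v} \<inter> space P = {u\<in>space P. Q (restrict u J)}"
    "(\<lambda>x. \<lambda>i\<in>K. x i) -` {v\<in>space (PiM K M). R v} \<inter> space P = {u\<in>space P. R (restrict u K)}"
    using J by auto
  ultimately show ?thesis by simp
qed

text \<open>The root carries no weight, so configurations live on the set \<open>V\<close> of the other nodes.\<close>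

locale block_percolation =
  fixes d :: nat and \<tau> :: "real \<Rightarrow> real" and k :: nat and \<eta> C :: real
  assumes arity: "d \<ge> 2" and measurable_weight [measurable]: "\<tau> \<in> borel_measurable unit_lebesgue"
    and k: "0 < k" and C: "0 < C"
    and supercritical: "1 < real d ^ k * measure (PiM {..<k} (\<lambda>_. unit_lebesgue))
      {u\<in>space (PiM {..<k} (\<lambda>_. unit_lebesgue)). (\<Sum>i<k. \<tau> (u i)) \<le> real k * \<eta> \<and> (\<forall>i<k. \<tau> (u i) \<le> C)}"
begin

definition V :: "nat list set" where "V = nodes d - {[]}"

definition P :: "(nat list \<Rightarrow> real) measure" where "P = PiM V (\<lambda>_. unit_lebesgue)"

text \<open>The configuration seen from \<open>z\<close>, with \<open>z\<close> as the new root.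
  Restricting it to \<open>V\<close> makes it a point of the same product space.\<close>

definition shift :: "nat list \<Rightarrow> (nat list \<Rightarrow> real) \<Rightarrow> nat list \<Rightarrow> real" where
  "shift z u = (\<lambda>y\<in>V. u (z @ y))"

text \<open>Meant for \<open>z\<close> at level k: the sum condition controls the ends of blocks,
  the cap controls the levels in between.\<close>

definition good :: "nat list \<Rightarrow> (nat list \<Rightarrow> real) \<Rightarrow> bool" where
  "good z u \<longleftrightarrow> (\<Sum>y\<in>nonroot_ancestors z. \<tau> (u y)) \<le> real k * \<eta> \<and> (\<forall>y\<in>nonroot_ancestors z. \<tau> (u y) \<le> C)"

text \<open>Survival up to generation \<open>j\<close> of the branching process whose individuals
  are block ends and whose offspring are reached by good blocks.\<close>

primrec survives :: "nat \<Rightarrow> (nat list \<Rightarrow> real) \<Rightarrow> bool" where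
  "survives 0 u = True"
| "survives (Suc j) u = (\<exists>z\<in>level d k. good z u \<and> survives j (shift z u))"

text \<open>The unspecified constant makes the event insensitive to a finite initial segment, as the
  zero-one argument requires; taking it in nat makes the union countable and the event measurable.
  The node may change with \<open>n\<close>, so no infinite path has to be constructed.\<close>

definition linear_path :: "(nat list \<Rightarrow> real) \<Rightarrow> bool" where
  "linear_path u \<longleftrightarrow> (\<exists>c::nat. \<forall>n. \<exists>x\<in>level d n. (\<Sum>y\<in>nonroot_ancestors x. \<tau> (u y)) \<le> \<eta> * real n + real c)"

sublocale P: prob_space P
  unfolding P_def by (intro prob_space_PiM prob_space_unit_lebesgue)

lemma V_nonempty: "V \<noteq> {}"
proof -
  have "[0] \<in> V" using arity by (simp add: V_def nodes_def)
  then show ?thesis by blast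
qed

lemma nonroot_ancestors_subset_V: "x \<in> nodes d \<Longrightarrow> nonroot_ancestors x \<subseteq> V"
  using nonroot_ancestors_subset_nodes[of x d] by (auto simp: V_def nonroot_ancestors_def)

lemma append_in_V: "z \<in> nodes d \<Longrightarrow> y \<in> V \<Longrightarrow> z @ y \<in> V"
  by (auto simp: V_def nodes_append)

text \<open>Stated for any index set \<open>J\<close> containing the subtree, because independence
  is applied to functions of the subtree's coordinates alone.\<close>

lemma measurable_shift_gen:
  assumes "\<And>y. y \<in> V \<Longrightarrow> z @ y \<in> J"
  shows "shift z \<in> measurable (PiM J (\<lambda>_. unit_lebesgue)) P"
  unfolding shift_def P_def using assms by (intro measurable_restrict measurable_component_singleton)

lemma measurable_shift: "z \<in> nodes d \<Longrightarrow> shift z \<in> measurable P P"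
  using measurable_shift_gen[of z V] append_in_V by (simp add: P_def)

lemma distr_shift:
  assumes "z \<in> nodes d"
  shows "distr P P (shift z) = P"
proof -
  have "distr (PiM V (\<lambda>_. unit_lebesgue)) (PiM V (\<lambda>_. unit_lebesgue)) (\<lambda>u. \<lambda>y\<in>V. u (z @ y)) = PiM V (\<lambda>_. unit_lebesgue)"
    using append_in_V[OF assms]
    by (intro distr_PiM_reindex[where f = "(@) z" and M = "\<lambda>_. unit_lebesgue"])
       (auto simp: inj_on_def prob_space_unit_lebesgue)
  then show ?thesis by (simp add: P_def shift_def[abs_def])
qed

lemma measurable_good_gen:
  assumes "nonroot_ancestors z \<subseteq> J"
  shows "Measurable.pred (PiM J (\<lambda>_. unit_lebesgue)) (good z)"
proof -
  have [measurable]: "(\<lambda>u. u y) \<in> measurable (PiM J (\<lambda>_. unit_lebesgue)) unit_lebesgue" if "y \<in> nonroot_ancestors z" for y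
    using that assms by (intro measurable_component_singleton) auto
  show ?thesis unfolding good_def[abs_def] by measurable
qed

lemma measurable_survives: "Measurable.pred P (survives j)"
proof (induction j)
  case (Suc j)
  have [measurable]: "Measurable.pred P (good z)" if "z \<in> level d k" for z
    unfolding P_def using that nonroot_ancestors_subset_V by (intro measurable_good_gen) auto
  have [measurable]: "Measurable.pred P (\<lambda>u. survives j (shift z u))" if "z \<in> level d k" for z
    using that by (intro measurable_compose[OF measurable_shift Suc]) auto
  show ?case unfolding survives.simps using finite_level by measurable
qed simp

lemma prob_shift:
  assumes "z \<in> nodes d" and [measurable]: "Measurable.pred P Q"
  shows "P.prob {u\<in>space P. Q (shift z u)} = P.prob {u\<in>space P. Q u}"
proof -
  have "P.prob {u\<in>space P. Q u} = measure (distr P P (shift z)) {u\<in>space P. Q u}"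
    using distr_shift[OF assms(1)] by simp
  also have "\<dots> = P.prob (shift z -` {u\<in>space P. Q u} \<inter> space P)"
    using measurable_shift[OF assms(1)] by (intro measure_distr) auto
  also have "shift z -` {u\<in>space P. Q u} \<inter> space P = {u\<in>space P. Q (shift z u)}"
    using measurable_space[OF measurable_shift[OF assms(1)]] by auto
  finally show ?thesis by simp
qed

lemma prob_good:
  assumes z: "z \<in> level d k"
  shows "P.prob {u\<in>space P. good z u} = measure (PiM {..<k} (\<lambda>_. unit_lebesgue))
      {u\<in>space (PiM {..<k} (\<lambda>_. unit_lebesgue)). (\<Sum>i<k. \<tau> (u i)) \<le> real k * \<eta> \<and> (\<forall>i<k. \<tau> (u i) \<le> C)}"
    (is "_ = measure ?K {u\<in>space ?K. ?G u}")
proof -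
  define f where "f u = (\<lambda>i\<in>{..<k}. u (take (Suc i) z))" for u :: "nat list \<Rightarrow> real"
  have len: "length z = k" "z \<in> nodes d" using z by auto
  have tV: "take (Suc i) z \<in> V" if "i < k" for i
    using that len by (auto simp: V_def nodes_take)
  have fm: "f \<in> measurable P ?K"
    unfolding f_def P_def using tV by (intro measurable_restrict measurable_component_singleton) auto
  have eq: "good z u \<longleftrightarrow> ?G (f u)" for u
    unfolding good_def sum_nonroot_ancestors len f_def by (auto simp: nonroot_ancestors_eq_image len)
  have "distr (PiM V (\<lambda>_. unit_lebesgue)) (PiM {..<k} (\<lambda>_. unit_lebesgue)) (\<lambda>u. \<lambda>i\<in>{..<k}. u (take (Suc i) z)) = ?K"
    using inj_on_take_Suc[of z] tV len
    by (intro distr_PiM_reindex[where f = "\<lambda>i. take (Suc i) z" and M = "\<lambda>_. unit_lebesgue"])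
       (auto simp: prob_space_unit_lebesgue)
  then have "distr P ?K f = ?K" by (simp add: P_def f_def[abs_def])
  then have "measure ?K {u\<in>space ?K. ?G u} = measure (distr P ?K f) {u\<in>space ?K. ?G u}" by simp
  also have "\<dots> = P.prob (f -` {u\<in>space ?K. ?G u} \<inter> space P)"
    using fm
  proof (rule measure_distr)
    have [measurable]: "(\<lambda>u. u i) \<in> measurable ?K unit_lebesgue" if "i < k" for i
      using that by (intro measurable_component_singleton) auto
    show "{u\<in>space ?K. ?G u} \<in> sets ?K" by measurable
  qed
  also have "f -` {u\<in>space ?K. ?G u} \<inter> space P = {u\<in>space P. good z u}"
    using measurable_space[OF fm] eq by auto
  finally show ?thesis by simp
qed

lemma good_restrict: "nonroot_ancestors z \<subseteq> J \<Longrightarrow> good z (restrict u J) = good z u"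
  by (auto simp: good_def subset_iff intro!: arg_cong2[where f = "(\<le>)"] sum.cong)

lemma shift_restrict: "(@) z ` V \<subseteq> J \<Longrightarrow> shift z (restrict u J) = shift z u"
  by (auto simp: shift_def fun_eq_iff)

text \<open>The block ending at \<open>z\<close> uses ancestors of \<open>z\<close>, the shifted
  configuration only strict descendants.\<close>

lemma prob_good_shift:
  assumes z: "z \<in> nodes d" and Q [measurable]: "Measurable.pred P Q"
  shows "P.prob {u\<in>space P. good z u \<and> Q (shift z u)} = P.prob {u\<in>space P. good z u} * P.prob {u\<in>space P. Q u}"
proof -
  let ?J = "nonroot_ancestors z" and ?K = "(@) z ` V"
  have disj: "?J \<inter> ?K = {}"
    by (auto simp: nonroot_ancestors_def V_def dest: prefix_length_le)
  have sub: "?J \<subseteq> V" "?K \<subseteq> V" using nonroot_ancestors_subset_V[OF z] append_in_V[OF z] by auto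
  have "Measurable.pred (PiM ?K (\<lambda>_. unit_lebesgue)) (\<lambda>u. Q (shift z u))"
    by (rule measurable_compose[OF measurable_shift_gen Q]) auto
  from prob_PiM_disjoint_coordinates[OF V_nonempty _ disj sub measurable_good_gen[OF subset_refl] this]
  show ?thesis
    by (simp add: prob_space_unit_lebesgue good_restrict shift_restrict prob_shift[OF z Q] flip: P_def)
qed

text \<open>Distinct nodes of equal length have disjoint subtrees; with unequal lengths one subtree
  could contain the other.\<close>

lemma prob_shift_shift:
  assumes z: "z \<in> nodes d" "z' \<in> nodes d" "length z = length z'" "z \<noteq> z'" and Q [measurable]: "Measurable.pred P Q"
  shows "P.prob {u\<in>space P. Q (shift z u) \<and> Q (shift z' u)} = (P.prob {u\<in>space P. Q u})\<^sup>2"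
proof -
  let ?J = "(@) z ` V" and ?K = "(@) z' ` V"
  have disj: "?J \<inter> ?K = {}" using z(3,4) by auto
  have sub: "?J \<subseteq> V" "?K \<subseteq> V" using append_in_V z by auto
  have Qz: "Measurable.pred (PiM ((@) z ` V) (\<lambda>_. unit_lebesgue)) (\<lambda>u. Q (shift z u))" for z
    by (rule measurable_compose[OF measurable_shift_gen Q]) auto
  from prob_PiM_disjoint_coordinates[OF V_nonempty _ disj sub Qz Qz]
  show ?thesis
    by (simp add: prob_space_unit_lebesgue shift_restrict prob_shift[OF z(1) Q] prob_shift[OF z(2) Q]
        power2_eq_square flip: P_def)
qed

text \<open>The mean offspring number of the block branching process.\<close>

definition block_mean :: real where
  "block_mean = real d ^ k * measure (PiM {..<k} (\<lambda>_. unit_lebesgue))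
      {u\<in>space (PiM {..<k} (\<lambda>_. unit_lebesgue)). (\<Sum>i<k. \<tau> (u i)) \<le> real k * \<eta> \<and> (\<forall>i<k. \<tau> (u i) \<le> C)}"

text \<open>A value p that the recursion preserves. With m the mean offspring and D = d^k, the
  second moment bound gives at least m p - D^2 p^2, which is at least p as soon as D^2 p <= m - 1.
  The cap 1 is for generation 0.\<close>

definition survival_bound :: real where
  "survival_bound = min 1 ((block_mean - 1) / (real d ^ k)\<^sup>2)"

lemma survival_bound: "0 < survival_bound" "survival_bound \<le> 1" "(real d ^ k)\<^sup>2 * survival_bound \<le> block_mean - 1"
proof -
  have D: "0 < (real d ^ k)\<^sup>2" using arity by simp
  show "0 < survival_bound"
    using supercritical D by (simp add: survival_bound_def block_mean_def)
  show "survival_bound \<le> 1" by (simp add: survival_bound_def)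
  have "survival_bound \<le> (block_mean - 1) / (real d ^ k)\<^sup>2" by (simp add: survival_bound_def)
  then show "(real d ^ k)\<^sup>2 * survival_bound \<le> block_mean - 1"
    using D by (simp add: pos_le_divide_eq mult.commute)
qed

text \<open>Induction on generations. With s the survival probability so far, the first moment is m
  s and the second at most m s + D^2 s^2, and the second moment bound for the union over level k
  closes the induction.\<close>

lemma prob_survives: "survival_bound \<le> P.prob {u\<in>space P. survives j u}"
proof (induction j)
  case 0
  then show ?case using survival_bound P.prob_space by simp
next
  case (Suc j)
  define s where "s = P.prob {u\<in>space P. survives j u}"
  define A where "A z = {u\<in>space P. good z u \<and> survives j (shift z u)}" for z
  define D where "D = real d ^ k"
  have D: "real (card (level d k)) = D" by (simp add: D_def card_level)
  have [measurable]: "Measurable.pred P (survives j)" by (rule measurable_survives)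
  have Am: "A z \<in> P.events" if "z \<in> level d k" for z
  proof -
    have [measurable]: "Measurable.pred P (good z)"
      unfolding P_def using that nonroot_ancestors_subset_V by (intro measurable_good_gen) auto
    have [measurable]: "shift z \<in> measurable P P" using that by (intro measurable_shift) auto
    show ?thesis unfolding A_def by measurable
  qed
  have s: "0 < s" "survival_bound \<le> s" using Suc survival_bound(1) by (auto simp: s_def)
  have A1: "P.prob (A z) = block_mean / D * s" if "z \<in> level d k" for z
    using that prob_good_shift[of z "survives j"] arity
    by (simp add: A_def s_def prob_good measurable_survives block_mean_def D_def)
  have sumA: "(\<Sum>z\<in>level d k. P.prob (A z)) = block_mean * s"
    using A1 arity by (simp add: D) (simp add: D_def)
  \<comment> \<open>Two paths to level k may share edges, so their good events are dependent.
    Dropping these events leaves two disjoint subtrees, which are independent.\<close>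
  have A2: "P.prob (A z \<inter> A z') \<le> (if z = z' then P.prob (A z) else 0) + s\<^sup>2" if "z \<in> level d k" "z' \<in> level d k" for z z'
  proof (cases "z = z'")
    case False
    have "P.prob (A z \<inter> A z') \<le> P.prob {u\<in>space P. survives j (shift z u) \<and> survives j (shift z' u)}"
    proof (rule P.finite_measure_mono)
      have [measurable]: "shift z \<in> measurable P P" "shift z' \<in> measurable P P"
        using that by (auto intro: measurable_shift)
      show "{u\<in>space P. survives j (shift z u) \<and> survives j (shift z' u)} \<in> P.events" by measurable
    qed (auto simp: A_def)
    also have "\<dots> = s\<^sup>2" using that False by (subst prob_shift_shift) (auto simp: s_def measurable_survives)
    finally show ?thesis using False by simp
  qed simp
  have "(\<Sum>z\<in>level d k. \<Sum>z'\<in>level d k. P.prob (A z \<inter> A z'))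
      \<le> (\<Sum>z\<in>level d k. \<Sum>z'\<in>level d k. (if z = z' then P.prob (A z) else 0) + s\<^sup>2)"
    by (intro sum_mono A2)
  also have "\<dots> = block_mean * s + D\<^sup>2 * s\<^sup>2"
    using finite_level[of d k] sumA by (simp add: sum.distrib D power2_eq_square)
  finally have sumAA: "(\<Sum>z\<in>level d k. \<Sum>z'\<in>level d k. P.prob (A z \<inter> A z')) \<le> block_mean * s + D\<^sup>2 * s\<^sup>2" .
  \<comment> \<open>With this choice t s is \<open>survival_bound\<close>, so the estimate no longer
    depends on s except through t <= 1.\<close>
  define t where "t = survival_bound / s"
  have t: "0 < t" "t \<le> 1" "t * s = survival_bound" using s survival_bound(1) by (auto simp: t_def)
  have m: "1 < block_mean" using supercritical by (simp add: block_mean_def)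
  have "survival_bound \<le> block_mean * survival_bound - (D\<^sup>2 * survival_bound) * survival_bound"
    using survival_bound(3) mult_right_mono[OF survival_bound(3), of survival_bound] survival_bound(1)
    by (simp add: D_def algebra_simps)
  also have "\<dots> \<le> 2 * (block_mean * survival_bound) - (t * (block_mean * survival_bound) + D\<^sup>2 * survival_bound * survival_bound)"
    using t(2) mult_right_mono[of t 1 "block_mean * survival_bound"] m survival_bound(1) by simp
  also have "\<dots> = 2 * t * (block_mean * s) - t\<^sup>2 * (block_mean * s + D\<^sup>2 * s\<^sup>2)"
    unfolding t(3)[symmetric] by (simp add: algebra_simps power2_eq_square)
  also have "\<dots> \<le> 2 * t * (\<Sum>z\<in>level d k. P.prob (A z)) - t\<^sup>2 * (\<Sum>z\<in>level d k. \<Sum>z'\<in>level d k. P.prob (A z \<inter> A z'))"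
    using mult_left_mono[OF sumAA, of "t\<^sup>2"] by (simp add: sumA)
  also have "\<dots> \<le> P.prob (\<Union>z\<in>level d k. A z)"
    by (rule P.second_moment_union_bound[OF finite_level Am])
  also have "(\<Union>z\<in>level d k. A z) = {u\<in>space P. survives (Suc j) u}" by (auto simp: A_def)
  finally show ?case .
qed

lemma survives_mono: "survives (Suc j) u \<Longrightarrow> survives j u"
proof (induction j arbitrary: u)
  case (Suc j)
  then obtain z where z: "z \<in> level d k" "good z u" "survives (Suc j) (shift z u)"
    unfolding survives.simps(2)[of "Suc j"] by blast
  from z(1,2) Suc.IH[OF z(3)] show ?case unfolding survives.simps(2)[of j] by blast
qed simp

lemma sum_nonroot_ancestors_shift:
  assumes "x \<in> nodes d"
  shows "(\<Sum>y\<in>nonroot_ancestors (z @ x). \<tau> (u y))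
    = (\<Sum>y\<in>nonroot_ancestors z. \<tau> (u y)) + (\<Sum>y\<in>nonroot_ancestors x. \<tau> (shift z u y))"
  unfolding sum_nonroot_ancestors_append using nonroot_ancestors_subset_V[OF assms]
  by (auto simp: shift_def intro!: sum.cong)

text \<open>Whole blocks cost at most eta per level. The additive constant pays for one incomplete
  block: a segment of n <= k levels costs at most n C, which is at most eta n + k (C +
  |eta|).\<close>

lemma survives_imp_path:
  assumes "survives j u" "n \<le> j * k"
  shows "\<exists>x\<in>level d n. (\<Sum>y\<in>nonroot_ancestors x. \<tau> (u y)) \<le> \<eta> * real n + real k * (C + \<bar>\<eta>\<bar>)"
  using assms
proof (induction j arbitrary: n u)
  case 0
  then show ?case using C by (auto simp: nodes_def nonroot_ancestors_def)
next
  case (Suc j)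
  then obtain z where z: "z \<in> level d k" "good z u" "survives j (shift z u)" by auto
  show ?case
  proof (cases "n \<le> k")
    case True
    have "(\<Sum>y\<in>nonroot_ancestors (take n z). \<tau> (u y)) \<le> (\<Sum>y\<in>nonroot_ancestors (take n z). C)"
      using z(2) by (intro sum_mono) (auto simp: good_def nonroot_ancestors_def intro: prefix_order.trans take_is_prefix)
    also have "\<dots> = real n * C" using z(1) True by (simp add: card_nonroot_ancestors)
    also have "\<dots> \<le> \<eta> * real n + real n * (C + \<bar>\<eta>\<bar>)"
    proof -
      have "0 \<le> real n * (\<eta> + \<bar>\<eta>\<bar>)" by (intro mult_nonneg_nonneg) auto
      then show ?thesis by (simp add: algebra_simps)
    qed
    also have "\<dots> \<le> \<eta> * real n + real k * (C + \<bar>\<eta>\<bar>)"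
      using True C by (intro add_left_mono mult_right_mono) auto
    finally show ?thesis using z(1) True by (intro bexI[of _ "take n z"]) (auto simp: nodes_take)
  next
    case False
    then have "n - k \<le> j * k" using Suc.prems by simp
    then obtain x where x: "x \<in> level d (n - k)"
      "(\<Sum>y\<in>nonroot_ancestors x. \<tau> (shift z u y)) \<le> \<eta> * real (n - k) + real k * (C + \<bar>\<eta>\<bar>)"
      using Suc.IH[OF z(3)] by blast
    have "(\<Sum>y\<in>nonroot_ancestors (z @ x). \<tau> (u y)) \<le> real k * \<eta> + (\<eta> * real (n - k) + real k * (C + \<bar>\<eta>\<bar>))"
      using x z(2) by (simp add: sum_nonroot_ancestors_shift good_def add_mono)
    also have "\<dots> = \<eta> * real n + real k * (C + \<bar>\<eta>\<bar>)"
      using False by (simp add: of_nat_diff algebra_simps)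
    finally show ?thesis
      using x(1) z(1) False by (intro bexI[of _ "z @ x"]) (auto simp: nodes_append)
  qed
qed

lemma measurable_linear_path: "Measurable.pred P linear_path"
proof -
  have [measurable]: "(\<lambda>u. u y) \<in> measurable P unit_lebesgue" if "y \<in> nonroot_ancestors x" "x \<in> level d n" for y x n
    unfolding P_def using that nonroot_ancestors_subset_V[of x] by (intro measurable_component_singleton) auto
  have [measurable]: "Measurable.pred P (\<lambda>u. \<exists>x\<in>level d n. (\<Sum>y\<in>nonroot_ancestors x. \<tau> (u y)) \<le> \<eta> * real n + real c)" for n c
    by (rule pred_intros_finite(4)[OF finite_level]) measurable
  show ?thesis unfolding linear_path_def[abs_def] by measurable
qed

text \<open>Prepending the fixed path to \<open>z\<close> changes sums by a finite amount, absorbed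
  in the constant. Levels not beyond \<open>z\<close> are served by the prefixes of \<open>z\<close>
  themselves.\<close>

lemma linear_path_shift:
  assumes z: "z \<in> nodes d" and u: "linear_path (shift z u)"
  shows "linear_path u"
proof -
  obtain c :: nat where c: "\<And>n. \<exists>x\<in>level d n. (\<Sum>y\<in>nonroot_ancestors x. \<tau> (shift z u y)) \<le> \<eta> * real n + real c"
    using u unfolding linear_path_def by blast
  \<comment> \<open>Dominates every prefix sum up to \<open>z\<close> and the correction from eta,
    so one constant serves all levels.\<close>
  define a where "a = (\<Sum>n\<le>length z. \<bar>\<Sum>y\<in>nonroot_ancestors (take n z). \<tau> (u y)\<bar>) + real (length z) * \<bar>\<eta>\<bar> + real c"
  obtain c' :: nat where c': "a \<le> real c'" using real_arch_simple by blast
  have "\<exists>x\<in>level d n. (\<Sum>y\<in>nonroot_ancestors x. \<tau> (u y)) \<le> \<eta> * real n + real c'" for n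
  proof (cases "n \<le> length z")
    case True
    have "\<bar>\<Sum>y\<in>nonroot_ancestors (take n z). \<tau> (u y)\<bar> \<le> (\<Sum>n\<le>length z. \<bar>\<Sum>y\<in>nonroot_ancestors (take n z). \<tau> (u y)\<bar>)"
      using True by (intro member_le_sum) auto
    moreover have "- (\<eta> * real n) \<le> real (length z) * \<bar>\<eta>\<bar>"
    proof -
      have "- \<eta> * real n \<le> \<bar>\<eta>\<bar> * real n" by (intro mult_right_mono) auto
      also have "\<dots> \<le> \<bar>\<eta>\<bar> * real (length z)" using True by (intro mult_left_mono) auto
      finally show ?thesis by (simp add: mult.commute)
    qed
    ultimately have "(\<Sum>y\<in>nonroot_ancestors (take n z). \<tau> (u y)) \<le> \<eta> * real n + real c'"
      using c' unfolding a_def by linarith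
    then show ?thesis using z True by (intro bexI[of _ "take n z"]) (auto simp: nodes_take)
  next
    case False
    obtain x where x: "x \<in> level d (n - length z)"
      "(\<Sum>y\<in>nonroot_ancestors x. \<tau> (shift z u y)) \<le> \<eta> * real (n - length z) + real c"
      using c by blast
    have "\<bar>\<Sum>y\<in>nonroot_ancestors (take (length z) z). \<tau> (u y)\<bar> \<le> (\<Sum>n\<le>length z. \<bar>\<Sum>y\<in>nonroot_ancestors (take n z). \<tau> (u y)\<bar>)"
      by (rule member_le_sum[where f = "\<lambda>n. \<bar>\<Sum>y\<in>nonroot_ancestors (take n z). \<tau> (u y)\<bar>"]) auto
    moreover have "- (\<eta> * real (length z)) \<le> real (length z) * \<bar>\<eta>\<bar>"
      using mult_right_mono[of "- \<eta>" "\<bar>\<eta>\<bar>" "real (length z)"] by (simp add: mult.commute)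
    moreover have "\<eta> * real (n - length z) = \<eta> * real n - \<eta> * real (length z)"
      using False by (simp add: of_nat_diff right_diff_distrib)
    moreover have "(\<Sum>y\<in>nonroot_ancestors (z @ x). \<tau> (u y))
        = (\<Sum>y\<in>nonroot_ancestors z. \<tau> (u y)) + (\<Sum>y\<in>nonroot_ancestors x. \<tau> (shift z u y))"
      using x by (intro sum_nonroot_ancestors_shift) auto
    ultimately have "(\<Sum>y\<in>nonroot_ancestors (z @ x). \<tau> (u y)) \<le> \<eta> * real n + real c'"
      using c' x(2) unfolding a_def take_all[OF order_refl] by linarith
    then show ?thesis using z x(1) False by (intro bexI[of _ "z @ x"]) (auto simp: nodes_append)
  qed
  then show ?thesis unfolding linear_path_def by blast
qed

text \<open>The failure probability \<open>p\<close> satisfies \<open>p \<le> p\<^sup>2\<close> because failure at the root forces failure in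
  two independent copies of the tree; as \<open>p < 1\<close>, it vanishes.\<close>

lemma AE_linear_path: "AE u in P. linear_path u"
proof -
  have [measurable]: "Measurable.pred P (survives j)" for j by (rule measurable_survives)
  have [measurable]: "Measurable.pred P linear_path" by (rule measurable_linear_path)
  have "(\<lambda>j. P.prob {u\<in>space P. survives j u}) \<longlonglongrightarrow> P.prob (\<Inter>j. {u\<in>space P. survives j u})"
    by (intro P.finite_Lim_measure_decseq) (auto simp: decseq_Suc_iff dest: survives_mono simp del: survives.simps)
  then have "survival_bound \<le> P.prob (\<Inter>j. {u\<in>space P. survives j u})"
    by (rule LIMSEQ_le_const) (use prob_survives in auto)
  also have "\<dots> \<le> P.prob {u\<in>space P. linear_path u}"
  proof (intro P.finite_measure_mono subsetI CollectI conjI)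
    fix u assume u: "u \<in> (\<Inter>j. {u\<in>space P. survives j u})"
    obtain c :: nat where c: "real k * (C + \<bar>\<eta>\<bar>) \<le> real c" using real_arch_simple by blast
    \<comment> \<open>Since k > 0, surviving n generations reaches beyond level n.\<close>
    have "\<exists>x\<in>level d n. (\<Sum>y\<in>nonroot_ancestors x. \<tau> (u y)) \<le> \<eta> * real n + real c" for n
      using survives_imp_path[of n u n] u k c by fastforce
    then show "linear_path u" unfolding linear_path_def by blast
  qed (use measurable_linear_path in auto)
  finally have pos: "0 < P.prob {u\<in>space P. linear_path u}" using survival_bound(1) by linarith
  define p where "p = P.prob {u\<in>space P. \<not> linear_path u}"
  have nodes01: "[0] \<in> nodes d" "[1] \<in> nodes d" using arity by (auto simp: nodes_def)
  have [measurable]: "shift [0] \<in> measurable P P" "shift [1] \<in> measurable P P"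
    using nodes01 by (auto intro: measurable_shift)
  have "p \<le> P.prob {u\<in>space P. \<not> linear_path (shift [0] u) \<and> \<not> linear_path (shift [1] u)}"
    unfolding p_def
  proof (rule P.finite_measure_mono)
    show "{u\<in>space P. \<not> linear_path u} \<subseteq> {u\<in>space P. \<not> linear_path (shift [0] u) \<and> \<not> linear_path (shift [1] u)}"
      using linear_path_shift[OF nodes01(1)] linear_path_shift[OF nodes01(2)] by blast
  qed measurable
  also have "\<dots> = p\<^sup>2"
    unfolding p_def using nodes01 by (intro prob_shift_shift) auto
  finally have "p \<le> p\<^sup>2" .
  moreover have "p = 1 - P.prob {u\<in>space P. linear_path u}"
    unfolding p_def by (rule P.prob_neg) measurable
  ultimately have "p < 1" "p \<le> p * p" using pos by (simp_all add: power2_eq_square)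
  moreover have "0 \<le> p" by (simp add: p_def)
  ultimately have "p = 0"
    using mult_strict_left_mono[of p 1 p] by fastforce
  then have "AE u in P. u \<notin> {u\<in>space P. \<not> linear_path u}"
    unfolding p_def by (subst (asm) P.prob_eq_0) auto
  then show ?thesis using AE_space by eventually_elim auto
qed

end

section \<open>From the product space to the given probability space: the upper bound\<close>

context weighted_tree
begin

lemma distr_U_PiM:
  assumes "V \<subseteq> nodes d" "V \<noteq> {}"
  shows "distr M (PiM V (\<lambda>_. unit_lebesgue)) (\<lambda>\<omega>. \<lambda>y\<in>V. U y \<omega>) = PiM V (\<lambda>_. unit_lebesgue)"
proof -
  have "indep_vars (\<lambda>_. unit_lebesgue) U V" by (rule indep_vars_subset[OF indep assms(1)])
  then have "distr M (PiM V (\<lambda>_. unit_lebesgue)) (\<lambda>\<omega>. \<lambda>y\<in>V. U y \<omega>) = (\<Pi>\<^sub>M i\<in>V. distr M unit_lebesgue (U i))"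
    by (subst (asm) indep_vars_iff_distr_eq_PiM'[OF assms(2)]) (use assms(1) measurable_U in auto)
  also have "\<dots> = PiM V (\<lambda>_. unit_lebesgue)"
    using assms(1) uniform by (intro PiM_cong) auto
  finally show ?thesis .
qed

lemma level_min_le:
  assumes "x \<in> level d n"
  shows "level_min d \<tau> U n \<omega> \<le> (\<Sum>y\<in>nonroot_ancestors x. \<tau> (U y \<omega>))"
  unfolding level_min_def path_sum_def using assms finite_level
  by (intro cINF_lower bdd_below_finite finite_imageI) auto

text \<open>The strict inequality for the mean is the room in which the entropy is pushed strictly
  below ln d; this yields a supercritical block, and percolation of such blocks is carried over to
  \<open>M\<close> by the joint law of the variables at the non-root nodes.\<close>

lemma AE_level_min_linear_bound:
  assumes s: "s \<in> kl_ball d" and less: "ext_integral \<tau> s < ereal \<eta>"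
  shows "AE \<omega> in M. \<exists>c::nat. \<forall>n. level_min d \<tau> U n \<omega> \<le> \<eta> * real n + real c"
proof -
  obtain f where f: "finite_entropy f" "s = density unit_lebesgue f" "rel_entropy f \<le> ln (real d)"
    using kl_ballE[OF s] .
  have su: "s \<in> unit_prob_measures" using s by (simp add: kl_ball_def)
  have "(\<integral>\<^sup>+u. ennreal (- \<tau> u) \<partial>s) \<le> (\<integral>\<^sup>+u. ennreal (max (- \<tau> u) 0) \<partial>s)"
    by (intro nn_integral_mono ennreal_leI) auto
  also have "\<dots> < \<infinity>"
    using integrable_neg_weight[OF f(1)] unfolding f(2) by (subst nn_integral_eq_integral) auto
  finally have i: "integrable s \<tau>"
    using less by (intro integrable_of_ext_integral_less_top)
      (auto simp: borel_measurable_unit_prob_measures[OF su] intro: less_le_trans)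
  then have "integral\<^sup>L s \<tau> < \<eta>" using less by (simp add: ext_integral_eq_integral)
  then have i': "integrable unit_lebesgue (\<lambda>u. f u * \<tau> u)" "(\<integral>u. f u * \<tau> u \<partial>unit_lebesgue) < \<eta>"
    using i unfolding f(2) by (simp_all add: integrable_density_unit[OF finite_entropyD(1)[OF f(1)]])
  have "0 < ln (real d)" using arity by simp
  then obtain g where g: "finite_entropy g" "rel_entropy g < ln (real d)" "integrable unit_lebesgue (\<lambda>u. g u * \<tau> u)"
    "(\<integral>u. g u * \<tau> u \<partial>unit_lebesgue) < \<eta>"
    using decrease_rel_entropy[OF f(1,3) _ measurable_weight i'] by blast
  \<comment> \<open>With c = ln d the factor exp c ^ k is d^k, the number of paths to level k, as
    the percolation argument expects.\<close>
  obtain k C where k: "0 < k" "0 < C"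
    "1 < exp (ln (real d)) ^ k * measure (PiM {..<k} (\<lambda>_. unit_lebesgue))
      {u\<in>space (PiM {..<k} (\<lambda>_. unit_lebesgue)). (\<Sum>i<k. \<tau> (u i)) \<le> real k * \<eta> \<and> (\<forall>i<k. \<tau> (u i) \<le> C)}"
    using exists_supercritical_block[OF g(1,2) measurable_weight g(3,4)] by blast
  interpret B: block_percolation d \<tau> k \<eta> C
    using arity k by unfold_locales auto
  have V: "B.V \<subseteq> nodes d" "B.V \<noteq> {}"
    using B.V_nonempty by (auto simp: B.V_def)
  have D: "distr M B.P (\<lambda>\<omega>. \<lambda>y\<in>B.V. U y \<omega>) = B.P"
    unfolding B.P_def by (rule distr_U_PiM[OF V])
  have "(\<lambda>\<omega>. \<lambda>y\<in>B.V. U y \<omega>) \<in> measurable M B.P"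
    unfolding B.P_def using V(1) by (intro measurable_restrict measurable_U) auto
  moreover have "AE u in distr M B.P (\<lambda>\<omega>. \<lambda>y\<in>B.V. U y \<omega>). B.linear_path u"
    unfolding D by (rule B.AE_linear_path)
  ultimately have "AE \<omega> in M. B.linear_path (\<lambda>y\<in>B.V. U y \<omega>)"
    by (rule AE_distrD)
  then show ?thesis
  proof eventually_elim
    case (elim \<omega>)
    then obtain c :: nat where c: "\<And>n. \<exists>x\<in>level d n. (\<Sum>y\<in>nonroot_ancestors x. \<tau> ((\<lambda>y\<in>B.V. U y \<omega>) y)) \<le> \<eta> * real n + real c"
      unfolding B.linear_path_def by blast
    have "level_min d \<tau> U n \<omega> \<le> \<eta> * real n + real c" for n
    proof -
      obtain x where x: "x \<in> level d n" "(\<Sum>y\<in>nonroot_ancestors x. \<tau> ((\<lambda>y\<in>B.V. U y \<omega>) y)) \<le> \<eta> * real n + real c"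
        using c by blast
      have "(\<Sum>y\<in>nonroot_ancestors x. \<tau> ((\<lambda>y\<in>B.V. U y \<omega>) y)) = (\<Sum>y\<in>nonroot_ancestors x. \<tau> (U y \<omega>))"
        using B.nonroot_ancestors_subset_V[of x] x(1) by (intro sum.cong) auto
      then show ?thesis using level_min_le[OF x(1), of \<omega>] x(2) by simp
    qed
    then show ?case by blast
  qed
qed

end

section \<open>The variational formula and its minimizers\<close>

text \<open>The supremum of the almost sure lower bounds is reached along a sequence, so countably
  many null sets suffice.\<close>

lemma ess_inf_AE: "AE t in L. ess_inf L \<le> ereal t"
proof -
  let ?A = "{z. AE t in L. z \<le> ereal t}"
  have "-\<infinity> \<in> ?A" by simp
  then obtain f :: "nat \<Rightarrow> ereal" where f: "range f \<subseteq> ?A" "Sup ?A = (SUP i. f i)"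
    using Sup_countable_SUP[of ?A] by blast
  then have "AE t in L. \<forall>i. f i \<le> ereal t" unfolding AE_all_countable by blast
  then show ?thesis unfolding ess_inf_eq_Sup f(2) by eventually_elim (auto intro: SUP_least)
qed

lemma ess_inf_greatest: "AE t in L. z \<le> ereal t \<Longrightarrow> z \<le> ess_inf L"
  unfolding ess_inf_eq_Sup by (intro Sup_upper) simp

context weighted_tree
begin

text \<open>\<open>real_of_ereal\<close> would turn an infinite infimum into 0;
  \<open>ereal_opt_value\<close> shows that the infimum is finite.\<close>

definition opt_value :: real where
  "opt_value = real_of_ereal (INF s\<in>kl_ball d. ext_integral \<tau> s)"

lemma density_in_kl_ball:
  assumes "finite_entropy f" "rel_entropy f \<le> ln (real d)"
  shows "density unit_lebesgue f \<in> kl_ball d"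
  using assms unit_prob_measures_density[OF finite_entropyD(1)[OF assms(1)]]
  by (simp add: kl_ball_def kl_div_density)

lemma exists_finite_in_kl_ball: "\<exists>s\<in>kl_ball d. ext_integral \<tau> s < \<infinity>"
proof -
  have "0 < ln (real d)" using arity by simp
  then obtain f where f: "finite_entropy f" "rel_entropy f < ln (real d)" "integrable unit_lebesgue (\<lambda>u. f u * \<tau> u)"
    using exists_bounded_uniform_density[OF measurable_weight] by blast
  then have "integrable (density unit_lebesgue f) \<tau>"
    by (simp add: integrable_density_unit[OF finite_entropyD(1)[OF f(1)]])
  then show ?thesis
    using density_in_kl_ball[OF f(1)] f(2) by (intro bexI) (auto simp: ext_integral_eq_integral)
qed

text \<open>Young's inequality between the density and the negative part of the weight, integrated,
  bounds the mean of the negative part by ln d plus its first exponential moment, uniformly over the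
  entropy ball.\<close>

lemma ext_integral_bounded_below:
  assumes s: "s \<in> kl_ball d"
  shows "ereal (- (ln (real d) + (\<integral>u. exp (max (- \<tau> u) 0) \<partial>unit_lebesgue))) \<le> ext_integral \<tau> s"
proof -
  obtain f where f: "finite_entropy f" "s = density unit_lebesgue f" "rel_entropy f \<le> ln (real d)"
    using kl_ballE[OF s] .
  note D = prob_densityD[OF finite_entropyD(1)[OF f(1)]]
  define Z where "Z = (\<integral>u. exp (max (- \<tau> u) 0) \<partial>unit_lebesgue)"
  have e: "integrable unit_lebesgue (\<lambda>u. exp (max (- \<tau> u) 0))" using exp_moment[of 1] by simp
  have neg: "integrable unit_lebesgue (\<lambda>u. f u * max (- \<tau> u) 0)"
    using integrable_mult_of_exp[OF f(1) _ _ e] by simp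
  have "(\<integral>u. f u * max (- \<tau> u) 0 \<partial>unit_lebesgue) \<le> (\<integral>u. f u * ln (f u) - f u + exp (max (- \<tau> u) 0) \<partial>unit_lebesgue)"
    using neg e D(2) finite_entropyD(2)[OF f(1)] mult_le_entropy_plus_exp[OF D(1)] by (intro integral_mono) auto
  also have "\<dots> = rel_entropy f - 1 + Z"
    using e D(2,3) finite_entropyD(2)[OF f(1)] by (simp add: rel_entropy_def Z_def)
  finally have le: "(\<integral>u. max (- \<tau> u) 0 \<partial>s) \<le> ln (real d) + Z"
    using f(3) unfolding f(2) by (simp add: integrable_density_unit[OF finite_entropyD(1)[OF f(1)]])
  have "(\<integral>\<^sup>+u. ennreal (- \<tau> u) \<partial>s) \<le> (\<integral>\<^sup>+u. ennreal (max (- \<tau> u) 0) \<partial>s)"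
    by (intro nn_integral_mono ennreal_leI) auto
  also have "\<dots> = ennreal (\<integral>u. max (- \<tau> u) 0 \<partial>s)"
    using integrable_neg_weight[OF f(1)] unfolding f(2) by (subst nn_integral_eq_integral) auto
  also have "\<dots> \<le> ennreal (ln (real d) + Z)" by (rule ennreal_leI[OF le])
  finally have "enn2ereal (\<integral>\<^sup>+u. ennreal (- \<tau> u) \<partial>s) \<le> ereal (ln (real d) + Z)"
  proof -
    assume *: "(\<integral>\<^sup>+u. ennreal (- \<tau> u) \<partial>s) \<le> ennreal (ln (real d) + Z)"
    have "0 \<le> ln (real d) + Z" using arity by (simp add: Z_def)
    then show ?thesis using * by (simp add: less_eq_ennreal.rep_eq enn2ereal_ennreal)
  qed
  then have "- ereal (ln (real d) + Z) \<le> - enn2ereal (\<integral>\<^sup>+u. ennreal (- \<tau> u) \<partial>s)"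
    by (simp only: ereal_minus_le_minus)
  also have "\<dots> = 0 - enn2ereal (\<integral>\<^sup>+u. ennreal (- \<tau> u) \<partial>s)" by simp
  also have "\<dots> \<le> ext_integral \<tau> s"
    unfolding ext_integral_def by (intro ereal_minus_mono) auto
  finally show ?thesis by (simp add: Z_def)
qed

lemma ereal_opt_value: "ereal opt_value = (INF s\<in>kl_ball d. ext_integral \<tau> s)"
proof -
  obtain s where "s \<in> kl_ball d" "ext_integral \<tau> s < \<infinity>" using exists_finite_in_kl_ball by blast
  then have "(INF s\<in>kl_ball d. ext_integral \<tau> s) < \<infinity>"
    by (meson INF_lower le_less_trans)
  moreover have "ereal (- (ln (real d) + (\<integral>u. exp (max (- \<tau> u) 0) \<partial>unit_lebesgue))) \<le> (INF s\<in>kl_ball d. ext_integral \<tau> s)"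
    by (intro INF_greatest ext_integral_bounded_below)
  ultimately show ?thesis unfolding opt_value_def
    by (cases "INF s\<in>kl_ball d. ext_integral \<tau> s") auto
qed

lemma opt_value_le: "s \<in> kl_ball d \<Longrightarrow> ereal opt_value \<le> ext_integral \<tau> s"
  unfolding ereal_opt_value by (rule INF_lower)

text \<open>Compactness provides a weak limit, and the two almost sure statements place it in the
  entropy ball and bound its mean. The lower bound, the existence of minimizers and the subsequence
  claim all rest on this.\<close>

lemma AE_precompact:
  "AE \<omega> in M. \<forall>x l. descending x \<longrightarrow> (\<lambda>k. path_avg \<tau> (x k) \<omega>) \<longlonglongrightarrow> l \<longrightarrow>
    (\<exists>r s. strict_mono r \<and> s \<in> kl_ball d \<and> weak_conv_unit (\<lambda>k. empirical_unit U (x (r k)) \<omega>) s \<and> ext_integral \<tau> s \<le> ereal l)"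
  using AE_weak_limit_in_kl_ball AE_ext_integral_le AE_space
proof eventually_elim
  case (elim \<omega>)
  show ?case
  proof (intro allI impI)
    fix x l assume x: "descending x" and l: "(\<lambda>k. path_avg \<tau> (x k) \<omega>) \<longlonglongrightarrow> l"
    \<comment> \<open>Index 0 is skipped: it may be the root, whose empirical measure has no
      mass.\<close>
    have "empirical_unit U (x (Suc k)) \<omega> \<in> unit_prob_measures" for k
      using descendingD[OF x, of "Suc k"] elim(3) by (intro empirical_unit) auto
    then obtain r s where r: "strict_mono r" and s: "s \<in> unit_prob_measures"
      and conv: "weak_conv_unit (\<lambda>k. empirical_unit U (x (Suc (r k))) \<omega>) s"
      by (rule unit_prob_measures_weakly_compact)
    have sr: "strict_mono (\<lambda>k. Suc (r k))" using r by (auto simp: strict_mono_def)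
    have d: "descending (\<lambda>k. x (Suc (r k)))" by (rule descending_subseq[OF x sr])
    have "s \<in> kl_ball d" using elim(1) d s conv by blast
    moreover have "(\<lambda>k. path_avg \<tau> (x (Suc (r k))) \<omega>) \<longlonglongrightarrow> l"
      using LIMSEQ_subseq_LIMSEQ[OF l sr] by (simp add: comp_def)
    ultimately have "ext_integral \<tau> s \<le> ereal l" using elim(2) d conv by blast
    then show "\<exists>r s. strict_mono r \<and> s \<in> kl_ball d \<and> weak_conv_unit (\<lambda>k. empirical_unit U (x (r k)) \<omega>) s \<and> ext_integral \<tau> s \<le> ereal l"
      using sr \<open>s \<in> kl_ball d\<close> conv by (intro exI[of _ "\<lambda>k. Suc (r k)"] exI[of _ s]) simp
  qed
qed

lemma level_min_attained:
  obtains x where "x \<in> level d n" "level_min d \<tau> U n \<omega> = path_sum \<tau> U x \<omega>"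
proof -
  have "(\<lambda>x. path_sum \<tau> U x \<omega>) ` level d n \<noteq> {}" using level_nonempty[of d n] arity by simp
  then have "level_min d \<tau> U n \<omega> = Min ((\<lambda>x. path_sum \<tau> U x \<omega>) ` level d n)"
    unfolding level_min_def using finite_level by (intro cInf_eq_Min) auto
  also have "\<dots> \<in> (\<lambda>x. path_sum \<tau> U x \<omega>) ` level d n"
    using finite_level level_nonempty[of d n] arity by (intro Min_in) auto
  finally show thesis using that by blast
qed

lemma path_sum_eq: "path_sum \<tau> U x \<omega> / real (length x) = path_avg \<tau> x \<omega>"
  by (simp add: path_sum_def path_avg_def)

text \<open>Realizes the level minima along a \<open>descending\<close> sequence, so that statements
  on arbitrary sequences apply to them. At n = 0 both quotients are 0.\<close>

lemma minimal_path_sequence: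
  obtains x where "descending x" "\<And>n. level_min d \<tau> U n \<omega> / real n = path_avg \<tau> (x n) \<omega>"
proof -
  have "\<forall>n. \<exists>x. x \<in> level d n \<and> level_min d \<tau> U n \<omega> = path_sum \<tau> U x \<omega>"
    using level_min_attained by metis
  then obtain x where x: "\<And>n. x n \<in> level d n" "\<And>n. level_min d \<tau> U n \<omega> = path_sum \<tau> U (x n) \<omega>"
    by metis
  have "level_min d \<tau> U n \<omega> / real n = path_avg \<tau> (x n) \<omega>" for n
    using path_sum_eq[of "x n" \<omega>] x by simp
  moreover have "descending x" using x(1) by (auto simp: descending_def strict_mono_def)
  ultimately show thesis using that by blast
qed

lemma AE_level_min_upper:
  "AE \<omega> in M. \<forall>e>0. \<forall>\<^sub>F n in sequentially. level_min d \<tau> U n \<omega> / real n < opt_value + e"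
proof -
  have "AE \<omega> in M. \<forall>i::nat. \<exists>c::nat. \<forall>n. level_min d \<tau> U n \<omega> \<le> (opt_value + 1 / real (Suc i)) * real n + real c"
    unfolding AE_all_countable
  proof
    fix i :: nat
    have "(INF s\<in>kl_ball d. ext_integral \<tau> s) < ereal (opt_value + 1 / real (Suc i))"
      unfolding ereal_opt_value[symmetric] by simp
    then obtain s where "s \<in> kl_ball d" "ext_integral \<tau> s < ereal (opt_value + 1 / real (Suc i))"
      by (auto simp: INF_less_iff)
    then show "AE \<omega> in M. \<exists>c::nat. \<forall>n. level_min d \<tau> U n \<omega> \<le> (opt_value + 1 / real (Suc i)) * real n + real c"
      by (rule AE_level_min_linear_bound)
  qed
  then show ?thesis
  proof eventually_elim
    case (elim \<omega>)
    show ?case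
    proof (intro allI impI)
      fix e :: real assume "0 < e"
      then obtain i where i: "1 / real (Suc i) < e" using reals_Archimedean by (auto simp: inverse_eq_divide)
      obtain c :: nat where c: "\<And>n. level_min d \<tau> U n \<omega> \<le> (opt_value + 1 / real (Suc i)) * real n + real c"
        using elim by blast
      have "(\<lambda>n. opt_value + 1 / real (Suc i) + real c / real n) \<longlonglongrightarrow> opt_value + 1 / real (Suc i) + 0"
        by (intro tendsto_intros lim_const_over_n)
      then have "\<forall>\<^sub>F n in sequentially. opt_value + 1 / real (Suc i) + real c / real n < opt_value + e"
        using i by (intro order_tendstoD) auto
      then show "\<forall>\<^sub>F n in sequentially. level_min d \<tau> U n \<omega> / real n < opt_value + e"
        using eventually_gt_at_top[of 0]
      proof eventually_elim
        case (elim n)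
        have "level_min d \<tau> U n \<omega> / real n \<le> ((opt_value + 1 / real (Suc i)) * real n + real c) / real n"
          using c by (intro divide_right_mono) auto
        also have "\<dots> = opt_value + 1 / real (Suc i) + real c / real n" using elim by (simp add: add_divide_distrib)
        finally show ?case using elim by linarith
      qed
    qed
  qed
qed

text \<open>For the lower bound, suppose the minima fall below \<open>opt_value - e\<close>
  infinitely often. The Chernoff bound for the negative part keeps the averages bounded below, so a
  subsequence converges to a finite limit, and \<open>AE_precompact\<close> yields a measure in the
  ball with mean below the infimum.\<close>

lemma AE_level_min_tendsto: "AE \<omega> in M. (\<lambda>n. level_min d \<tau> U n \<omega> / real n) \<longlonglongrightarrow> opt_value"
proof -
  define g where "g u = max (- \<tau> u) 0" for u
  have "AE \<omega> in M. chernoff_bounded g \<omega>"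
    using exp_moment[of 1] unfolding g_def by (intro AE_chernoff_bounded) auto
  then show ?thesis using AE_precompact AE_level_min_upper AE_space
  proof eventually_elim
    case (elim \<omega>)
    obtain x where x_desc: "descending x" and avg: "\<And>n. level_min d \<tau> U n \<omega> / real n = path_avg \<tau> (x n) \<omega>"
      using minimal_path_sequence[where \<omega> = \<omega>] by blast
    obtain c where c: "\<forall>\<^sub>F n in sequentially. path_avg g (x n) \<omega> \<le> c"
      using path_avg_chernoff[OF elim(1) x_desc] gt_ex by blast
    have lower: "\<forall>\<^sub>F n in sequentially. - c \<le> path_avg \<tau> (x n) \<omega>"
      using c
    proof eventually_elim
      case (elim n)
      have "path_avg (\<lambda>u. (-1) * g u) (x n) \<omega> \<le> path_avg \<tau> (x n) \<omega>"
        using descendingD(1)[OF x_desc] \<open>\<omega> \<in> space M\<close> by (intro path_avg_mono) (auto simp: g_def)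
      then show ?case using elim unfolding path_avg_linear by linarith
    qed
    have "\<forall>\<^sub>F n in sequentially. opt_value - e < path_avg \<tau> (x n) \<omega>" if "0 < e" for e
    proof (rule ccontr)
      assume "\<not> ?thesis"
      then have "\<exists>\<^sub>F n in sequentially. path_avg \<tau> (x n) \<omega> \<le> opt_value - e"
        by (simp add: frequently_def not_le)
      from frequently_eventually_conj[OF this lower]
      have "\<exists>\<^sub>F n in sequentially. - c \<le> path_avg \<tau> (x n) \<omega> \<and> path_avg \<tau> (x n) \<omega> \<le> opt_value - e"
        by (simp add: conj_commute)
      then have "infinite {n. - c \<le> path_avg \<tau> (x n) \<omega> \<and> path_avg \<tau> (x n) \<omega> \<le> opt_value - e}"
        by (simp add: frequently_cofinite[symmetric] cofinite_eq_sequentially)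
      then obtain r :: "nat \<Rightarrow> nat" where r: "strict_mono r"
        "\<And>n. - c \<le> path_avg \<tau> (x (r n)) \<omega>" "\<And>n. path_avg \<tau> (x (r n)) \<omega> \<le> opt_value - e"
        using infinite_enumerate by blast
      have "bounded (range (\<lambda>n. path_avg \<tau> (x (r n)) \<omega>))"
        using r(2,3) by (intro bounded_subset[OF bounded_closed_interval[of "- c" "opt_value - e"]]) auto
      then obtain l q where q: "strict_mono q" "((\<lambda>n. path_avg \<tau> (x (r n)) \<omega>) \<circ> q) \<longlonglongrightarrow> l"
        using bounded_imp_convergent_subsequence by blast
      have rq: "strict_mono (\<lambda>n. r (q n))" using r(1) q(1) by (auto simp: strict_mono_def)
      have "descending (\<lambda>n. x (r (q n)))" by (rule descending_subseq[OF x_desc rq])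
      moreover have "(\<lambda>n. path_avg \<tau> (x (r (q n))) \<omega>) \<longlonglongrightarrow> l" using q(2) by (simp add: comp_def)
      ultimately obtain s where s: "s \<in> kl_ball d" "ext_integral \<tau> s \<le> ereal l"
        using elim(2) by blast
      have "l \<le> opt_value - e"
        using q(2) by (rule LIMSEQ_le_const2) (use r(3) in auto)
      moreover have "ereal opt_value \<le> ereal l" using opt_value_le[OF s(1)] s(2) by (rule order_trans)
      ultimately show False using \<open>0 < e\<close> by simp
    qed
    note lower_e = this
    show ?case
    proof (rule tendstoI)
      fix e :: real assume "0 < e"
      then have "\<forall>\<^sub>F n in sequentially. level_min d \<tau> U n \<omega> / real n < opt_value + e" using elim(3) by blast
      then show "\<forall>\<^sub>F n in sequentially. dist (level_min d \<tau> U n \<omega> / real n) opt_value < e"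
        using lower_e[OF \<open>0 < e\<close>] by eventually_elim (simp add: avg dist_real_def abs_less_iff)
    qed
  qed
qed

lemma time_constant_eq: "time_constant M d \<tau> U = opt_value"
  unfolding time_constant_def
proof (rule the_equality)
  show "AE \<omega> in M. (\<lambda>n. level_min d \<tau> U n \<omega> / real n) \<longlonglongrightarrow> opt_value"
    by (rule AE_level_min_tendsto)
  fix c assume "AE \<omega> in M. (\<lambda>n. level_min d \<tau> U n \<omega> / real n) \<longlonglongrightarrow> c"
  then have "AE \<omega> in M. c = opt_value"
    using AE_level_min_tendsto by eventually_elim (rule LIMSEQ_unique)
  then show "c = opt_value" by simp
qed

lemma minimizersI: "s \<in> kl_ball d \<Longrightarrow> ext_integral \<tau> s \<le> ereal opt_value \<Longrightarrow> s \<in> minimizers d \<tau> opt_value"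
  using opt_value_le[of s] by (simp add: minimizers_def)

text \<open>A deterministic claim proved through the random tree: for almost every outcome, a weak
  limit along nodes attaining the level minima is a minimizer, and a claim that is almost surely
  true and does not depend on the outcome is true.\<close>

lemma minimizers_nonempty: "minimizers d \<tau> opt_value \<noteq> {}"
proof -
  have "AE \<omega> in M. minimizers d \<tau> opt_value \<noteq> {}"
    using AE_precompact AE_level_min_tendsto
  proof eventually_elim
    case (elim \<omega>)
    obtain x where x: "descending x" "\<And>n. level_min d \<tau> U n \<omega> / real n = path_avg \<tau> (x n) \<omega>"
      using minimal_path_sequence[where \<omega> = \<omega>] by blast
    then have "(\<lambda>n. path_avg \<tau> (x n) \<omega>) \<longlonglongrightarrow> opt_value" using elim(2) by simp
    with x(1) obtain s where "s \<in> kl_ball d" "ext_integral \<tau> s \<le> ereal opt_value"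
      using elim(1) by blast
    then show ?case using minimizersI by auto
  qed
  then show ?thesis by simp
qed

lemma minimizersE:
  assumes "s \<in> minimizers d \<tau> opt_value"
  obtains f where "finite_entropy f" "s = density unit_lebesgue f" "rel_entropy f \<le> ln (real d)"
    "kl_div s unit_lebesgue = ereal (rel_entropy f)" "integrable s \<tau>" "integral\<^sup>L s \<tau> = opt_value"
    "s \<in> unit_prob_measures"
proof -
  have s: "s \<in> kl_ball d" "ext_integral \<tau> s = ereal opt_value" using assms by (auto simp: minimizers_def)
  have su: "s \<in> unit_prob_measures" using s(1) by (simp add: kl_ball_def)
  have "integrable s \<tau> \<and> integral\<^sup>L s \<tau> = opt_value"
    using s(2) by (intro integrable_of_ext_integral_eq) (simp_all add: borel_measurable_unit_prob_measures[OF su])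
  then show thesis using kl_ballE[OF s(1)] that su by metis
qed

lemma cdf_empirical_weight:
  assumes "x \<in> nodes d" "x \<noteq> []" "\<omega> \<in> space M"
  shows "cdf (empirical_weight \<tau> U x \<omega>) t = path_avg (indicator {u\<in>space unit_lebesgue. \<tau> u \<le> t}) x \<omega>"
proof -
  have "cdf (empirical_weight \<tau> U x \<omega>) t = integral\<^sup>L (empirical_weight \<tau> U x \<omega>) (indicator {..t})"
    by (simp add: cdf_def empirical_weight_def)
  also have "\<dots> = (\<Sum>y\<in>nonroot_ancestors x. indicator {..t} (\<tau> (U y \<omega>))) / real (length x)"
    unfolding empirical_weight_def using assms(2) by (intro integral_empirical) auto
  also have "\<dots> = path_avg (indicator {u\<in>space unit_lebesgue. \<tau> u \<le> t}) x \<omega>"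
    unfolding path_avg_def using ancestor_in_unit[OF assms(1,3)]
    by (intro arg_cong2[where f = "(/)"] sum.cong) (auto simp: indicator_def)
  finally show ?thesis .
qed

text \<open>The weight is merely measurable, so the continuous mapping theorem does not apply.
  Indicators of sublevel sets are bounded measurable test functions; rational thresholds keep their
  number countable, and monotonicity reaches every continuity point.\<close>

lemma AE_weak_conv_weights:
  "AE \<omega> in M. \<forall>x s. descending x \<longrightarrow> s \<in> kl_ball d \<longrightarrow>
    weak_conv_unit (\<lambda>k. empirical_unit U (x k) \<omega>) s \<longrightarrow>
    weak_conv_m (\<lambda>k. empirical_weight \<tau> U (x k) \<omega>) (distr s borel \<tau>)"
proof -
  define h :: "real \<Rightarrow> real \<Rightarrow> real" where "h t = indicator {u\<in>space unit_lebesgue. \<tau> u \<le> t}" for t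
  have h_set: "{u\<in>space unit_lebesgue. \<tau> u \<le> t} \<in> sets unit_lebesgue" for t by measurable
  have "AE \<omega> in M. \<forall>q::rat. \<forall>x s. descending x \<longrightarrow> s \<in> kl_ball d \<longrightarrow>
    weak_conv_unit (\<lambda>k. empirical_unit U (x k) \<omega>) s \<longrightarrow>
    (\<lambda>k. path_avg (h (of_rat q)) (x k) \<omega>) \<longlonglongrightarrow> integral\<^sup>L s (h (of_rat q))"
    unfolding AE_all_countable
  proof (intro allI AE_path_avg_tendsto)
    show "h (of_rat q) \<in> borel_measurable unit_lebesgue" for q :: rat
      unfolding h_def by (rule borel_measurable_indicator[OF h_set])
    show "\<bar>h (of_rat q) u\<bar> \<le> 1" for q :: rat and u by (simp add: h_def indicator_def)
  qed
  then show ?thesis using AE_space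
  proof eventually_elim
    case (elim \<omega>)
    show ?case
    proof (intro allI impI)
      fix x s assume x: "descending x" and s: "s \<in> kl_ball d"
        and conv: "weak_conv_unit (\<lambda>k. empirical_unit U (x k) \<omega>) s"
      have su: "s \<in> unit_prob_measures" using s by (simp add: kl_ball_def)
      have \<tau>s: "\<tau> \<in> borel_measurable s" using measurable_weight by (simp add: borel_measurable_unit_prob_measures[OF su])
      define F where "F = cdf (distr s borel \<tau>)"
      have F: "F t = integral\<^sup>L s (h t)" for t
      proof -
        have "F t = measure s (\<tau> -` {..t} \<inter> space s)"
          unfolding F_def cdf_def by (rule measure_distr[OF \<tau>s]) simp
        also have "\<tau> -` {..t} \<inter> space s = {u\<in>space unit_lebesgue. \<tau> u \<le> t} \<inter> space s"
          using sets_eq_imp_space_eq[OF sets_unit_prob_measures[OF su]] by auto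
        finally show ?thesis by (simp add: h_def)
      qed
      have Fq: "(\<lambda>k. path_avg (h (of_rat q)) (x k) \<omega>) \<longlonglongrightarrow> F (of_rat q)" for q
        unfolding F using elim(1) x s conv by blast
      show "weak_conv_m (\<lambda>k. empirical_weight \<tau> U (x k) \<omega>) (distr s borel \<tau>)"
        unfolding weak_conv_m_def weak_conv_def F_def[symmetric]
      proof (intro allI impI tendstoI)
        fix t e :: real assume cont: "isCont F t" and "0 < e"
        obtain \<delta> where \<delta>: "0 < \<delta>" "\<And>y. \<bar>y - t\<bar> < \<delta> \<Longrightarrow> \<bar>F y - F t\<bar> < e / 2"
          using cont[unfolded continuous_at_eps_delta, rule_format, of "e / 2"] \<open>0 < e\<close>
          by (auto simp: dist_real_def)
        \<comment> \<open>Rational thresholds on both sides of \<open>t\<close>, close enough that F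
          changes by less than e/2; the empirical distribution function at \<open>t\<close> lies
          between its values there.\<close>
        obtain q1 where q1: "t - \<delta> < of_rat q1" "of_rat q1 < t" using of_rat_dense[of "t - \<delta>" t] \<delta>(1) by auto
        obtain q2 where q2: "t < of_rat q2" "of_rat q2 < t + \<delta>" using of_rat_dense[of t "t + \<delta>"] \<delta>(1) by auto
        have "\<forall>\<^sub>F k in sequentially. dist (path_avg (h (of_rat q1)) (x k) \<omega>) (F (of_rat q1)) < e / 2"
          "\<forall>\<^sub>F k in sequentially. dist (path_avg (h (of_rat q2)) (x k) \<omega>) (F (of_rat q2)) < e / 2"
          by (rule tendstoD[OF Fq], use \<open>0 < e\<close> in simp)+
        then show "\<forall>\<^sub>F k in sequentially. dist (cdf (empirical_weight \<tau> U (x k) \<omega>) t) (F t) < e"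
          using eventually_gt_at_top[of 0]
        proof eventually_elim
          case (elim k)
          have "cdf (empirical_weight \<tau> U (x k) \<omega>) t = path_avg (h t) (x k) \<omega>"
            unfolding h_def using descendingD[OF x, of k] elim(3) \<open>\<omega> \<in> space M\<close> by (intro cdf_empirical_weight) auto
          moreover have "path_avg (h (of_rat q1)) (x k) \<omega> \<le> path_avg (h t) (x k) \<omega>"
            "path_avg (h t) (x k) \<omega> \<le> path_avg (h (of_rat q2)) (x k) \<omega>"
            using descendingD(1)[OF x, of k] \<open>\<omega> \<in> space M\<close> q1 q2
            by (auto intro!: path_avg_mono simp: h_def indicator_def)
          moreover have "\<bar>F (of_rat q1) - F t\<bar> < e / 2" "\<bar>F (of_rat q2) - F t\<bar> < e / 2"
            by (rule \<delta>(2), use q1 q2 in \<open>simp add: abs_less_iff\<close>)+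
          ultimately show ?case using elim(1,2) unfolding dist_real_def by linarith
        qed
      qed
    qed
  qed
qed

lemma AE_convergence_to_minimizers:
  "AE \<omega> in M. \<forall>n x. strict_mono n \<longrightarrow>
     (\<forall>k. x k \<in> nodes d \<and> length (x k) = n k) \<longrightarrow>
     (\<lambda>k. path_sum \<tau> U (x k) \<omega> / real (n k)) \<longlonglongrightarrow> opt_value \<longrightarrow>
     (\<exists>r. strict_mono r \<and>
        (\<exists>\<sigma>\<in>minimizers d \<tau> opt_value. weak_conv_unit (\<lambda>j. empirical_unit U (x (r j)) \<omega>) \<sigma>)) \<and>
     (\<forall>r. strict_mono r \<longrightarrow>
        (\<forall>\<sigma>\<in>minimizers d \<tau> opt_value. weak_conv_unit (\<lambda>j. empirical_unit U (x (r j)) \<omega>) \<sigma> \<longrightarrow>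
           weak_conv_m (\<lambda>j. empirical_weight \<tau> U (x (r j)) \<omega>) (distr \<sigma> borel \<tau>)))"
  using AE_precompact AE_weak_conv_weights
proof eventually_elim
  case (elim \<omega>)
  show ?case
  proof (intro allI impI)
    fix n :: "nat \<Rightarrow> nat" and x
    assume n: "strict_mono n" and x: "\<forall>k. x k \<in> nodes d \<and> length (x k) = n k"
      and lim: "(\<lambda>k. path_sum \<tau> U (x k) \<omega> / real (n k)) \<longlonglongrightarrow> opt_value"
    have desc: "descending x" using n x by (auto simp: descending_def)
    have "(\<lambda>k. path_avg \<tau> (x k) \<omega>) \<longlonglongrightarrow> opt_value"
      using lim x by (simp add: path_sum_eq[symmetric])
    then have "\<exists>r s. strict_mono r \<and> s \<in> kl_ball d \<and> weak_conv_unit (\<lambda>k. empirical_unit U (x (r k)) \<omega>) s \<and> ext_integral \<tau> s \<le> ereal opt_value"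
      using elim(1) desc by blast
    then have 1: "\<exists>r. strict_mono r \<and>
        (\<exists>\<sigma>\<in>minimizers d \<tau> opt_value. weak_conv_unit (\<lambda>j. empirical_unit U (x (r j)) \<omega>) \<sigma>)"
      using minimizersI by blast
    have 2: "weak_conv_m (\<lambda>j. empirical_weight \<tau> U (x (r j)) \<omega>) (distr \<sigma> borel \<tau>)"
      if "strict_mono r" "\<sigma> \<in> minimizers d \<tau> opt_value" "weak_conv_unit (\<lambda>j. empirical_unit U (x (r j)) \<omega>) \<sigma>" for r \<sigma>
      using elim(2) descending_subseq[OF desc that(1)] that(2,3) by (simp add: minimizers_def)
    show "(\<exists>r. strict_mono r \<and>
        (\<exists>\<sigma>\<in>minimizers d \<tau> opt_value. weak_conv_unit (\<lambda>j. empirical_unit U (x (r j)) \<omega>) \<sigma>)) \<and>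
     (\<forall>r. strict_mono r \<longrightarrow>
        (\<forall>\<sigma>\<in>minimizers d \<tau> opt_value. weak_conv_unit (\<lambda>j. empirical_unit U (x (r j)) \<omega>) \<sigma> \<longrightarrow>
           weak_conv_m (\<lambda>j. empirical_weight \<tau> U (x (r j)) \<omega>) (distr \<sigma> borel \<tau>)))"
      using 1 2 by blast
  qed
qed

section \<open>The essential infimum and uniqueness of the minimizer\<close>

abbreviation b :: ereal where "b \<equiv> ess_inf (distr unit_lebesgue borel \<tau>)"

lemma AE_ess_inf_le: "AE u in unit_lebesgue. b \<le> ereal (\<tau> u)"
  using ess_inf_AE[of "distr unit_lebesgue borel \<tau>"] by (rule AE_distrD[OF measurable_weight])

lemma le_ess_inf: "AE u in unit_lebesgue. z \<le> ereal (\<tau> u) \<Longrightarrow> z \<le> b"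
  by (intro ess_inf_greatest) (simp add: AE_distr_iff)

lemma ess_inf_not_top: "b \<noteq> \<infinity>"
proof
  assume "b = \<infinity>"
  then have "AE u in unit_lebesgue. False" using AE_ess_inf_le by simp
  then show False using unit_lebesgue.AE_const[of False] by simp
qed

lemma prob_weight_eq:
  assumes "x \<in> nodes d"
  shows "measure M {\<omega>\<in>space M. ereal (\<tau> (U x \<omega>)) = z} = measure unit_lebesgue {u\<in>space unit_lebesgue. ereal (\<tau> u) = z}"
proof -
  have S: "{u\<in>space unit_lebesgue. ereal (\<tau> u) = z} \<in> sets unit_lebesgue" by measurable
  have "measure unit_lebesgue {u\<in>space unit_lebesgue. ereal (\<tau> u) = z}
      = measure (distr M unit_lebesgue (U x)) {u\<in>space unit_lebesgue. ereal (\<tau> u) = z}"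
    using uniform[OF assms] by simp
  also have "\<dots> = measure M (U x -` {u\<in>space unit_lebesgue. ereal (\<tau> u) = z} \<inter> space M)"
    by (rule measure_distr[OF measurable_U[OF assms] S])
  also have "U x -` {u\<in>space unit_lebesgue. ereal (\<tau> u) = z} \<inter> space M = {\<omega>\<in>space M. ereal (\<tau> (U x \<omega>)) = z}"
    using measurable_space[OF measurable_U[OF assms]] by auto
  finally show ?thesis by simp
qed

lemma AE_unit_imp_AE_density:
  assumes "prob_density f" "AE u in unit_lebesgue. Q u"
  shows "AE u in density unit_lebesgue f. Q u"
  using assms(2) prob_densityD(4)[OF assms(1)] by (subst AE_density) (auto elim: eventually_mono)

text \<open>The uniform law on the atom has entropy at most ln d, so the optimal value is at most
  the essential infimum. A minimizer is absolutely continuous and the weight is almost surely at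
  least that infimum, so a mean not above it leaves only equality almost surely.\<close>

lemma minimizers_atom:
  assumes atom: "1 / real d \<le> measure unit_lebesgue {u\<in>space unit_lebesgue. ereal (\<tau> u) = b}"
    and s: "s \<in> minimizers d \<tau> opt_value"
  shows "distr s borel \<tau> = return borel (real_of_ereal b)"
proof -
  define B where "B = {u\<in>space unit_lebesgue. ereal (\<tau> u) = b}"
  define f where "f = uniform_density B"
  have B: "B \<in> sets unit_lebesgue" unfolding B_def by measurable
  have "0 < 1 / real d" using arity by simp
  then have pos: "0 < measure unit_lebesgue B" "1 / real d \<le> measure unit_lebesgue B"
    using atom by (auto simp only: B_def)
  \<comment> \<open>A point of the atom shows that the essential infimum is finite.\<close>
  then have "B \<noteq> {}" by auto
  then obtain u0 where "ereal (\<tau> u0) = b" unfolding B_def by blast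
  then obtain b0 where b0: "b = ereal b0" by metis
  have f: "finite_entropy f" "rel_entropy f = - ln (measure unit_lebesgue B)"
    using finite_entropy_uniform_on[OF B pos(1)] by (simp_all add: f_def)
  have "ln (1 / real d) \<le> ln (measure unit_lebesgue B)" using pos arity by simp
  then have "rel_entropy f \<le> ln (real d)" using arity by (simp add: f ln_div)
  note fk = density_in_kl_ball[OF f(1) this]
  note D = prob_densityD[OF finite_entropyD(1)[OF f(1)]]
  have eq: "f u * \<tau> u = b0 * f u" for u by (simp add: f_def uniform_density_def B_def b0 indicator_def)
  have "integrable (density unit_lebesgue f) \<tau>" "integral\<^sup>L (density unit_lebesgue f) \<tau> = b0"
    using D(2,3) by (simp_all add: integrable_density_unit[OF finite_entropyD(1)[OF f(1)]] eq)
  then have "opt_value \<le> b0" using opt_value_le[OF fk] by (simp add: ext_integral_eq_integral)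
  obtain g where g: "finite_entropy g" "s = density unit_lebesgue g" "integrable s \<tau>" "integral\<^sup>L s \<tau> = opt_value"
    "s \<in> unit_prob_measures" using minimizersE[OF s] .
  interpret s: prob_space s using g(5) by (simp add: unit_prob_measures_def)
  have "AE u in unit_lebesgue. b0 \<le> \<tau> u" using AE_ess_inf_le by (simp add: b0)
  then have ge: "AE u in s. b0 \<le> \<tau> u"
    unfolding g(2) by (rule AE_unit_imp_AE_density[OF finite_entropyD(1)[OF g(1)]])
  have int: "integrable s (\<lambda>u. \<tau> u - b0)" using g(3) by simp
  have "(\<integral>u. \<tau> u - b0 \<partial>s) = opt_value - b0" using g(3,4) s.prob_space by simp
  moreover have "0 \<le> (\<integral>u. \<tau> u - b0 \<partial>s)"
    using ge by (intro integral_nonneg_AE) (auto elim: eventually_mono)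
  ultimately have "(\<integral>u. \<tau> u - b0 \<partial>s) = 0" using \<open>opt_value \<le> b0\<close> by simp
  then have "AE u in s. \<tau> u - b0 = 0"
    using ge by (subst (asm) integral_nonneg_eq_0_iff_AE[OF int]) (auto elim: eventually_mono)
  then have "distr s borel \<tau> = distr s borel (\<lambda>_. b0)"
    using measurable_weight
    by (intro distr_cong_AE) (auto simp: borel_measurable_unit_prob_measures[OF g(5)] elim: eventually_mono)
  also have "\<dots> = return borel b0" by (rule s.distr_const) simp
  finally show ?thesis by (simp add: b0)
qed

text \<open>Otherwise a minimizer is concentrated on the set \<open>\<tau> = opt_value\<close>, whose measure is then at least
  \<open>1 / d\<close> by the entropy bound, and \<open>opt_value\<close> is the essential infimum.\<close>

lemma measure_below_opt_value_pos:
  assumes no_atom: "measure unit_lebesgue {u\<in>space unit_lebesgue. ereal (\<tau> u) = b} < 1 / real d"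
  shows "0 < measure unit_lebesgue {u\<in>space unit_lebesgue. \<tau> u < opt_value}"
proof (rule ccontr)
  assume "\<not> ?thesis"
  then have "measure unit_lebesgue {u\<in>space unit_lebesgue. \<tau> u < opt_value} = 0" by (simp add: less_le)
  then have "AE u in unit_lebesgue. u \<notin> {u\<in>space unit_lebesgue. \<tau> u < opt_value}"
    by (subst (asm) unit_lebesgue.prob_eq_0) measurable
  then have ge: "AE u in unit_lebesgue. opt_value \<le> \<tau> u"
    using AE_space[of unit_lebesgue] by eventually_elim auto
  then have vb: "ereal opt_value \<le> b" by (intro le_ess_inf) simp
  obtain s where s: "s \<in> minimizers d \<tau> opt_value" using minimizers_nonempty by blast
  obtain f where f: "finite_entropy f" "s = density unit_lebesgue f" "rel_entropy f \<le> ln (real d)"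
    "integrable s \<tau>" "integral\<^sup>L s \<tau> = opt_value" "s \<in> unit_prob_measures" using minimizersE[OF s] .
  note D = prob_densityD[OF finite_entropyD(1)[OF f(1)]]
  interpret s: prob_space s using f(6) by (simp add: unit_prob_measures_def)
  have ge_s: "AE u in s. opt_value \<le> \<tau> u"
    unfolding f(2) by (rule AE_unit_imp_AE_density[OF finite_entropyD(1)[OF f(1)] ge])
  have int: "integrable s (\<lambda>u. \<tau> u - opt_value)" using f(4) by simp
  have "(\<integral>u. \<tau> u - opt_value \<partial>s) = 0" using f(4,5) s.prob_space by simp
  then have "AE u in s. \<tau> u - opt_value = 0"
    using ge_s by (subst (asm) integral_nonneg_eq_0_iff_AE[OF int]) (auto elim: eventually_mono)
  then have conc: "AE u in unit_lebesgue. 0 < f u \<longrightarrow> \<tau> u = opt_value"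
    unfolding f(2) using D(4) by (subst (asm) AE_density) auto
  define A where "A = {u\<in>space unit_lebesgue. \<tau> u = opt_value}"
  define q where "q = measure unit_lebesgue A"
  have A: "A \<in> sets unit_lebesgue" unfolding A_def by measurable
  have f_A: "AE u in unit_lebesgue. f u = indicator A u * f u"
    using conc AE_space
    by eventually_elim (use D(1) in \<open>auto simp: A_def indicator_def less_le\<close>)
  have "q \<noteq> 0"
  proof
    assume "q = 0"
    then have "AE u in unit_lebesgue. u \<notin> A" using A unfolding q_def by (subst (asm) unit_lebesgue.prob_eq_0)
    then have "AE u in unit_lebesgue. f u = 0" using f_A by eventually_elim simp
    then have "(\<integral>u. f u \<partial>unit_lebesgue) = 0" by (rule integral_eq_zero_AE)
    then show False using D(3) by simp
  qed
  then have "0 < q" by (simp add: q_def less_le)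
  have intA: "integrable unit_lebesgue (\<lambda>u. indicator A u / q)"
    using A by (simp add: less_top[symmetric])
  \<comment> \<open>A law concentrated on \<open>A\<close> has entropy at least -ln q: integrate
    Young's inequality with the constant slope -ln q on \<open>A\<close>; outside \<open>A\<close>
    both sides vanish.\<close>
  have "- ln q = (\<integral>u. - ln q * f u \<partial>unit_lebesgue)" using D(2,3) by simp
  also have "\<dots> \<le> (\<integral>u. f u * ln (f u) - f u + indicator A u / q \<partial>unit_lebesgue)"
  proof (rule integral_mono_AE)
    show "AE u in unit_lebesgue. - ln q * f u \<le> f u * ln (f u) - f u + indicator A u / q"
      using f_A
    proof eventually_elim
      case (elim u)
      show ?case
      proof (cases "u \<in> A")
        case True
        then show ?thesis
          using mult_le_entropy_plus_exp[OF D(1)[of u], of "- ln q"] \<open>0 < q\<close>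
          by (simp add: exp_minus field_simps)
      next
        case False
        then show ?thesis using elim by simp
      qed
    qed
  qed (use D(2) finite_entropyD(2)[OF f(1)] intA in auto)
  also have "\<dots> = rel_entropy f - 1 + q / q"
    using D(2,3) finite_entropyD(2)[OF f(1)] intA sets.sets_into_space[OF A]
    by (simp add: rel_entropy_def q_def Int_absorb2)
  finally have "- ln q \<le> ln (real d)" using f(3) \<open>0 < q\<close> by simp
  then have "ln (1 / real d) \<le> ln q" using arity by (simp add: ln_div)
  then have "1 / real d \<le> q" using \<open>0 < q\<close> arity by (subst (asm) ln_le_cancel_iff) auto
  moreover have "b = ereal opt_value"
  proof (rule antisym[OF _ vb])
    show "b \<le> ereal opt_value"
    proof (rule ccontr)
      assume "\<not> b \<le> ereal opt_value"
      have "AE u in unit_lebesgue. u \<notin> A"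
        using AE_ess_inf_le by eventually_elim (use \<open>\<not> b \<le> ereal opt_value\<close> in \<open>auto simp: A_def\<close>)
      then show False using A \<open>q \<noteq> 0\<close> unfolding q_def by (simp add: unit_lebesgue.prob_eq_0)
    qed
  qed
  ultimately show False using no_atom by (simp add: q_def A_def)
qed

lemma rel_entropy_ge_of_opt_value:
  assumes no_atom: "measure unit_lebesgue {u\<in>space unit_lebesgue. ereal (\<tau> u) = b} < 1 / real d"
    and f: "finite_entropy f" "integrable unit_lebesgue (\<lambda>u. f u * \<tau> u)" "(\<integral>u. f u * \<tau> u \<partial>unit_lebesgue) = opt_value"
  shows "ln (real d) \<le> rel_entropy f"
proof (rule ccontr)
  assume "\<not> ?thesis"
  then have less: "rel_entropy f < ln (real d)" by simp
  define B where "B = {u\<in>space unit_lebesgue. \<tau> u < opt_value}"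
  define g where "g = uniform_density B"
  have B: "B \<in> sets unit_lebesgue" unfolding B_def by measurable
  have pos: "0 < measure unit_lebesgue B" using measure_below_opt_value_pos[OF no_atom] by (simp only: B_def)
  have g: "finite_entropy g"
    using finite_entropy_uniform_on[OF B pos] by (simp add: g_def)
  note G = prob_densityD[OF finite_entropyD(1)[OF g]]
  define s where "s = density unit_lebesgue g"
  have su: "s \<in> unit_prob_measures" unfolding s_def by (rule unit_prob_measures_density[OF finite_entropyD(1)[OF g]])
  interpret s: prob_space s using su by (simp add: unit_prob_measures_def)
  have "AE u in s. 0 < g u" unfolding s_def using G(4) by (rule AE_density_pos)
  then have below: "AE u in s. \<tau> u < opt_value"
  proof eventually_elim
    case (elim u)
    then have "u \<in> B" by (cases "u \<in> B") (auto simp: g_def uniform_density_def)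
    then show ?case by (simp add: B_def)
  qed
  have neg: "integrable s (\<lambda>u. max (- \<tau> u) 0)" unfolding s_def by (rule integrable_neg_weight[OF g])
  \<comment> \<open>On \<open>B\<close> the weight is below the optimal value, and its negative part
    is integrable, so the weight is dominated in absolute value.\<close>
  have "integrable s (\<lambda>u. \<bar>opt_value\<bar> + max (- \<tau> u) 0)" using neg by simp
  then have i: "integrable s \<tau>"
  proof (rule Bochner_Integration.integrable_bound)
    show "\<tau> \<in> borel_measurable s"
      using measurable_weight by (simp add: borel_measurable_unit_prob_measures[OF su])
    show "AE u in s. norm (\<tau> u) \<le> norm (\<bar>opt_value\<bar> + max (- \<tau> u) 0)"
      using below by eventually_elim auto
  qed
  then have "integral\<^sup>L s \<tau> < opt_value" using below by (intro s.expectation_less) auto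
  then have gi: "integrable unit_lebesgue (\<lambda>u. g u * \<tau> u)" "(\<integral>u. g u * \<tau> u \<partial>unit_lebesgue) < opt_value"
    using i unfolding s_def by (simp_all add: integrable_density_unit[OF finite_entropyD(1)[OF g]])
  \<comment> \<open>The entropy of the uniform law may exceed ln d, so the share is small enough to
    spend only the slack of \<open>f\<close>; any positive share already lowers the mean.\<close>
  obtain t where t: "0 < t" "t \<le> 1" "(1 - t) * rel_entropy f + t * rel_entropy g < ln (real d)"
    using exists_small_convex_weight[OF less] by blast
  define h where "h u = (1 - t) * f u + t * g u" for u
  have h: "finite_entropy h" "rel_entropy h \<le> ln (real d)"
    using finite_entropy_mix(1,2)[OF f(1) g, of t] t by (auto simp: h_def[abs_def])
  have "integrable (density unit_lebesgue h) \<tau>"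
    "integral\<^sup>L (density unit_lebesgue h) \<tau> = (1 - t) * opt_value + t * (\<integral>u. g u * \<tau> u \<partial>unit_lebesgue)"
    using integral_mixture[OF f(2) gi(1), of t, folded h_def] f(3)
    by (simp_all add: integrable_density_unit[OF finite_entropyD(1)[OF h(1)]])
  moreover have "(1 - t) * opt_value + t * (\<integral>u. g u * \<tau> u \<partial>unit_lebesgue) < (1 - t) * opt_value + t * opt_value"
    using t(1) gi(2) by (intro add_strict_left_mono mult_strict_left_mono) auto
  ultimately have "ext_integral \<tau> (density unit_lebesgue h) < ereal opt_value"
    by (simp add: ext_integral_eq_integral algebra_simps)
  then show False using opt_value_le[OF density_in_kl_ball[OF h]] by simp
qed

text \<open>The midpoint of two minimizers has the optimal mean, so its entropy is at least ln d,
  while convexity bounds it by an average of two numbers at most ln d. Equality in the convexity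
  bound makes the densities agree almost everywhere.\<close>

lemma minimizers_unique:
  assumes no_atom: "measure unit_lebesgue {u\<in>space unit_lebesgue. ereal (\<tau> u) = b} < 1 / real d"
    and s: "s \<in> minimizers d \<tau> opt_value" "s' \<in> minimizers d \<tau> opt_value"
  shows "s = s'"
proof -
  obtain f where f: "finite_entropy f" "s = density unit_lebesgue f" "rel_entropy f \<le> ln (real d)"
    "integrable s \<tau>" "integral\<^sup>L s \<tau> = opt_value" using minimizersE[OF s(1)] .
  obtain g where g: "finite_entropy g" "s' = density unit_lebesgue g" "rel_entropy g \<le> ln (real d)"
    "integrable s' \<tau>" "integral\<^sup>L s' \<tau> = opt_value" using minimizersE[OF s(2)] .
  have fi: "integrable unit_lebesgue (\<lambda>u. f u * \<tau> u)" "(\<integral>u. f u * \<tau> u \<partial>unit_lebesgue) = opt_value"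
    using f(4,5) unfolding f(2) by (simp_all add: integrable_density_unit[OF finite_entropyD(1)[OF f(1)]])
  have gi: "integrable unit_lebesgue (\<lambda>u. g u * \<tau> u)" "(\<integral>u. g u * \<tau> u \<partial>unit_lebesgue) = opt_value"
    using g(4,5) unfolding g(2) by (simp_all add: integrable_density_unit[OF finite_entropyD(1)[OF g(1)]])
  define h where "h u = (1 - 1/2) * f u + 1/2 * g u" for u
  note mix = finite_entropy_mix[OF f(1) g(1), of "1/2"]
  have h: "finite_entropy h" "rel_entropy h \<le> (1 - 1/2) * rel_entropy f + 1/2 * rel_entropy g"
    unfolding h_def[abs_def] by (rule mix; simp)+
  have "ln (real d) \<le> rel_entropy h"
    using integral_mixture[OF fi(1) gi(1), of "1/2", folded h_def] fi(2) gi(2)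
    by (intro rel_entropy_ge_of_opt_value[OF no_atom h(1)]) simp_all
  then have "rel_entropy h = (1 - 1/2) * rel_entropy f + 1/2 * rel_entropy g"
    using h(2) f(3) g(3) by simp
  then have "AE u in unit_lebesgue. f u = g u"
    unfolding h_def[abs_def] by (rule mix(3)[rotated 2]) simp_all
  then show ?thesis
    unfolding f(2) g(2)
    using prob_densityD(4)[OF finite_entropyD(1)[OF f(1)]] prob_densityD(4)[OF finite_entropyD(1)[OF g(1)]]
    by (intro density_cong) (auto elim: eventually_mono)
qed

text \<open>Every competitor with the optimal mean has divergence at least ln d, and the minimizer
  has at most ln d. Hence it solves the constrained problem, and any other solution lies in the
  entropy ball and is a minimizer too.\<close>

lemma minimizers_eq_arg_min:
  assumes no_atom: "measure unit_lebesgue {u\<in>space unit_lebesgue. ereal (\<tau> u) = b} < 1 / real d"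
  shows "\<exists>\<sigma>'. minimizers d \<tau> opt_value = {\<sigma>'} \<and>
     {\<sigma>. is_arg_min (\<lambda>\<sigma>. kl_div \<sigma> unit_lebesgue)
            (\<lambda>\<sigma>. \<sigma> \<in> unit_prob_measures \<and> ext_integral \<tau> \<sigma> = ereal opt_value) \<sigma>} = {\<sigma>'}"
proof -
  obtain s where s: "s \<in> minimizers d \<tau> opt_value" using minimizers_nonempty by blast
  then have single: "minimizers d \<tau> opt_value = {s}" using minimizers_unique[OF no_atom] by blast
  have sP: "s \<in> unit_prob_measures" "ext_integral \<tau> s = ereal opt_value" "kl_div s unit_lebesgue \<le> ereal (ln (real d))"
    using s by (auto simp: minimizers_def kl_ball_def)
  have lower: "\<not> kl_div y unit_lebesgue < ereal (ln (real d))"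
    if y: "y \<in> unit_prob_measures" "ext_integral \<tau> y = ereal opt_value" for y
  proof
    assume less: "kl_div y unit_lebesgue < ereal (ln (real d))"
    then have "kl_div y unit_lebesgue < \<infinity>" by (rule less_trans) simp
    then obtain f where f: "finite_entropy f" "y = density unit_lebesgue f" "kl_div y unit_lebesgue = ereal (rel_entropy f)"
      using kl_div_finiteE[OF y(1)] by blast
    have "integrable y \<tau> \<and> integral\<^sup>L y \<tau> = opt_value"
      using y(2) by (intro integrable_of_ext_integral_eq) (simp_all add: borel_measurable_unit_prob_measures[OF y(1)])
    then have "integrable unit_lebesgue (\<lambda>u. f u * \<tau> u)" "(\<integral>u. f u * \<tau> u \<partial>unit_lebesgue) = opt_value"
      unfolding f(2) by (simp_all add: integrable_density_unit[OF finite_entropyD(1)[OF f(1)]])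
    then have "ln (real d) \<le> rel_entropy f" by (rule rel_entropy_ge_of_opt_value[OF no_atom f(1)])
    then show False using less f(3) by simp
  qed
  have "is_arg_min (\<lambda>\<sigma>. kl_div \<sigma> unit_lebesgue)
            (\<lambda>\<sigma>. \<sigma> \<in> unit_prob_measures \<and> ext_integral \<tau> \<sigma> = ereal opt_value) y \<longleftrightarrow> y = s" for y
  proof
    assume "is_arg_min (\<lambda>\<sigma>. kl_div \<sigma> unit_lebesgue)
            (\<lambda>\<sigma>. \<sigma> \<in> unit_prob_measures \<and> ext_integral \<tau> \<sigma> = ereal opt_value) y"
    then have y: "y \<in> unit_prob_measures" "ext_integral \<tau> y = ereal opt_value" "\<not> kl_div s unit_lebesgue < kl_div y unit_lebesgue"
      using sP by (auto simp: is_arg_min_def)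
    then have "kl_div y unit_lebesgue \<le> ereal (ln (real d))" using sP(3) by (auto simp: not_less intro: order_trans)
    then have "y \<in> minimizers d \<tau> opt_value" using y by (simp add: minimizers_def kl_ball_def)
    then show "y = s" using single by simp
  next
    assume "y = s"
    then show "is_arg_min (\<lambda>\<sigma>. kl_div \<sigma> unit_lebesgue)
            (\<lambda>\<sigma>. \<sigma> \<in> unit_prob_measures \<and> ext_integral \<tau> \<sigma> = ereal opt_value) y"
      using sP lower less_le_trans[OF _ sP(3)] by (auto simp: is_arg_min_def)
  qed
  then show ?thesis using single by auto
qed

end

theorem theorem4p1:
  fixes M :: "'w measure" and d :: nat and \<tau> :: "real \<Rightarrow> real"
    and U :: "nat list \<Rightarrow> 'w \<Rightarrow> real"
  defines "\<mu> \<equiv> time_constant M d \<tau> U"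
    and "b \<equiv> ess_inf (distr unit_lebesgue borel \<tau>)"
  assumes "d \<ge> 2"
    and "prob_space M" and "complete_measure M"
    and "prob_space.indep_vars M (\<lambda>_. unit_lebesgue) U (nodes d)"
    and "\<And>x. x \<in> nodes d \<Longrightarrow> distr M unit_lebesgue (U x) = unit_lebesgue"
    and "\<tau> \<in> borel_measurable (restrict_space borel {0..1})"
    and "\<exists>\<alpha>>0. \<exists>\<beta>>1.
      (\<integral>\<^sup>+u. ennreal (exp (\<alpha> * (max (- \<tau> u) 0) powr \<beta>)) \<partial>unit_lebesgue) < \<infinity>"
  shows
    (* (a) *)
    "(AE \<omega> in M. (\<lambda>n. level_min d \<tau> U n \<omega> / real n) \<longlonglongrightarrow> \<mu>) \<and>
     ereal \<mu> = (INF \<sigma>\<in>kl_ball d. ext_integral \<tau> \<sigma>) \<and>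
     \<comment> \<open>(b)\<close>
     minimizers d \<tau> \<mu> \<noteq> {} \<and>
     \<comment> \<open>(c)\<close>
     (AE \<omega> in M. \<forall>n x. strict_mono n \<longrightarrow>
       (\<forall>k. x k \<in> nodes d \<and> length (x k) = n k) \<longrightarrow>
       (\<lambda>k. path_sum \<tau> U (x k) \<omega> / real (n k)) \<longlonglongrightarrow> \<mu> \<longrightarrow>
       (\<exists>r. strict_mono r \<and>
          (\<exists>\<sigma>\<in>minimizers d \<tau> \<mu>. weak_conv_unit (\<lambda>j. empirical_unit U (x (r j)) \<omega>) \<sigma>)) \<and>
       (\<forall>r. strict_mono r \<longrightarrow>
          (\<forall>\<sigma>\<in>minimizers d \<tau> \<mu>. weak_conv_unit (\<lambda>j. empirical_unit U (x (r j)) \<omega>) \<sigma> \<longrightarrow>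
             weak_conv_m (\<lambda>j. empirical_weight \<tau> U (x (r j)) \<omega>) (distr \<sigma> borel \<tau>)))) \<and>
     \<comment> \<open>(d)\<close>
     b \<noteq> \<infinity> \<and>
     (\<forall>x\<in>nodes d.
       (measure M {\<omega>\<in>space M. ereal (\<tau> (U x \<omega>)) = b} \<ge> 1 / real d \<longrightarrow>
          (\<forall>\<sigma>\<in>minimizers d \<tau> \<mu>. distr \<sigma> borel \<tau> = return borel (real_of_ereal b))) \<and>
       (measure M {\<omega>\<in>space M. ereal (\<tau> (U x \<omega>)) = b} < 1 / real d \<longrightarrow>
          (\<exists>\<sigma>'. minimizers d \<tau> \<mu> = {\<sigma>'} \<and>
             {\<sigma>. is_arg_min (\<lambda>\<sigma>. kl_div \<sigma> unit_lebesgue)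
                    (\<lambda>\<sigma>. \<sigma> \<in> unit_prob_measures \<and> ext_integral \<tau> \<sigma> = ereal \<mu>) \<sigma>} = {\<sigma>'})))"
proof -
  have \<tau> [measurable]: "\<tau> \<in> borel_measurable unit_lebesgue"
    using assms(8) by (simp add: borel_measurable_unit_lebesgue)
  obtain \<alpha> \<beta> where "0 < \<alpha>" "1 < \<beta>"
    "(\<integral>\<^sup>+u. ennreal (exp (\<alpha> * (max (- \<tau> u) 0) powr \<beta>)) \<partial>unit_lebesgue) < \<infinity>"
    using assms(9) by blast
  then have exp: "integrable unit_lebesgue (\<lambda>u. exp (\<theta> * max (- \<tau> u) 0))" for \<theta>
    by (intro integrable_exp_of_powr) auto
  interpret prob_space M by fact
  interpret weighted_tree M d U \<tau>
    using assms(3,6,7) \<tau> exp by unfold_locales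
  have \<mu>: "\<mu> = opt_value" unfolding \<mu>_def by (rule time_constant_eq)
  \<comment> \<open>The probability at a node is replaced by the Lebesgue measure of the level set,
    which does not depend on the node.\<close>
  have "(1 / real d \<le> measure M {\<omega>\<in>space M. ereal (\<tau> (U x \<omega>)) = b} \<longrightarrow>
          (\<forall>\<sigma>\<in>minimizers d \<tau> opt_value. distr \<sigma> borel \<tau> = return borel (real_of_ereal b))) \<and>
       (measure M {\<omega>\<in>space M. ereal (\<tau> (U x \<omega>)) = b} < 1 / real d \<longrightarrow>
          (\<exists>\<sigma>'. minimizers d \<tau> opt_value = {\<sigma>'} \<and>
             {\<sigma>. is_arg_min (\<lambda>\<sigma>. kl_div \<sigma> unit_lebesgue)
                    (\<lambda>\<sigma>. \<sigma> \<in> unit_prob_measures \<and> ext_integral \<tau> \<sigma> = ereal opt_value) \<sigma>} = {\<sigma>'}))"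
    if "x \<in> nodes d" for x
    unfolding prob_weight_eq[OF that] b_def using minimizers_atom minimizers_eq_arg_min by blast
  then show ?thesis
    unfolding \<mu> using AE_level_min_tendsto ereal_opt_value minimizers_nonempty AE_convergence_to_minimizers
      ess_inf_not_top by (simp add: b_def)
qed

end
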